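(* Let $\mathsf{A}=\{A_1,\ldots,A_\ell\} \subset \mathbf{M}_d(\mathbb{C})$, and let $\gamma \in [0,1]$ and $1 \leq i \leq \ell$. Then the following properties are equivalent: (i) For every weakly extremal $x \in \Sigma_{\ell}$ we have $\frac{1}{n}\sum_{k=0}^{n-1}\chi_{[i]}(\sigma^kx) \to \gamma$ as $n\to\infty$. (ii) For every strongly extremal $x \in \Sigma_{\ell}$ we have $\frac{1}{n}\sum_{k=0}^{n-1}\chi_{[i]}(\sigma^kx) \to \gamma$ as $n\to\infty$. (iii) For every ergodic $\mu \in \mathcal{M}_{\max}(\mathsf{A})$ we have $\mu([i])=\gamma$. (iv) For every $\mu \in \mathcal{M}_{\max}(\mathsf{A})$ we have $\mu([i])=\gamma$. Suppose additionally that there exists a Barabanov norm for $\mathsf{A}$. Then each of properties (i)-(iv) is additionally equivalent to the following property: for every Kozyakin extremal $x \in \Sigma_\ell$, we have $\frac{1}{n}\sum_{k=0}^{n-1}\chi_{[i]}(\sigma^kx) \to \gamma$ as $n\to\infty$.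
   Context: $\mathbf{M}_d(\mathbb{C})$ is the set of $d\times d$ complex matrices; $\|\cdot\|$ is the Euclidean norm on $\mathbb{C}^d$ and the induced operator norm. Convention: $\log 0=-\infty$. The joint spectral radius is $\varrho(\mathsf{A})=\lim_{n\to\infty}\max\{\|A_{i_1}\cdots A_{i_n}\|^{1/n}\colon 1\le i_1,\dots,i_n\le\ell\}$. $\Sigma_\ell=\{1,\dots,\ell\}^{\mathbb{N}}$ is the space of one-sided sequences $x=(x_j)_{j=1}^\infty$ with the product topology, $\sigma$ is the shift $(x_j)_{j\ge1}\mapsto(x_{j+1})_{j\ge1}$, and $\mathcal{M}_\sigma$ is the set of $\sigma$-invariant Borel probability measures on $\Sigma_\ell$. $[i]\subset\Sigma_\ell$ is the set of sequences whose first entry equals $i$, and $\chi_{[i]}$ is its characteristic function. For $x\in\Sigma_\ell$, $n\ge1$, $\mathcal{L}_{\mathsf{A}}(x,n):=A_{x_n}\cdots A_{x_1}$. $\mathcal{M}_{\max}(\mathsf{A})$ is the set of $\mu\in\mathcal{M}_\sigma$ with $\inf_{n\ge1}\frac1n\int\log\|\mathcal{L}_{\mathsf{A}}(x,n)\|\,d\mu(x)=\log\varrho(\mathsf{A})$. A point $x$ is strongly extremal if there is $\varepsilon>0$ with $\|\mathcal{L}_{\mathsf{A}}(x,n)\|\ge\varepsilon\varrho(\mathsf{A})^n$ for all $n\ge1$; weakly extremal if $\lim_{n\to\infty}\|\mathcal{L}_{\mathsf{A}}(x,n)\|^{1/n}=\varrho(\mathsf{A})$. A norm $|\!|\!|\cdot|\!|\!|$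 on $\mathbb{C}^d$ is a Barabanov norm for $\mathsf{A}$ if $\varrho(\mathsf{A})|\!|\!|v|\!|\!|=\max_{A\in\mathsf{A}}|\!|\!|Av|\!|\!|$ for all $v\in\mathbb{C}^d$. A point $x$ is Kozyakin extremal if there exist a Barabanov norm $|\!|\!|\cdot|\!|\!|$ for $\mathsf{A}$ and $v\in\mathbb{C}^d$ with $|\!|\!|v|\!|\!|=1$ such that $|\!|\!|\mathcal{L}_{\mathsf{A}}(x,n)v|\!|\!|=\varrho(\mathsf{A})^n$ for all $n\ge1$. *)

theory Defs
  imports "HOL-Probability.Probability"
begin

text \<open>
  The symbols are the natural numbers from 1 to l, and A maps a symbol to a matrix; its values
  at other arguments are irrelevant.  Sequences are indexed from 0, so that
  \<open>x j\<close> is the entry \<open>x\<^sub>j\<^sub>+\<^sub>1\<close> of the one-sided sequence \<open>(x\<^sub>1, x\<^sub>2, \<dots>)\<close>.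
\<close>

definition full_shift :: "nat \<Rightarrow> (nat \<Rightarrow> nat) set" where
  "full_shift l = {x. \<forall>j. x j \<in> {1..l}}"

definition shift :: "(nat \<Rightarrow> nat) \<Rightarrow> (nat \<Rightarrow> nat)" where
  "shift x = (\<lambda>j. x (Suc j))"

definition cyl :: "nat \<Rightarrow> nat \<Rightarrow> (nat \<Rightarrow> nat) set" where
  "cyl l i = {x \<in> full_shift l. x 0 = i}"

text \<open>
  The type \<open>nat \<Rightarrow> nat\<close> carries the product topology of the discrete topology, so the restriction
  of \<open>borel\<close> is the Borel sigma-algebra of the subspace topology on the full shift.
\<close>

definition invariant_measures :: "nat \<Rightarrow> (nat \<Rightarrow> nat) measure set" where
  "invariant_measures l = {\<mu>. prob_space \<mu> \<and>
     sets \<mu> = sets (restrict_space borel (full_shift l)) \<and>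
     (\<forall>B\<in>sets \<mu>. measure \<mu> (shift -` B \<inter> space \<mu>) = measure \<mu> B)}"

definition ergodic :: "(nat \<Rightarrow> nat) measure \<Rightarrow> bool" where
  "ergodic \<mu> \<longleftrightarrow> (\<forall>B\<in>sets \<mu>. shift -` B \<inter> space \<mu> = B \<longrightarrow> measure \<mu> B = 0 \<or> measure \<mu> B = 1)"

text \<open>
  The operator norm induced by the Euclidean norm; the type class norm on matrices is a different
  norm.
\<close>

definition op_norm :: "complex^'d^'d \<Rightarrow> real" where
  "op_norm M = onorm (\<lambda>v. M *v v)"

definition word_prod :: "(nat \<Rightarrow> complex^'d^'d) \<Rightarrow> nat list \<Rightarrow> complex^'d^'d" where
  "word_prod A w = foldr (\<lambda>i M. A i ** M) w (mat 1)"

definition jsr :: "(nat \<Rightarrow> complex^'d^'d) \<Rightarrow> nat \<Rightarrow> real" where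
  "jsr A l = lim (\<lambda>n. Max {root n (op_norm (word_prod A w)) | w. length w = n \<and> set w \<subseteq> {1..l}})"

fun cocycle :: "(nat \<Rightarrow> complex^'d^'d) \<Rightarrow> (nat \<Rightarrow> nat) \<Rightarrow> nat \<Rightarrow> complex^'d^'d" where
  "cocycle A x 0 = mat 1"
| "cocycle A x (Suc n) = A (x n) ** cocycle A x n"

definition ext_log :: "real \<Rightarrow> ereal" where
  "ext_log r = (if r = 0 then -\<infinity> else ereal (ln r))"

text \<open>
  The integral of the positive part minus that of the negative part.  It is only applied to functions
  bounded above on a probability space, so the form \<open>\<infinity> - \<infinity>\<close> does not occur.
\<close>

definition ext_integral :: "'a measure \<Rightarrow> ('a \<Rightarrow> ereal) \<Rightarrow> ereal" where
  "ext_integral M f =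
     enn2ereal (\<integral>\<^sup>+ x. e2ennreal (f x) \<partial>M) - enn2ereal (\<integral>\<^sup>+ x. e2ennreal (- f x) \<partial>M)"

definition max_measures :: "(nat \<Rightarrow> complex^'d^'d) \<Rightarrow> nat \<Rightarrow> (nat \<Rightarrow> nat) measure set" where
  "max_measures A l = {\<mu> \<in> invariant_measures l.
     (INF n\<in>{1..}. ereal (1 / real n) * ext_integral \<mu> (\<lambda>x. ext_log (op_norm (cocycle A x n))))
       = ext_log (jsr A l)}"

definition strongly_extremal :: "(nat \<Rightarrow> complex^'d^'d) \<Rightarrow> nat \<Rightarrow> (nat \<Rightarrow> nat) \<Rightarrow> bool" where
  "strongly_extremal A l x \<longleftrightarrow> x \<in> full_shift l \<and>
     (\<exists>\<epsilon>>0. \<forall>n\<ge>1. op_norm (cocycle A x n) \<ge> \<epsilon> * jsr A l ^ n)"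

definition weakly_extremal :: "(nat \<Rightarrow> complex^'d^'d) \<Rightarrow> nat \<Rightarrow> (nat \<Rightarrow> nat) \<Rightarrow> bool" where
  "weakly_extremal A l x \<longleftrightarrow> x \<in> full_shift l \<and>
     (\<lambda>n. root n (op_norm (cocycle A x n))) \<longlonglongrightarrow> jsr A l"

definition is_norm :: "(complex^'d \<Rightarrow> real) \<Rightarrow> bool" where
  "is_norm N \<longleftrightarrow> (\<forall>v. N v \<ge> 0) \<and> (\<forall>v. N v = 0 \<longleftrightarrow> v = 0) \<and>
     (\<forall>c v. N (c *s v) = cmod c * N v) \<and> (\<forall>u v. N (u + v) \<le> N u + N v)"

definition barabanov_norm ::
    "(nat \<Rightarrow> complex^'d^'d) \<Rightarrow> nat \<Rightarrow> (complex^'d \<Rightarrow> real) \<Rightarrow> bool" where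
  "barabanov_norm A l N \<longleftrightarrow> is_norm N \<and>
     (\<forall>v. jsr A l * N v = Max ((\<lambda>i. N (A i *v v)) ` {1..l}))"

definition kozyakin_extremal :: "(nat \<Rightarrow> complex^'d^'d) \<Rightarrow> nat \<Rightarrow> (nat \<Rightarrow> nat) \<Rightarrow> bool" where
  "kozyakin_extremal A l x \<longleftrightarrow> x \<in> full_shift l \<and>
     (\<exists>N v. barabanov_norm A l N \<and> N v = 1 \<and> (\<forall>n\<ge>1. N (cocycle A x n *v v) = jsr A l ^ n))"

definition has_frequency :: "nat \<Rightarrow> nat \<Rightarrow> real \<Rightarrow> (nat \<Rightarrow> nat) \<Rightarrow> bool" where
  "has_frequency l i \<gamma> x \<longleftrightarrow>
     (\<lambda>n. 1 / real n * (\<Sum>k<n. indicator (cyl l i) ((shift ^^ k) x))) \<longlonglongrightarrow> \<gamma>"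

end

theory Submission
  imports Defs
begin

text \<open>
  If \<open>\<rho> = 0\<close>, every sequence is strongly extremal and every invariant measure is maximising.  Otherwise divide the
  matrices by \<open>\<rho>\<close>, so that products grow subexponentially and a measure is maximising iff the
  integrals of \<open>ln \<parallel>\<L>(x, n)\<parallel>\<close> are all nonnegative.

  Let \<open>U\<^sub>0 = 0\<close> and let \<open>U\<^sub>j\<^sub>+\<^sub>1\<close> be the set of vectors whose orbits are bounded modulo \<open>U\<^sub>j\<close>.  This filtration
  reaches the whole space, and products are bounded on each quotient.  If on a set of positive
  measure the products tended to zero on every quotient, the measure conditioned on this invariant set
  would still be maximising, but in a norm adapted to the filtration the expected logarithm would be
  negative at some time.  So for a maximising measure almost every point is strongly extremal, and by
  dominated convergence the frequencies integrate to the measure of the cylinder.  For a Barabanov norm the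
  products have norm exactly one almost surely, and compactness gives a vector realising it.

  Conversely, the empirical measures of a weakly extremal point accumulate only at maximising
  measures.  Finally, the maximising measures form a compact convex set, a face of the invariant measures;
  maximising (or minimising) \<open>\<mu>([i])\<close> and then, one by one, the measures of all other cylinders singles
  out an extreme point, which is ergodic.
\<close>

section \<open>Filtrations by invariant subspaces\<close>

text \<open>A measure enters only through its values on cylinders. This is why logarithms are
  truncated as \<open>ln (max (H w) \<delta>)\<close>: their integrals are finite sums, linear in
  those values, they survive pointwise limits, and the value minus infinity needs no separate
  treatment. The obstacle is that subexponential growth does not bound the products, so a
  nonnegative exponent does not at once give the lower bound up to a constant that
  \<open>strongly_extremal\<close> asks for. Boundedness holds only on the quotients of the
  filtration, and the adapted norm hides what lies off the diagonal. That norm may be chosen after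
  the time n, because nonnegativity of the exponent does not depend on the norm: a change of norm
  costs a constant, which disappears along multiples of n by submultiplicativity and invariance.
  Comparing linear decrease with sublinear growth in the same way shows why maximising measures form
  a face: no component can offset the negative exponent of another. No subadditive or pointwise
  ergodic theorem and no ergodic decomposition enters.\<close>

definition rel_onorm :: "('a \<Rightarrow> real) \<Rightarrow> 'a set \<Rightarrow> ('a \<Rightarrow> 'a) \<Rightarrow> real" where
  "rel_onorm p U f = (SUP v\<in>U. p (f v) / p v)"

text \<open>A vector with \<open>p v = 0\<close> contributes the quotient 0 to the supremum, so for
  a seminorm p \<open>rel_onorm\<close> is the operator norm of the induced map on U modulo the
  kernel of p. The rough bound K keeps the supremum finite and forces \<open>p (f v) = 0\<close> on
  that kernel.\<close>

lemma rel_onorm_bound: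
  assumes nn: "\<And>v. 0 \<le> p v" and K: "\<And>v. v \<in> U \<Longrightarrow> p (f v) \<le> K * p v" and v: "v \<in> U"
  shows "p (f v) \<le> rel_onorm p U f * p v"
proof (cases "p v = 0")
  case True
  then show ?thesis using K[OF v] by simp
next
  case False
  then have pos: "p v > 0" using nn[of v] by simp
  have "bdd_above ((\<lambda>v. p (f v) / p v) ` U)"
  proof (rule bdd_aboveI2)
    fix u assume "u \<in> U"
    show "p (f u) / p u \<le> max K 0"
    proof (cases "p u = 0")
      case False
      then have "p u > 0" using nn[of u] by simp
      then have "p (f u) / p u \<le> K" using K[OF \<open>u \<in> U\<close>] by (simp add: divide_le_eq mult.commute)
      then show ?thesis by simp
    qed simp
  qed
  then have "p (f v) / p v \<le> rel_onorm p U f"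
    unfolding rel_onorm_def by (rule cSUP_upper[OF v])
  then show ?thesis using pos by (simp add: divide_le_eq mult.commute)
qed

lemma rel_onorm_le:
  assumes "U \<noteq> {}" "\<And>v. 0 \<le> p v" "\<And>v. v \<in> U \<Longrightarrow> p (f v) \<le> b * p v" "0 \<le> b"
  shows "rel_onorm p U f \<le> b"
  unfolding rel_onorm_def
proof (rule cSUP_least[OF assms(1)])
  fix v assume "v \<in> U"
  show "p (f v) / p v \<le> b"
    using assms(2)[of v] assms(3)[OF \<open>v \<in> U\<close>] assms(4)
    by (cases "p v = 0") (auto simp: divide_le_eq mult.commute)
qed

lemma rel_onorm_nonneg:
  assumes nn: "\<And>v. 0 \<le> p v" and K: "\<And>v. v \<in> U \<Longrightarrow> p (f v) \<le> K * p v" and "U \<noteq> {}"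
  shows "0 \<le> rel_onorm p U f"
proof (cases "\<exists>v\<in>U. p v > 0")
  case True
  then obtain v where v: "v \<in> U" "p v > 0" by blast
  have "0 \<le> rel_onorm p U f * p v"
    using rel_onorm_bound[of p U f K v, OF nn K v(1)] nn[of "f v"] by linarith
  then show ?thesis using v(2) by (simp add: zero_le_mult_iff)
next
  case False
  then have "p v = 0" if "v \<in> U" for v using nn[of v] that by force
  then have "(\<lambda>v. p (f v) / p v) ` U = {0}" using \<open>U \<noteq> {}\<close> by auto
  then show ?thesis unfolding rel_onorm_def by simp
qed

lemma rel_onorm_compose:
  assumes nn: "\<And>v. 0 \<le> p v" and U: "U \<noteq> {}" "\<And>v. v \<in> U \<Longrightarrow> f v \<in> U"
    and K: "\<And>v. v \<in> U \<Longrightarrow> p (f v) \<le> K * p v" and L: "\<And>v. v \<in> U \<Longrightarrow> p (g v) \<le> L * p v"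
  shows "rel_onorm p U (g \<circ> f) \<le> rel_onorm p U f * rel_onorm p U g"
proof (rule rel_onorm_le[where p=p, OF U(1) nn])
  have g0: "0 \<le> rel_onorm p U g" by (rule rel_onorm_nonneg[of p U g L, OF nn L U(1)])
  show "0 \<le> rel_onorm p U f * rel_onorm p U g"
    using g0 rel_onorm_nonneg[of p U f K, OF nn K U(1)] by simp
  fix v assume v: "v \<in> U"
  have "p ((g \<circ> f) v) \<le> rel_onorm p U g * p (f v)"
    using rel_onorm_bound[of p U g L, OF nn L U(2)[OF v]] by simp
  also have "\<dots> \<le> rel_onorm p U g * (rel_onorm p U f * p v)"
    by (rule mult_left_mono[OF rel_onorm_bound[of p U f K, OF nn K v] g0])
  finally show "p ((g \<circ> f) v) \<le> rel_onorm p U f * rel_onorm p U g * p v"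
    by (simp add: mult_ac)
qed

section \<open>The distance to a subspace as a seminorm on the quotient\<close>

lemma infdist_subspace_rep:
  fixes U :: "'a::euclidean_space set"
  assumes "subspace U"
  obtains u where "u \<in> U" "norm (v - u) = infdist v U"
proof -
  have "closed U" "U \<noteq> {}" using assms closed_subspace subspace_0 by auto
  then obtain u where "u \<in> U" "infdist v U = dist v u" using infdist_attains_inf by blast
  then show thesis using that by (simp add: dist_norm)
qed

lemma infdist_subspace_le:
  fixes U :: "'a::euclidean_space set"
  assumes "u \<in> U"
  shows "infdist v U \<le> norm (v - u)"
  using infdist_le[OF assms, of v] by (simp add: dist_norm)

lemma infdist_subspace_le_norm:
  fixes U :: "'a::euclidean_space set"
  assumes "subspace U"
  shows "infdist v U \<le> norm v"
  using infdist_subspace_le[OF subspace_0[OF assms], of v] by simp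

lemma infdist_subspace_zero_iff:
  fixes U :: "'a::euclidean_space set"
  assumes "subspace U"
  shows "infdist v U = 0 \<longleftrightarrow> v \<in> U"
  using in_closed_iff_infdist_zero[of U v] closed_subspace[OF assms] subspace_0[OF assms] by auto

lemma infdist_subspace_triangle:
  fixes U :: "'a::euclidean_space set"
  assumes "subspace U"
  shows "infdist (v + w) U \<le> infdist v U + infdist w U"
proof -
  obtain a b where a: "a \<in> U" "norm (v - a) = infdist v U" and b: "b \<in> U" "norm (w - b) = infdist w U"
    using infdist_subspace_rep[OF assms] by metis
  have "infdist (v + w) U \<le> norm ((v + w) - (a + b))"
    by (rule infdist_subspace_le) (simp add: assms a(1) b(1) subspace_add)
  also have "\<dots> = norm ((v - a) + (w - b))" by (simp add: algebra_simps)
  also have "\<dots> \<le> norm (v - a) + norm (w - b)" by (rule norm_triangle_ineq)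
  finally show ?thesis using a b by simp
qed

lemma infdist_subspace_scaleR:
  fixes U :: "'a::euclidean_space set"
  assumes "subspace U"
  shows "infdist (c *\<^sub>R v) U = \<bar>c\<bar> * infdist v U"
proof -
  have le: "infdist (c *\<^sub>R v) U \<le> \<bar>c\<bar> * infdist v U" for c v
  proof -
    obtain a where a: "a \<in> U" "norm (v - a) = infdist v U"
      using infdist_subspace_rep[OF assms] by metis
    have "infdist (c *\<^sub>R v) U \<le> norm (c *\<^sub>R v - c *\<^sub>R a)"
      by (rule infdist_subspace_le) (simp add: assms a(1) subspace_scale)
    also have "\<dots> = \<bar>c\<bar> * norm (v - a)" by (simp flip: scaleR_diff_right)
    finally show ?thesis using a by simp
  qed
  show ?thesis
  proof (cases "c = 0")
    case True
    then show ?thesis using infdist_subspace_zero_iff[OF assms, of 0] subspace_0[OF assms] by simp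
  next
    case False
    have "infdist v U = infdist ((1/c) *\<^sub>R (c *\<^sub>R v)) U" using False by simp
    also have "\<dots> \<le> \<bar>1/c\<bar> * infdist (c *\<^sub>R v) U" by (rule le)
    finally have "\<bar>c\<bar> * infdist v U \<le> infdist (c *\<^sub>R v) U"
      using False by (simp add: field_simps)
    then show ?thesis using le[of c v] by simp
  qed
qed

lemma infdist_subspace_add_mem:
  fixes U :: "'a::euclidean_space set"
  assumes "subspace U" "u \<in> U"
  shows "infdist (v + u) U = infdist v U"
proof -
  have z: "infdist u U = 0" "infdist (- u) U = 0"
    using infdist_subspace_zero_iff[OF assms(1)] assms subspace_neg by auto
  show ?thesis
    using infdist_subspace_triangle[OF assms(1), of v u] infdist_subspace_triangle[OF assms(1), of "v + u" "- u"] z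
    by simp
qed

lemma infdist_subspace_sum:
  fixes U :: "'a::euclidean_space set"
  assumes "subspace U" "finite B"
  shows "infdist (\<Sum>b\<in>B. g b) U \<le> (\<Sum>b\<in>B. infdist (g b) U)"
  using assms(2)
proof induction
  case empty
  then show ?case using infdist_subspace_zero_iff[OF assms(1)] subspace_0[OF assms(1)] by simp
next
  case (insert x F)
  then show ?case using infdist_subspace_triangle[OF assms(1), of "g x" "\<Sum>b\<in>F. g b"] by simp
qed

text \<open>
  Words are read from left to right, as in \<open>\<L>(x, n)\<close>: the map of the first letter is applied first.
\<close>

locale linear_words =
  fixes I :: "'i set" and W :: "'i list \<Rightarrow> 'a::euclidean_space \<Rightarrow> 'a"
  assumes linear_W: "linear (W w)"
    and W_Nil: "W [] v = v"
    and W_append: "W (u @ w) v = W w (W u v)"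
begin

definition bounded_mod :: "'a set \<Rightarrow> 'a set" where
  "bounded_mod U = {v. \<exists>B. \<forall>w\<in>lists I. infdist (W w v) U \<le> B}"

definition invariant_subspace :: "'a set \<Rightarrow> bool" where
  "invariant_subspace U \<longleftrightarrow> subspace U \<and> (\<forall>w\<in>lists I. \<forall>v\<in>U. W w v \<in> U)"

lemma invariant_subspace_bounded_mod:
  assumes "invariant_subspace U"
  shows "invariant_subspace (bounded_mod U)"
proof -
  have U: "subspace U" and inv: "\<And>w v. w \<in> lists I \<Longrightarrow> v \<in> U \<Longrightarrow> W w v \<in> U"
    using assms by (auto simp: invariant_subspace_def)
  have "subspace (bounded_mod U)"
    unfolding subspace_def
  proof (intro conjI ballI allI)
    have "infdist (W w 0) U = 0" for w
      using linear_0[OF linear_W] infdist_subspace_zero_iff[OF U] subspace_0[OF U] by simp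
    then show "0 \<in> bounded_mod U" by (auto simp: bounded_mod_def intro!: exI[of _ 0])
  next
    fix x y assume "x \<in> bounded_mod U" "y \<in> bounded_mod U"
    then obtain B1 B2 where B: "\<And>w. w \<in> lists I \<Longrightarrow> infdist (W w x) U \<le> B1"
      "\<And>w. w \<in> lists I \<Longrightarrow> infdist (W w y) U \<le> B2"
      unfolding bounded_mod_def by blast
    have "infdist (W w (x + y)) U \<le> B1 + B2" if "w \<in> lists I" for w
      using infdist_subspace_triangle[OF U, of "W w x" "W w y"] B[OF that]
      by (simp add: linear_add[OF linear_W])
    then show "x + y \<in> bounded_mod U" by (auto simp: bounded_mod_def)
  next
    fix c x assume "x \<in> bounded_mod U"
    then obtain B where B: "\<And>w. w \<in> lists I \<Longrightarrow> infdist (W w x) U \<le> B"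
      unfolding bounded_mod_def by blast
    have "infdist (W w (c *\<^sub>R x)) U \<le> \<bar>c\<bar> * B" if "w \<in> lists I" for w
      using mult_left_mono[OF B[OF that], of "\<bar>c\<bar>"]
      by (simp add: linear_scale[OF linear_W] infdist_subspace_scaleR[OF U])
    then show "c *\<^sub>R x \<in> bounded_mod U" by (auto simp: bounded_mod_def)
  qed
  moreover have "W u v \<in> bounded_mod U" if "u \<in> lists I" "v \<in> bounded_mod U" for u v
  proof -
    obtain B where B: "\<And>w. w \<in> lists I \<Longrightarrow> infdist (W w v) U \<le> B"
      using \<open>v \<in> bounded_mod U\<close> unfolding bounded_mod_def by blast
    have "infdist (W w (W u v)) U \<le> B" if "w \<in> lists I" for w
      using B[of "u @ w"] that \<open>u \<in> lists I\<close> by (simp add: W_append)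
    then show ?thesis by (auto simp: bounded_mod_def)
  qed
  ultimately show ?thesis by (auto simp: invariant_subspace_def)
qed

lemma bounded_mod_superset:
  assumes "invariant_subspace U"
  shows "U \<subseteq> bounded_mod U"
proof
  fix v assume v: "v \<in> U"
  have "infdist (W w v) U \<le> 0" if "w \<in> lists I" for w
    using assms v that infdist_subspace_zero_iff[of U "W w v"] by (auto simp: invariant_subspace_def)
  then show "v \<in> bounded_mod U" by (auto simp: bounded_mod_def)
qed

lemma infdist_W_cong:
  assumes "invariant_subspace U" "w \<in> lists I" "u \<in> U"
  shows "infdist (W w (v - u)) U = infdist (W w v) U"
proof -
  have "subspace U" "W w u \<in> U" using assms by (auto simp: invariant_subspace_def)
  then show ?thesis
    using infdist_subspace_add_mem[of U "- W w u" "W w v"] subspace_neg[of U "W w u"]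
    by (simp add: linear_diff[OF linear_W])
qed

lemma infdist_W_le_onorm:
  assumes "invariant_subspace U" "w \<in> lists I"
  shows "infdist (W w v) U \<le> onorm (W w) * infdist v U"
proof -
  have U: "subspace U" using assms by (auto simp: invariant_subspace_def)
  obtain u where u: "u \<in> U" "norm (v - u) = infdist v U" using infdist_subspace_rep[OF U] by metis
  have "infdist (W w v) U = infdist (W w (v - u)) U" by (simp add: infdist_W_cong[OF assms u(1)])
  also have "\<dots> \<le> norm (W w (v - u))" by (rule infdist_subspace_le_norm[OF U])
  also have "\<dots> \<le> onorm (W w) * norm (v - u)"
    by (rule onorm) (simp add: linear_conv_bounded_linear[symmetric] linear_W)
  finally show ?thesis using u by simp
qed

text \<open>Finite dimension turns boundedness along each orbit into one constant: expand v in an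
  orthonormal basis of \<open>bounded_mod U\<close> and add the bounds of the basis vectors. This
  controls the image by \<open>norm v\<close>; moving v by its nearest point in the invariant
  subspace U replaces the norm by the quotient seminorm.\<close>

lemma bounded_mod_uniform:
  assumes "invariant_subspace U"
  obtains C where "0 \<le> C"
    "\<And>w v. w \<in> lists I \<Longrightarrow> v \<in> bounded_mod U \<Longrightarrow> infdist (W w v) U \<le> C * infdist v U"
proof -
  have U: "subspace U" using assms by (auto simp: invariant_subspace_def)
  have U': "subspace (bounded_mod U)"
    using invariant_subspace_bounded_mod[OF assms] by (auto simp: invariant_subspace_def)
  obtain B where B: "B \<subseteq> bounded_mod U" "pairwise orthogonal B" "\<And>x. x \<in> B \<Longrightarrow> norm x = 1"
    "independent B" "card B = dim (bounded_mod U)" "span B = bounded_mod U"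
    using orthonormal_basis_subspace[OF U'] by metis
  have fin: "finite B" using B(4) by (rule independent_imp_finite)
  have "\<forall>b\<in>B. \<exists>K. \<forall>w\<in>lists I. infdist (W w b) U \<le> K" using B(1) by (auto simp: bounded_mod_def)
  then obtain K where K: "\<And>b w. b \<in> B \<Longrightarrow> w \<in> lists I \<Longrightarrow> infdist (W w b) U \<le> K b" by metis
  define C where "C = (\<Sum>b\<in>B. \<bar>K b\<bar>)"
  have *: "infdist (W w v) U \<le> C * norm v" if w: "w \<in> lists I" and v: "v \<in> bounded_mod U" for w v
  proof -
    have ex: "v = (\<Sum>b\<in>B. (v \<bullet> b) *\<^sub>R b)"
      using orthonormal_basis_expand[OF B(2) B(3) _ fin, of v] v B(6) by simp
    have "infdist (W w v) U = infdist (\<Sum>b\<in>B. (v \<bullet> b) *\<^sub>R W w b) U"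
      by (subst ex) (simp add: linear_sum[OF linear_W] linear_scale[OF linear_W])
    also have "\<dots> \<le> (\<Sum>b\<in>B. infdist ((v \<bullet> b) *\<^sub>R W w b) U)"
      by (rule infdist_subspace_sum[OF U fin])
    also have "\<dots> \<le> (\<Sum>b\<in>B. norm v * \<bar>K b\<bar>)"
    proof (rule sum_mono)
      fix b assume b: "b \<in> B"
      have "\<bar>v \<bullet> b\<bar> \<le> norm v" using Cauchy_Schwarz_ineq2[of v b] B(3)[OF b] by simp
      moreover have "infdist (W w b) U \<le> \<bar>K b\<bar>" using K[OF b w] by linarith
      ultimately have "\<bar>v \<bullet> b\<bar> * infdist (W w b) U \<le> norm v * \<bar>K b\<bar>"
        by (intro mult_mono) (auto simp: infdist_nonneg)
      then show "infdist ((v \<bullet> b) *\<^sub>R W w b) U \<le> norm v * \<bar>K b\<bar>"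
        by (simp add: infdist_subspace_scaleR[OF U])
    qed
    also have "\<dots> = C * norm v" by (simp add: C_def sum_distrib_left mult.commute)
    finally show ?thesis .
  qed
  show thesis
  proof
    show "0 \<le> C" by (auto simp: C_def intro: sum_nonneg)
    fix w v assume w: "w \<in> lists I" and v: "v \<in> bounded_mod U"
    obtain u where u: "u \<in> U" "norm (v - u) = infdist v U" using infdist_subspace_rep[OF U] by metis
    have "v - u \<in> bounded_mod U"
      using bounded_mod_superset[OF assms] u(1) v U' by (auto intro: subspace_diff)
    then show "infdist (W w v) U \<le> C * infdist v U"
      using *[OF w, of "v - u"] infdist_W_cong[OF assms w u(1)] u(2) by simp
  qed
qed

text \<open>
  If every vector outside \<open>U\<close> had an unbounded orbit modulo \<open>U\<close>, compactness would give
  words of bounded length doubling every vector modulo \<open>U\<close>, hence exponential growth.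
\<close>

lemma bounded_mod_strict:
  assumes subexp: "\<And>\<eta>. \<eta> > 0 \<Longrightarrow> \<exists>C. \<forall>w\<in>lists I. onorm (W w) \<le> C * (1 + \<eta>) ^ length w"
    and inv: "invariant_subspace U" and ne: "U \<noteq> UNIV"
  shows "bounded_mod U \<noteq> U"
proof
  assume eq: "bounded_mod U = U"
  have U: "subspace U" using inv by (auto simp: invariant_subspace_def)
  \<comment> \<open>These are the unit vectors orthogonal to U: a compact set of representatives for
    the unit sphere of the quotient.\<close>
  define S where "S = {v. norm v = 1 \<and> infdist v U = 1}"
  have normalise: "\<exists>r\<in>S. \<exists>u\<in>U. v - u = infdist v U *\<^sub>R r" if pos: "infdist v U > 0" for v
  proof -
    obtain u where u: "u \<in> U" "norm (v - u) = infdist v U" using infdist_subspace_rep[OF U] by metis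
    define r where "r = (1 / infdist v U) *\<^sub>R (v - u)"
    have "infdist (v - u) U = infdist v U"
      using infdist_subspace_add_mem[OF U subspace_neg[OF U u(1)], of v] by simp
    then have "r \<in> S" using pos u(2) by (simp add: S_def r_def infdist_subspace_scaleR[OF U])
    moreover have "v - u = infdist v U *\<^sub>R r" using pos by (simp add: r_def)
    ultimately show ?thesis using u(1) by blast
  qed
  have "S = sphere 0 1 \<inter> {v. infdist v U = 1}" by (auto simp: S_def)
  moreover have "closed {v. infdist v U = 1}"
    by (intro closed_Collect_eq continuous_intros)
  ultimately have "compact S" by (simp add: compact_Int_closed)
  define O' where "O' w = {v. infdist (W w v) U > 2}" for w
  have op: "open (O' w)" for w
    unfolding O'_def
    by (intro open_Collect_less continuous_on_const continuous_on_infdist linear_continuous_on)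
      (simp add: linear_conv_bounded_linear[symmetric] linear_W)
  have cover: "S \<subseteq> (\<Union>w\<in>lists I. O' w)"
  proof
    fix v assume v: "v \<in> S"
    then have "v \<notin> bounded_mod U"
      using eq infdist_subspace_zero_iff[OF U, of v] by (auto simp: S_def)
    then show "v \<in> (\<Union>w\<in>lists I. O' w)"
      by (auto simp: bounded_mod_def O'_def not_le)
  qed
  obtain D where D: "D \<subseteq> lists I" "finite D" "S \<subseteq> (\<Union>w\<in>D. O' w)"
    using compactE_image[OF \<open>compact S\<close> op cover] by metis
  \<comment> \<open>\<open>Suc\<close> keeps N positive whatever the covering words are; N becomes a
    denominator in \<open>\<eta>\<close>.\<close>
  define N where "N = Suc (Max (insert 0 (length ` D)))"
  have N: "length w \<le> N" if "w \<in> D" for w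
    using Max_ge[of "insert 0 (length ` D)" "length w"] that D(2) unfolding N_def
    by (meson finite.insertI finite_imageI imageI insertI2 le_SucI)
  obtain v1 where "v1 \<notin> U" using ne by blast
  then have "infdist v1 U > 0"
    using infdist_subspace_zero_iff[OF U, of v1] infdist_nonneg[of v1 U] by linarith
  then obtain v0 where v0: "v0 \<in> S" using normalise by blast
  have grow: "\<exists>w\<in>lists I. length w \<le> n * N \<and> 2 ^ n \<le> infdist (W w v0) U" for n
  proof (induction n)
    case 0
    show ?case using v0 by (intro bexI[of _ "[]"]) (auto simp: W_Nil S_def)
  next
    case (Suc n)
    then obtain w where w: "w \<in> lists I" "length w \<le> n * N" "2 ^ n \<le> infdist (W w v0) U" by blast
    define p where "p = infdist (W w v0) U"
    have p: "p \<ge> 2 ^ n" "p > 0" using w(3) less_le_trans[of 0 "2 ^ n" p] by (auto simp: p_def)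
    obtain r u where r: "r \<in> S" "u \<in> U" "W w v0 - u = p *\<^sub>R r"
      using normalise[of "W w v0"] p by (auto simp: p_def)
    obtain w' where w': "w' \<in> D" "infdist (W w' r) U > 2"
      using D(3) r(1) by (auto simp: O'_def)
    have "w' \<in> lists I" using w' D by blast
    have "infdist (W w' (W w v0)) U = infdist (W w' (p *\<^sub>R r)) U"
      using infdist_W_cong[OF inv \<open>w' \<in> lists I\<close> r(2), of "W w v0"] r(3) by simp
    also have "\<dots> = p * infdist (W w' r) U"
      using p by (simp add: linear_scale[OF linear_W] infdist_subspace_scaleR[OF U])
    also have "\<dots> \<ge> 2 ^ n * 2" using p w'(2) by (intro mult_mono) auto
    finally have "2 ^ Suc n \<le> infdist (W (w @ w') v0) U" by (simp add: W_append)
    moreover have "length (w @ w') \<le> Suc n * N" using w(2) N[OF w'(1)] by simp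
    moreover have "w @ w' \<in> lists I" using w(1) \<open>w' \<in> lists I\<close> by simp
    ultimately show ?case by blast
  qed
  \<comment> \<open>Chosen so that the growth over a block of N letters is at most
    \<open>exp (1/2)\<close>, which is below 2, whereas \<open>grow\<close> doubles the distance
    within each such block.\<close>
  define \<eta> where "\<eta> = 1 / (2 * real N)"
  have N0: "N > 0" by (simp add: N_def)
  then have "\<eta> > 0" by (simp add: \<eta>_def)
  then obtain C where C: "\<And>w. w \<in> lists I \<Longrightarrow> onorm (W w) \<le> C * (1 + \<eta>) ^ length w"
    using subexp by blast
  have "(1 + \<eta>) ^ N \<le> exp \<eta> ^ N"
    using \<open>\<eta> > 0\<close> by (intro power_mono exp_ge_add_one_self) auto
  also have "\<dots> = exp (1/2)" using N0 by (simp add: \<eta>_def flip: exp_of_nat_mult)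
  finally have eN: "(1 + \<eta>) ^ N \<le> exp (1/2)" .
  have C0: "C \<ge> 0" using C[of "[]"] onorm_pos_le[of "W []"] linear_W[of "[]"]
    by (simp add: linear_conv_bounded_linear)
  have "exp (1/2::real) ^ 2 = exp 1" by (simp flip: exp_of_nat_mult)
  then have "exp (1/2::real) ^ 2 < 2 ^ 2" using exp_le by simp
  then have e2: "exp (1/2::real) < 2" by (rule power_less_imp_less_base) simp
  have bound: "(2 / exp (1/2)) ^ n \<le> C" for n
  proof -
    obtain w where w: "w \<in> lists I" "length w \<le> n * N" "2 ^ n \<le> infdist (W w v0) U"
      using grow by blast
    have "2 ^ n \<le> onorm (W w)"
      using infdist_W_le_onorm[OF inv w(1), of v0] w(3) v0 by (simp add: S_def)
    also have "\<dots> \<le> C * (1 + \<eta>) ^ length w" by (rule C[OF w(1)])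
    also have "\<dots> \<le> C * (1 + \<eta>) ^ (N * n)"
      using w(2) \<open>\<eta> > 0\<close> C0 by (intro mult_left_mono power_increasing) (auto simp: mult.commute)
    also have "\<dots> \<le> C * exp (1/2) ^ n"
      unfolding power_mult using C0 eN \<open>\<eta> > 0\<close> by (intro mult_left_mono power_mono) auto
    finally show ?thesis by (simp add: power_divide divide_le_eq)
  qed
  have "2 / exp (1/2::real) > 1" using e2 by (simp add: less_divide_eq)
  then obtain n where "C < (2 / exp (1/2)) ^ n" using real_arch_pow by blast
  with bound[of n] show False by simp
qed

section \<open>The filtration and its weighted norm\<close>

definition filt :: "nat \<Rightarrow> 'a set" where
  "filt j = (bounded_mod ^^ j) {0}"

lemma filt_0: "filt 0 = {0}" and filt_Suc: "filt (Suc j) = bounded_mod (filt j)"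
  by (simp_all add: filt_def)

lemma invariant_filt: "invariant_subspace (filt j)"
proof (induction j)
  case 0
  show ?case by (auto simp: filt_0 invariant_subspace_def linear_0[OF linear_W])
qed (simp add: filt_Suc invariant_subspace_bounded_mod)

lemma subspace_filt: "subspace (filt j)"
  using invariant_filt by (auto simp: invariant_subspace_def)

lemma filt_mono: "filt j \<subseteq> filt (Suc j)"
  by (simp add: filt_Suc bounded_mod_superset invariant_filt)

text \<open>Every proper term is strictly enlarged, which raises the dimension; after as many steps
  as the dimension of the space nothing is left to add.\<close>

lemma filt_top:
  assumes subexp: "\<And>\<eta>. \<eta> > 0 \<Longrightarrow> \<exists>C. \<forall>w\<in>lists I. onorm (W w) \<le> C * (1 + \<eta>) ^ length w"
  shows "filt (DIM('a)) = UNIV"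
proof -
  have "j \<le> dim (filt j) \<or> filt j = UNIV" for j
  proof (induction j)
    case (Suc j)
    show ?case
    proof (cases "filt j = UNIV")
      case True
      then show ?thesis using filt_mono[of j] by auto
    next
      case False
      have "filt j \<subset> filt (Suc j)"
        using filt_mono bounded_mod_strict[OF subexp invariant_filt False] by (auto simp: filt_Suc)
      then have "span (filt j) \<subset> span (filt (Suc j))"
        using span_subspace[OF subset_refl span_superset subspace_filt] by metis
      then have "dim (filt j) < dim (filt (Suc j))" by (rule dim_psubset)
      then show ?thesis using Suc False by auto
    qed
  qed simp
  then have "DIM('a) \<le> dim (filt DIM('a)) \<or> filt DIM('a) = UNIV" by blast
  then show ?thesis
    using dim_eq_full[of "filt DIM('a)"] dim_subset_UNIV[of "filt DIM('a)"] subspace_filt[of "DIM('a)"]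
    by (metis order_antisym span_subspace subset_refl span_superset)
qed

lemma filt_bounded:
  obtains C where "0 \<le> C"
    "\<And>j w v. j < k \<Longrightarrow> w \<in> lists I \<Longrightarrow> v \<in> filt (Suc j) \<Longrightarrow>
      infdist (W w v) (filt j) \<le> C * infdist v (filt j)"
proof -
  have "\<exists>C\<ge>0. \<forall>w\<in>lists I. \<forall>v\<in>filt (Suc j). infdist (W w v) (filt j) \<le> C * infdist v (filt j)" for j
    using bounded_mod_uniform[OF invariant_filt, of j] unfolding filt_Suc by metis
  then obtain C where C: "\<And>j. C j \<ge> 0"
    "\<And>j w v. w \<in> lists I \<Longrightarrow> v \<in> filt (Suc j) \<Longrightarrow> infdist (W w v) (filt j) \<le> C j * infdist v (filt j)"
    by metis
  show thesis
  proof
    show "0 \<le> (\<Sum>j<k. C j)" using C(1) by (simp add: sum_nonneg)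
    fix j w v assume h: "j < k" "w \<in> lists I" "v \<in> filt (Suc j)"
    have "C j \<le> (\<Sum>j<k. C j)" using h(1) C(1) by (intro member_le_sum) auto
    then have "C j * infdist v (filt j) \<le> (\<Sum>j<k. C j) * infdist v (filt j)"
      by (intro mult_right_mono infdist_nonneg)
    with C(2)[OF h(2,3)] show "infdist (W w v) (filt j) \<le> (\<Sum>j<k. C j) * infdist v (filt j)" by simp
  qed
qed

text \<open>The term j = 0 is the Euclidean norm. A map that preserves the filtration may pass a
  contribution from level \<open>Suc j\<close> to level j, never upwards, so powers of t that grow
  with j make this leakage cost a factor 1/t.\<close>

definition filt_norm :: "real \<Rightarrow> 'a \<Rightarrow> real" where
  "filt_norm t v = (\<Sum>j<DIM('a). t ^ j * infdist v (filt j))"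

text \<open>
  With a large weight \<open>t\<close> the off-diagonal part of the block triangular map \<open>W w\<close> is negligible, so
  only its diagonal blocks matter.
\<close>

lemma filt_norm_W_le:
  assumes top: "filt (DIM('a)) = UNIV" and w: "w \<in> lists I" and t: "t > 0"
    and q: "\<And>j v. j < DIM('a) \<Longrightarrow> v \<in> filt (Suc j) \<Longrightarrow> infdist (W w v) (filt j) \<le> q * infdist v (filt j)"
    and q0: "0 \<le> q"
  shows "filt_norm t (W w v) \<le> (q + (q + onorm (W w)) / t) * filt_norm t v"
proof -
  let ?p = "\<lambda>j v. infdist v (filt j)"
  define K where "K = q + onorm (W w)"
  have on: "0 \<le> onorm (W w)" "\<And>v. norm (W w v) \<le> onorm (W w) * norm v"
    using linear_W[of w] by (auto simp: linear_conv_bounded_linear intro: onorm_pos_le onorm)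
  have K: "K \<ge> 0" using on(1) q0 by (simp add: K_def)
  have step: "?p j (W w v) \<le> q * ?p j v + K * ?p (Suc j) v" if j: "j < DIM('a)" for j
  proof -
    \<comment> \<open>Split v at u: on u the diagonal bound q applies, and the norm of the remainder
      is the next distance, so it is charged to level \<open>Suc j\<close>.\<close>
    obtain u where u: "u \<in> filt (Suc j)" "norm (v - u) = ?p (Suc j) v"
      using infdist_subspace_rep[OF subspace_filt] by metis
    have "?p j (W w v) = ?p j (W w u + W w (v - u))" by (simp add: linear_diff[OF linear_W])
    also have "\<dots> \<le> ?p j (W w u) + ?p j (W w (v - u))"
      by (rule infdist_subspace_triangle[OF subspace_filt])
    finally have 1: "?p j (W w v) \<le> q * ?p j u + onorm (W w) * ?p (Suc j) v"
      using q[OF j u(1)] on(2)[of "v - u"] u(2) infdist_subspace_le_norm[OF subspace_filt, of "W w (v - u)" j]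
      by simp
    have "?p j u = ?p j (v + - (v - u))" by simp
    also have "\<dots> \<le> ?p j v + ?p j (- (v - u))" by (rule infdist_subspace_triangle[OF subspace_filt])
    also have "\<dots> \<le> ?p j v + ?p (Suc j) v"
      using infdist_subspace_le_norm[OF subspace_filt, of "- (v - u)" j] u(2)
      by (simp add: norm_minus_commute)
    finally have "q * ?p j u \<le> q * (?p j v + ?p (Suc j) v)" using q0 by (rule mult_left_mono)
    with 1 show ?thesis by (simp add: K_def distrib_left distrib_right)
  qed
  \<comment> \<open>The shifted sum reaches one level beyond those in \<open>filt_norm\<close>; that
    level vanishes because the filtration ends in the whole space.\<close>
  have top0: "?p (DIM('a)) v = 0" by (simp add: top)
  have "filt_norm t (W w v) \<le> (\<Sum>j<DIM('a). t ^ j * (q * ?p j v + K * ?p (Suc j) v))"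
    unfolding filt_norm_def using t by (intro sum_mono mult_left_mono step) auto
  also have "\<dots> = q * filt_norm t v + (K / t) * (\<Sum>j<DIM('a). t ^ Suc j * ?p (Suc j) v)"
    using t by (simp add: filt_norm_def sum_distrib_left sum.distrib algebra_simps)
  finally have 1: "filt_norm t (W w v) \<le>
    q * filt_norm t v + (K / t) * (\<Sum>j<DIM('a). t ^ Suc j * ?p (Suc j) v)" .
  have "(\<Sum>j<DIM('a). t ^ Suc j * ?p (Suc j) v) \<le> filt_norm t v"
  proof -
    have "(\<Sum>j<DIM('a). t ^ Suc j * ?p (Suc j) v) + ?p 0 v = (\<Sum>j<Suc DIM('a). t ^ j * ?p j v)"
      using sum.lessThan_Suc_shift[of "\<lambda>j. t ^ j * ?p j v" "DIM('a)"] by simp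
    also have "\<dots> = filt_norm t v" using top0 by (simp add: filt_norm_def)
    finally show ?thesis using infdist_nonneg[of v "filt 0"] by linarith
  qed
  then have "(K / t) * (\<Sum>j<DIM('a). t ^ Suc j * ?p (Suc j) v) \<le> (K / t) * filt_norm t v"
    using K t by (intro mult_left_mono) auto
  with 1 show ?thesis by (simp add: K_def distrib_right)
qed

lemma filt_norm_ge: "t > 0 \<Longrightarrow> norm v \<le> filt_norm t v"
proof -
  assume t: "t > 0"
  have "norm v = t ^ 0 * infdist v (filt 0)" by (simp add: filt_0 infdist_singleton dist_norm)
  also have "\<dots> \<le> filt_norm t v"
    unfolding filt_norm_def using t by (intro member_le_sum) (auto simp: infdist_nonneg)
  finally show ?thesis .
qed

lemma filt_norm_le:
  assumes "t > 0"
  shows "filt_norm t v \<le> (\<Sum>j<DIM('a). t ^ j) * norm v"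
  unfolding filt_norm_def sum_distrib_right using assms
  by (intro sum_mono mult_left_mono infdist_subspace_le_norm[OF subspace_filt]) auto

end

section \<open>Cylinders and measures on the full shift\<close>

abbreviation shift_space :: "nat \<Rightarrow> (nat \<Rightarrow> nat) measure" where
  "shift_space l \<equiv> restrict_space borel (full_shift l)"

definition initial_word :: "nat \<Rightarrow> (nat \<Rightarrow> 'a) \<Rightarrow> 'a list" where
  "initial_word n x = map x [0..<n]"

definition words :: "nat \<Rightarrow> nat \<Rightarrow> nat list set" where
  "words l n = {w. set w \<subseteq> {1..l} \<and> length w = n}"

definition word_cyl :: "nat \<Rightarrow> nat list \<Rightarrow> (nat \<Rightarrow> nat) set" where
  "word_cyl l w = {x \<in> full_shift l. initial_word (length w) x = w}"

lemma length_initial_word [simp]: "length (initial_word n x) = n"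
  by (simp add: initial_word_def)

lemma initial_word_0 [simp]: "initial_word 0 x = []"
  by (simp add: initial_word_def)

lemma initial_word_Suc: "initial_word (Suc n) x = initial_word n x @ [x n]"
  by (simp add: initial_word_def)

lemma initial_word_eq_iff: "initial_word n x = w \<longleftrightarrow> length w = n \<and> (\<forall>j<n. x j = w ! j)"
proof -
  have "initial_word n x = w" if "length w = n" "\<forall>j<n. x j = w ! j"
    by (rule nth_equalityI) (use that in \<open>simp_all add: initial_word_def\<close>)
  moreover have "\<forall>j<n. x j = initial_word n x ! j" by (simp add: initial_word_def)
  ultimately show ?thesis by force
qed

lemma shift_funpow: "(shift ^^ k) x = (\<lambda>j. x (j + k))"
  by (induction k arbitrary: x) (auto simp: shift_def fun_eq_iff)

lemma initial_word_add: "initial_word (m + n) x = initial_word m x @ initial_word n ((shift ^^ m) x)"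
  by (auto simp: initial_word_def shift_funpow intro!: nth_equalityI simp: nth_append)

lemma initial_word_Suc_shift: "initial_word (Suc n) x = x 0 # initial_word n (shift x)"
  using initial_word_add[of 1 n x] by (simp add: initial_word_def)

lemma finite_words [simp]: "finite (words l n)"
  unfolding words_def by (rule finite_lists_length_eq) simp

lemma words_0 [simp]: "words l 0 = {[]}"
  by (auto simp: words_def)

lemma words_snoc_iff: "w @ [a] \<in> words l (Suc n) \<longleftrightarrow> w \<in> words l n \<and> a \<in> {1..l}"
  by (auto simp: words_def)

lemma shift_full_shift: "x \<in> full_shift l \<Longrightarrow> shift x \<in> full_shift l"
  by (simp add: full_shift_def shift_def)

lemma shift_funpow_full_shift: "x \<in> full_shift l \<Longrightarrow> (shift ^^ k) x \<in> full_shift l"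
  by (simp add: full_shift_def shift_funpow)

lemma initial_word_in_words: "x \<in> full_shift l \<Longrightarrow> initial_word n x \<in> words l n"
  by (auto simp: words_def initial_word_def full_shift_def)

lemma word_cyl_Nil [simp]: "word_cyl l [] = full_shift l"
  by (auto simp: word_cyl_def)

lemma word_cyl_singleton: "word_cyl l [i] = cyl l i"
  by (auto simp: word_cyl_def cyl_def initial_word_def)

lemma word_cyl_eq: "word_cyl l w = {x \<in> full_shift l. \<forall>j<length w. x j = w ! j}"
  by (simp add: word_cyl_def initial_word_eq_iff)

lemma word_cyl_empty:
  assumes "w \<notin> lists {1..l}"
  shows "word_cyl l w = {}"
proof -
  have "w \<in> lists {1..l}" if "x \<in> full_shift l" "initial_word (length w) x = w" for x
    using initial_word_in_words[OF that(1), of "length w"] that(2) by (auto simp: words_def)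
  with assms show ?thesis by (auto simp: word_cyl_def)
qed

lemma word_cyl_Int_full_shift [simp]: "word_cyl l w \<inter> full_shift l = word_cyl l w"
  by (auto simp: word_cyl_def)

lemma continuous_shift: "continuous_on UNIV shift"
  unfolding shift_def by (intro continuous_on_coordinatewise_then_product continuous_on_product_coordinates)

lemma measurable_coordinate_nat [measurable]: "(\<lambda>x :: nat \<Rightarrow> nat. x j) \<in> borel \<rightarrow>\<^sub>M (count_space UNIV :: nat measure)"
proof -
  have "(\<lambda>x::nat\<Rightarrow>nat. x j) \<in> borel \<rightarrow>\<^sub>M borel"
    by (intro borel_measurable_continuous_onI continuous_on_product_coordinates)
  then show ?thesis
    by (subst (asm) measurable_cong_sets[OF refl sets_borel_eq_count_space])
qed

lemma measurable_initial_word_borel: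
  "initial_word n \<in> (borel :: (nat \<Rightarrow> nat) measure) \<rightarrow>\<^sub>M count_space UNIV"
proof (subst measurable_count_space_eq2_countable, intro conjI ballI)
  fix w :: "nat list"
  have "initial_word n -` {w} = (if length w = n then (\<Inter>j\<in>{..<n}. (\<lambda>x. x j) -` {w ! j}) else {})"
    by (auto simp: initial_word_eq_iff)
  moreover have "(\<lambda>x::nat\<Rightarrow>nat. x j) -` {w ! j} \<in> sets borel" for j
    using measurable_sets[OF measurable_coordinate_nat, of "{w ! j}" j] by simp
  ultimately show "initial_word n -` {w} \<inter> space borel \<in> sets borel"
    by (cases "n = 0") (auto intro!: sets.countable_INT')
qed auto

lemma sets_full_shift [measurable]: "full_shift l \<in> sets borel"
proof -
  have "full_shift l = (\<Inter>j. (\<lambda>x. x j) -` {1..l})" by (auto simp: full_shift_def)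
  moreover have "(\<lambda>x::nat\<Rightarrow>nat. x j) -` {1..l} \<in> sets borel" for j
    using measurable_sets[OF measurable_coordinate_nat, of "{1..l}" j] by simp
  ultimately show ?thesis by auto
qed

lemma space_shift_space [simp]: "space (shift_space l) = full_shift l"
  by (simp add: space_restrict_space)

lemma measurable_initial_word [measurable]: "initial_word n \<in> shift_space l \<rightarrow>\<^sub>M count_space UNIV"
  by (rule measurable_restrict_space1[OF measurable_initial_word_borel])

lemma measurable_shift [measurable]: "shift \<in> shift_space l \<rightarrow>\<^sub>M shift_space l"
  by (intro measurable_restrict_space3 borel_measurable_continuous_onI continuous_shift)
    (auto simp: shift_full_shift)

lemma sets_word_cyl [measurable]: "word_cyl l w \<in> sets (shift_space l)"
proof -
  have "word_cyl l w = initial_word (length w) -` {w} \<inter> space (shift_space l)"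
    by (auto simp: word_cyl_def)
  then show ?thesis using measurable_sets[OF measurable_initial_word, of "{w}" "length w" l] by simp
qed

lemma sets_cyl [measurable]: "cyl l i \<in> sets (shift_space l)"
  by (metis sets_word_cyl word_cyl_singleton)

lemma open_contains_word_cyl:
  fixes U :: "(nat \<Rightarrow> nat) set"
  assumes "open U" "x \<in> U" "x \<in> full_shift l"
  obtains w where "x \<in> word_cyl l w" "word_cyl l w \<subseteq> U"
proof -
  have "openin (product_topology (\<lambda>i. euclidean) UNIV) U" using assms(1) by (simp add: open_fun_def)
  from product_topology_open_contains_basis[OF this assms(2)]
  obtain X where X: "x \<in> (\<Pi>\<^sub>E i\<in>UNIV. X i)" "finite {i. X i \<noteq> UNIV}" "(\<Pi>\<^sub>E i\<in>UNIV. X i) \<subseteq> U"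
    by auto
  obtain n where n: "\<And>i. X i \<noteq> UNIV \<Longrightarrow> i < n"
    using X(2) unfolding finite_nat_set_iff_bounded by auto
  have "word_cyl l (initial_word n x) \<subseteq> U"
  proof
    fix y assume "y \<in> word_cyl l (initial_word n x)"
    then have y: "y j = x j" if "j < n" for j using that by (auto simp: word_cyl_eq initial_word_def)
    have "y i \<in> X i" for i
      using n[of i] y[of i] X(1) by (cases "X i = UNIV") (auto simp: PiE_iff)
    then show "y \<in> U" using X(3) by (auto simp: PiE_iff)
  qed
  moreover have "x \<in> word_cyl l (initial_word n x)" using assms(3) by (simp add: word_cyl_def)
  ultimately show thesis using that by blast
qed

text \<open>An open set is the union of the cylinders inside it, and there are only countably many
  words.\<close>

lemma sets_shift_space_eq: "sets (shift_space l) = sigma_sets (full_shift l) (insert {} (range (word_cyl l)))"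
  (is "_ = sigma_sets _ ?E")
proof (rule antisym)
  show "sigma_sets (full_shift l) ?E \<subseteq> sets (shift_space l)"
    using sets.sigma_sets_subset[of ?E "shift_space l"] sets_word_cyl
    by (metis empty_subsetI image_subsetI insert_subset sets.empty_sets space_shift_space)
  have b: "sets (borel :: (nat \<Rightarrow> nat) measure) = sigma_sets UNIV {S. open S}"
    by (simp add: borel_def)
  have "sets (shift_space l) = sigma_sets (full_shift l) ((\<inter>) (full_shift l) ` {S. open S})"
    unfolding sets_restrict_space b
    by (rule sigma_sets_Int) (use sets_full_shift b in auto)
  also have "\<dots> \<subseteq> sigma_sets (full_shift l) ?E"
  proof (rule sigma_sets_mono, clarify)
    fix U :: "(nat \<Rightarrow> nat) set" assume U: "open U"
    let ?D = "{w. word_cyl l w \<subseteq> U}"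
    have "full_shift l \<inter> U = \<Union> (word_cyl l ` ?D)"
    proof (intro equalityI subsetI)
      fix x assume "x \<in> full_shift l \<inter> U"
      then obtain w where "x \<in> word_cyl l w" "word_cyl l w \<subseteq> U"
        using open_contains_word_cyl[OF U, of x l] by blast
      then show "x \<in> \<Union> (word_cyl l ` ?D)" by blast
    next
      fix x assume "x \<in> \<Union> (word_cyl l ` ?D)"
      then show "x \<in> full_shift l \<inter> U" by (auto simp: word_cyl_def)
    qed
    moreover have "\<Union> (word_cyl l ` ?D) \<in> sigma_sets (full_shift l) ?E"
      by (rule sigma_sets_UNION) (auto intro: sigma_sets.Basic)
    ultimately show "full_shift l \<inter> U \<in> sigma_sets (full_shift l) ?E" by simp
  qed
  finally show "sets (shift_space l) \<subseteq> sigma_sets (full_shift l) ?E" .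
qed

text \<open>Cylinders are nested or disjoint, according to whether the shorter word is a prefix of
  the longer one. With the empty set they form an intersection-stable generator.\<close>

lemma word_cyl_Int: "word_cyl l u \<inter> word_cyl l w \<in> {{}, word_cyl l u, word_cyl l w}"
proof -
  have *: "word_cyl l u \<inter> word_cyl l w \<in> {{}, word_cyl l w}" if "length u \<le> length w" for u w
  proof (cases "\<forall>j<length u. u ! j = w ! j")
    case True
    then show ?thesis using that by (auto simp: word_cyl_eq)
  next
    case False
    then have "word_cyl l u \<inter> word_cyl l w = {}" using that by (force simp: word_cyl_eq)
    then show ?thesis by simp
  qed
  show ?thesis using *[of u w] *[of w u] by (cases "length u \<le> length w") (auto simp: Int_commute)
qed

text \<open>Words with a letter outside \<open>{1..l}\<close> have empty cylinders, so comparing the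
  admissible ones covers the whole generator.\<close>

lemma shift_space_measure_eqI:
  assumes "prob_space M" "prob_space N" "sets M = sets (shift_space l)" "sets N = sets (shift_space l)"
    and eq: "\<And>w. w \<in> lists {1..l} \<Longrightarrow> measure M (word_cyl l w) = measure N (word_cyl l w)"
  shows "M = N"
proof -
  interpret M: prob_space M by fact
  interpret N: prob_space N by fact
  show ?thesis
  proof (rule measure_eqI_generator_eq[where A = "\<lambda>_. full_shift l" and \<Omega> = "full_shift l"
        and E = "insert {} (range (word_cyl l))"])
    show "Int_stable (insert {} (range (word_cyl l)))"
      unfolding Int_stable_def
    proof (intro ballI)
      fix a b assume "a \<in> insert {} (range (word_cyl l))" "b \<in> insert {} (range (word_cyl l))"
      then consider "a = {} \<or> b = {}" | u w where "a = word_cyl l u" "b = word_cyl l w" by blast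
      then show "a \<inter> b \<in> insert {} (range (word_cyl l))"
      proof cases
        case 2
        with word_cyl_Int[of l u w] show ?thesis by blast
      qed auto
    qed
    show "insert {} (range (word_cyl l)) \<subseteq> Pow (full_shift l)" by (auto simp: word_cyl_def)
    show "emeasure M X = emeasure N X" if "X \<in> insert {} (range (word_cyl l))" for X
      using that eq word_cyl_empty[of _ l] by (auto simp: M.emeasure_eq_measure N.emeasure_eq_measure) 
        (metis measure_empty)
    show "range (\<lambda>_. full_shift l) \<subseteq> insert {} (range (word_cyl l))"
      using word_cyl_Nil[of l] by (metis image_subsetI insertI2 rangeI)
  qed (use assms(3,4) in \<open>auto simp: sets_shift_space_eq\<close>)
qed

section \<open>Probability measures on the full shift and their cylinder values\<close>

locale shift_prob = prob_space \<mu> for l :: nat and \<mu> :: "(nat \<Rightarrow> nat) measure" +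
  assumes sets_eq [measurable_cong]: "sets \<mu> = sets (shift_space l)"
begin

lemma space_eq [simp]: "space \<mu> = full_shift l"
  using sets_eq_imp_space_eq[OF sets_eq] by simp

text \<open>A function of the first n letters is a finite combination of indicators of cylinders. So
  integrability comes for free and the integral is linear in the cylinder values, the form in which
  integrals of truncated logarithms pass to limits of weights.\<close>

lemma integral_initial_word:
  fixes H :: "nat list \<Rightarrow> real"
  shows "integrable \<mu> (\<lambda>x. H (initial_word n x))"
    and "(\<integral>x. H (initial_word n x) \<partial>\<mu>) = (\<Sum>w\<in>words l n. measure \<mu> (word_cyl l w) * H w)"
proof -
  have m: "word_cyl l w \<in> sets \<mu>" for w by simp
  have eq: "H (initial_word n x) = (\<Sum>w\<in>words l n. H w * indicator (word_cyl l w) x)"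
    if "x \<in> space \<mu>" for x
  proof -
    have "indicator (word_cyl l w) x = (if w = initial_word n x then 1 else (0::real))"
      if "w \<in> words l n" for w
      using that \<open>x \<in> space \<mu>\<close> by (auto simp: word_cyl_def words_def split: split_indicator)
    then have "(\<Sum>w\<in>words l n. H w * indicator (word_cyl l w) x) =
      (\<Sum>w\<in>words l n. if w = initial_word n x then H w else 0)"
      by (intro sum.cong) auto
    also have "\<dots> = H (initial_word n x)"
      using initial_word_in_words[of x l n] that by (simp add: sum.delta)
    finally show ?thesis by simp
  qed
  have int: "integrable \<mu> (\<lambda>x. \<Sum>w\<in>words l n. H w * indicator (word_cyl l w) x)"
    using m by (intro Bochner_Integration.integrable_sum integrable_mult_right) (auto simp: emeasure_eq_measure)
  then show "integrable \<mu> (\<lambda>x. H (initial_word n x))"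
    by (subst Bochner_Integration.integrable_cong[OF refl eq]) auto
  have "(\<integral>x. H (initial_word n x) \<partial>\<mu>) = (\<integral>x. (\<Sum>w\<in>words l n. H w * indicator (word_cyl l w) x) \<partial>\<mu>)"
    by (rule Bochner_Integration.integral_cong[OF refl eq])
  also have "\<dots> = (\<Sum>w\<in>words l n. H w * measure \<mu> (word_cyl l w))"
    using m by (subst Bochner_Integration.integral_sum) (auto simp: emeasure_eq_measure integrable_mult_right)
  finally show "(\<integral>x. H (initial_word n x) \<partial>\<mu>) = (\<Sum>w\<in>words l n. measure \<mu> (word_cyl l w) * H w)"
    by (simp add: mult.commute)
qed

lemma word_cyl_snoc: "w \<in> lists {1..l} \<Longrightarrow>
    measure \<mu> (word_cyl l w) = (\<Sum>a\<in>{1..l}. measure \<mu> (word_cyl l (w @ [a])))"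
proof -
  have "word_cyl l w = (\<Union>a\<in>{1..l}. word_cyl l (w @ [a]))"
    by (auto simp: word_cyl_def initial_word_Suc full_shift_def)
  moreover have "disjoint_family_on (\<lambda>a. word_cyl l (w @ [a])) {1..l}"
    by (auto simp: disjoint_family_on_def word_cyl_def initial_word_Suc)
  moreover have "(\<lambda>a. word_cyl l (w @ [a])) ` {1..l} \<subseteq> sets \<mu>" by auto
  ultimately show ?thesis by (simp only: finite_measure_finite_Union finite_atLeastAtMost)
qed

end

locale invariant_prob = shift_prob l \<mu> for l :: nat and \<mu> :: "(nat \<Rightarrow> nat) measure" +
  assumes inv: "B \<in> sets \<mu> \<Longrightarrow> measure \<mu> (shift -` B \<inter> space \<mu>) = measure \<mu> B"
begin

lemma distr_shift: "distr \<mu> \<mu> shift = \<mu>"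
proof (rule measure_eqI)
  fix B assume "B \<in> sets (distr \<mu> \<mu> shift)"
  then have B: "B \<in> sets \<mu>" by simp
  have "shift \<in> \<mu> \<rightarrow>\<^sub>M \<mu>" by measurable
  then show "emeasure (distr \<mu> \<mu> shift) B = emeasure \<mu> B"
    using B inv[OF B] by (simp add: emeasure_distr emeasure_eq_measure)
qed simp

lemma distr_shift_funpow: "distr \<mu> \<mu> (shift ^^ k) = \<mu>"
proof (induction k)
  case (Suc k)
  have m: "shift \<in> \<mu> \<rightarrow>\<^sub>M \<mu>" "shift ^^ k \<in> \<mu> \<rightarrow>\<^sub>M \<mu>" by measurable
  have "distr \<mu> \<mu> (shift \<circ> (shift ^^ k)) = distr (distr \<mu> \<mu> (shift ^^ k)) \<mu> shift"
    using distr_distr[OF m] by simp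
  then show ?case using Suc distr_shift by (simp add: comp_def)
qed (simp add: distr_id2 id_def)

lemma integral_shift_funpow:
  fixes f :: "_ \<Rightarrow> real"
  assumes "f \<in> borel_measurable \<mu>"
  shows "(\<integral>x. f ((shift ^^ k) x) \<partial>\<mu>) = (\<integral>x. f x \<partial>\<mu>)"
proof -
  have m: "shift ^^ k \<in> \<mu> \<rightarrow>\<^sub>M \<mu>" by measurable
  show ?thesis using integral_distr[OF m assms] distr_shift_funpow by simp
qed

text \<open>Prepending letters to w gives the pieces of the preimage of its cylinder under the
  shift, so this is invariance read on cylinders.\<close>

lemma word_cyl_Cons: "w \<in> lists {1..l} \<Longrightarrow>
    measure \<mu> (word_cyl l w) = (\<Sum>a\<in>{1..l}. measure \<mu> (word_cyl l (a # w)))"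
proof -
  have "shift -` word_cyl l w \<inter> space \<mu> = (\<Union>a\<in>{1..l}. word_cyl l (a # w))"
    by (auto simp: word_cyl_def initial_word_Suc_shift shift_full_shift) (auto simp: full_shift_def)
  moreover have "disjoint_family_on (\<lambda>a. word_cyl l (a # w)) {1..l}"
    by (auto simp: disjoint_family_on_def word_cyl_def initial_word_Suc_shift)
  ultimately have "measure \<mu> (shift -` word_cyl l w \<inter> space \<mu>) = (\<Sum>a\<in>{1..l}. measure \<mu> (word_cyl l (a # w)))"
    using finite_measure_finite_Union[of "{1..l}" "\<lambda>a. word_cyl l (a # w)"] by (simp add: image_subset_iff)
  then show ?thesis by (subst (asm) inv) auto
qed

end

lemma invariant_measures_iff: "\<mu> \<in> invariant_measures l \<longleftrightarrow> invariant_prob l \<mu>"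
  by (auto simp: invariant_measures_def invariant_prob_def invariant_prob_axioms_def shift_prob_def
      shift_prob_axioms_def)

section \<open>Measures with prescribed cylinder weights\<close>

text \<open>\<open>snoc\<close> is the consistency condition of Kolmogorov and \<open>Cons\<close>
  is invariance under the shift. Together these are the constraints satisfied by the cylinder values
  of an invariant probability measure, and the construction below shows that there are no others on
  admissible words.\<close>

locale word_weights =
  fixes l :: nat and p :: "nat list \<Rightarrow> real"
  assumes nonneg: "0 \<le> p w"
    and Nil: "p [] = 1"
    and snoc: "w \<in> lists {1..l} \<Longrightarrow> p w = (\<Sum>a\<in>{1..l}. p (w @ [a]))"
    and Cons: "w \<in> lists {1..l} \<Longrightarrow> p w = (\<Sum>a\<in>{1..l}. p (a # w))"
begin

text \<open>
  The unit interval is cut into intervals of length \<open>p w\<close>, in lexicographic order, and the measure is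
  the law of the expansion of a uniformly distributed point.
\<close>

definition left :: "nat list \<Rightarrow> real" where
  "left w = (\<Sum>k<length w. \<Sum>b\<in>{1..<w ! k}. p (take k w @ [b]))"

text \<open>Half-open, so that the one-letter extensions split an interval exactly, with no
  exceptional endpoints; a word of weight 0 gets the empty interval and is never the expansion of a
  point of \<open>{0..<1}\<close>.\<close>

definition ivl :: "nat list \<Rightarrow> real set" where
  "ivl w = {left w ..< left w + p w}"

primrec expansion :: "nat \<Rightarrow> real \<Rightarrow> nat list" where
  "expansion 0 t = []"
| "expansion (Suc n) t = expansion n t @ [THE a. a \<in> {1..l} \<and> t \<in> ivl (expansion n t @ [a])]"

definition expansion_seq :: "real \<Rightarrow> nat \<Rightarrow> nat" where
  "expansion_seq t n = expansion (Suc n) t ! n"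

lemma left_snoc: "left (w @ [a]) = left w + (\<Sum>b\<in>{1..<a}. p (w @ [b]))"
  by (simp add: left_def nth_append)

lemma ivl_snoc: "1 \<le> a \<Longrightarrow>
  ivl (w @ [a]) = {left w + (\<Sum>b\<in>{1..<a}. p (w @ [b])) ..< left w + (\<Sum>b\<in>{1..<Suc a}. p (w @ [b]))}"
  by (simp add: ivl_def left_snoc sum.atLeastLessThan_Suc add.assoc)

lemma ivl_Nil: "ivl [] = {0..<1}"
  by (simp add: ivl_def left_def Nil)

lemma ivl_split_ex:
  assumes w: "w \<in> lists {1..l}" and t: "t \<in> ivl w"
  shows "\<exists>a. a \<in> {1..l} \<and> t \<in> ivl (w @ [a])"
proof -
  define g where "g a = (\<Sum>b\<in>{1..<a}. p (w @ [b]))" for a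
  have gl: "g (Suc l) = p w" using snoc[OF w] by (simp add: g_def atLeastLessThanSuc_atLeastAtMost)
  \<comment> \<open>The first letter whose right endpoint lies beyond t. Letter 0 is excluded
    because \<open>g 1 = 0\<close> leaves its right endpoint at \<open>left w\<close>.\<close>
  define a where "a = (LEAST a. t < left w + g (Suc a))"
  have l: "t < left w + g (Suc l)" using t gl by (simp add: ivl_def)
  have a: "t < left w + g (Suc a)" "a \<le> l"
    unfolding a_def using LeastI[of "\<lambda>a. t < left w + g (Suc a)", OF l] Least_le[of "\<lambda>a. t < left w + g (Suc a)", OF l]
    by auto
  have "g 1 = 0" by (simp add: g_def)
  then have "a \<noteq> 0" using a(1) t by (intro notI) (auto simp: ivl_def)
  then obtain c where c: "a = Suc c" by (cases a) auto
  have "\<not> t < left w + g (Suc c)"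
    using not_less_Least[of c "\<lambda>a. t < left w + g (Suc a)"] c unfolding a_def by simp
  then have "t \<in> ivl (w @ [a])" using a(1) c ivl_snoc[of a w] by (simp add: g_def)
  then show ?thesis using a(2) c by auto
qed

lemma ivl_split_unique:
  assumes "1 \<le> a" "1 \<le> b" "t \<in> ivl (w @ [a])" "t \<in> ivl (w @ [b])"
  shows "a = b"
proof -
  have *: False if "1 \<le> a" "1 \<le> b" "t \<in> ivl (w @ [a])" "t \<in> ivl (w @ [b])" "a < b" for a b
  proof -
    have "(\<Sum>c\<in>{1..<Suc a}. p (w @ [c])) \<le> (\<Sum>c\<in>{1..<b}. p (w @ [c]))"
      using that(5) by (intro sum_mono2) (auto simp: nonneg)
    then show False using that by (auto simp: ivl_snoc)
  qed
  show ?thesis using *[of a b] *[of b a] assms by (meson nat_neq_iff)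
qed

lemma expansion_step:
  assumes "w \<in> lists {1..l}" "t \<in> ivl w"
  shows "(THE a. a \<in> {1..l} \<and> t \<in> ivl (w @ [a])) \<in> {1..l}"
    "t \<in> ivl (w @ [THE a. a \<in> {1..l} \<and> t \<in> ivl (w @ [a])])"
proof -
  have "\<exists>!a. a \<in> {1..l} \<and> t \<in> ivl (w @ [a])"
    using ivl_split_ex[OF assms] ivl_split_unique[of _ _ t w] by auto
  from theI'[OF this] show "(THE a. a \<in> {1..l} \<and> t \<in> ivl (w @ [a])) \<in> {1..l}"
    "t \<in> ivl (w @ [THE a. a \<in> {1..l} \<and> t \<in> ivl (w @ [a])])" by auto
qed

lemma expansion_in:
  assumes t: "t \<in> {0..<1}"
  shows "expansion n t \<in> words l n \<and> t \<in> ivl (expansion n t)"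
proof (induction n)
  case 0
  show ?case using t ivl_Nil by simp
next
  case (Suc n)
  then have "expansion n t \<in> lists {1..l}" by (auto simp: words_def)
  from expansion_step[OF this, of t] Suc show ?case
    unfolding expansion.simps words_snoc_iff by blast
qed

lemma ivl_snoc_subset:
  assumes "w @ [a] \<in> lists {1..l}"
  shows "ivl (w @ [a]) \<subseteq> ivl w"
proof -
  have a: "1 \<le> a" "a \<le> l" and w: "w \<in> lists {1..l}" using assms by auto
  have "(\<Sum>b\<in>{1..<Suc a}. p (w @ [b])) \<le> (\<Sum>b\<in>{1..l}. p (w @ [b]))"
    using a by (intro sum_mono2) (auto simp: nonneg)
  moreover have "0 \<le> (\<Sum>b\<in>{1..<a}. p (w @ [b]))" by (intro sum_nonneg nonneg)
  ultimately show ?thesis unfolding ivl_snoc[OF a(1)] unfolding ivl_def using snoc[OF w] by auto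
qed

lemma expansion_unique: "w \<in> words l n \<Longrightarrow> t \<in> ivl w \<Longrightarrow> t \<in> {0..<1} \<and> expansion n t = w"
proof (induction n arbitrary: w)
  case 0
  then show ?case using ivl_Nil by simp
next
  case (Suc n)
  then obtain u a where w: "w = u @ [a]" by (cases w rule: rev_cases) (auto simp: words_def)
  have u: "u \<in> words l n" and a: "a \<in> {1..l}" using Suc.prems(1) words_snoc_iff unfolding w by auto
  have l: "u \<in> lists {1..l}" "w \<in> lists {1..l}" using u Suc.prems(1) by (auto simp: words_def)
  have tu: "t \<in> ivl u" using ivl_snoc_subset[of u a] l Suc.prems(2) unfolding w by blast
  have IH: "t \<in> {0..<1}" "expansion n t = u" using Suc.IH[OF u tu] by auto
  have "(THE a. a \<in> {1..l} \<and> t \<in> ivl (u @ [a])) = a"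
    using expansion_step[OF l(1) tu] ivl_split_unique[of _ a t u] a Suc.prems(2) unfolding w by auto
  then show ?case using IH w by simp
qed

lemma expansion_eq_iff: "w \<in> words l n \<Longrightarrow> {t \<in> {0..<1}. expansion n t = w} = ivl w"
  using expansion_unique[of w n] expansion_in[of _ n] by blast

lemma length_expansion: "length (expansion n t) = n"
  by (induction n) auto

lemma expansion_nth: "m \<le> n \<Longrightarrow> j < m \<Longrightarrow> expansion n t ! j = expansion m t ! j"
proof (induction n)
  case (Suc n)
  then show ?case by (cases "m = Suc n") (auto simp: nth_append length_expansion)
qed simp

lemma initial_word_expansion_seq: "initial_word n (expansion_seq t) = expansion n t"
  unfolding initial_word_eq_iff expansion_seq_def
  using expansion_nth[of "Suc _" n] by (auto simp: length_expansion Suc_le_eq simp del: expansion.simps)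

section \<open>The law of the expansion as an invariant measure\<close>

definition unit_measure :: "real measure" where
  "unit_measure = restrict_space lborel {0..<1}"

definition weight_measure :: "(nat \<Rightarrow> nat) measure" where
  "weight_measure = distr unit_measure (shift_space l) expansion_seq"

lemma prob_space_unit: "prob_space unit_measure"
  by (rule prob_spaceI) (simp add: unit_measure_def emeasure_restrict_space space_restrict_space)

lemma space_unit [simp]: "space unit_measure = {0..<1}"
  by (simp add: unit_measure_def space_restrict_space)

lemma sets_ivl: "w \<in> words l n \<Longrightarrow> ivl w \<in> sets unit_measure"
proof -
  assume "w \<in> words l n"
  then have "ivl w \<subseteq> {0..<1}" using expansion_unique by blast
  moreover have "ivl w \<in> sets lborel" by (simp add: ivl_def)
  ultimately show ?thesis
    unfolding unit_measure_def by (subst sets_restrict_space_iff) auto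
qed

lemma measurable_expansion_seq: "expansion_seq \<in> unit_measure \<rightarrow>\<^sub>M shift_space l"
proof (rule measurable_restrict_space2)
  show "expansion_seq \<in> space unit_measure \<rightarrow> full_shift l"
  proof
    fix t assume "t \<in> space unit_measure"
    then have "expansion (Suc n) t \<in> words l (Suc n)" for n
      using expansion_in[of t "Suc n"] unfolding space_unit by blast
    then have "expansion (Suc n) t ! n \<in> {1..l}" for n
      unfolding words_def by (metis (mono_tags, lifting) lessI mem_Collect_eq nth_mem subsetD)
    then show "expansion_seq t \<in> full_shift l" by (auto simp: full_shift_def expansion_seq_def)
  qed
  show "expansion_seq \<in> borel_measurable unit_measure"
  proof (rule measurable_coordinatewise_then_product)
    fix n
    have "(\<lambda>t. expansion_seq t n) \<in> unit_measure \<rightarrow>\<^sub>M count_space UNIV"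
    proof (subst measurable_count_space_eq2_countable, intro conjI ballI)
      fix a :: nat
      have "(\<lambda>t. expansion_seq t n) -` {a} \<inter> space unit_measure =
        (\<Union>w\<in>{w\<in>words l (Suc n). w ! n = a}. ivl w)"
        unfolding expansion_seq_def
      proof (intro equalityI subsetI)
        fix t assume t: "t \<in> (\<lambda>t. expansion (Suc n) t ! n) -` {a} \<inter> space unit_measure"
        then have "expansion (Suc n) t \<in> words l (Suc n) \<and> t \<in> ivl (expansion (Suc n) t)"
          by (intro expansion_in) auto
        with t show "t \<in> (\<Union>w\<in>{w\<in>words l (Suc n). w ! n = a}. ivl w)" by blast
      next
        fix t assume "t \<in> (\<Union>w\<in>{w\<in>words l (Suc n). w ! n = a}. ivl w)"
        then obtain w where w: "w \<in> words l (Suc n)" "w ! n = a" "t \<in> ivl w" by blast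
        with expansion_unique[OF w(1,3)]
        show "t \<in> (\<lambda>t. expansion (Suc n) t ! n) -` {a} \<inter> space unit_measure"
          by (simp del: expansion.simps)
      qed
      also have "\<dots> \<in> sets unit_measure"
        using sets_ivl by (intro sets.finite_UN) auto
      finally show "(\<lambda>t. expansion_seq t n) -` {a} \<inter> space unit_measure \<in> sets unit_measure" .
    qed auto
    then show "(\<lambda>t. expansion_seq t n) \<in> borel_measurable unit_measure"
      by (subst measurable_cong_sets[OF refl sets_borel_eq_count_space])
  qed
qed

lemma prob_space_weight_measure: "prob_space weight_measure"
  unfolding weight_measure_def
  by (rule prob_space.prob_space_distr[OF prob_space_unit measurable_expansion_seq])

lemma measure_weight_measure:
  assumes "w \<in> lists {1..l}"
  shows "measure weight_measure (word_cyl l w) = p w"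
proof -
  have w: "w \<in> words l (length w)" using assms by (auto simp: words_def)
  have "expansion_seq -` word_cyl l w \<inter> space unit_measure = ivl w"
    using measurable_space[OF measurable_expansion_seq] unfolding expansion_eq_iff[OF w, symmetric]
    by (auto simp: word_cyl_def initial_word_expansion_seq)
  then have "measure weight_measure (word_cyl l w) = measure unit_measure (ivl w)"
    unfolding weight_measure_def by (subst measure_distr[OF measurable_expansion_seq]) auto
  also have "\<dots> = measure lborel (ivl w)"
    unfolding unit_measure_def using expansion_unique[OF w] by (intro measure_restrict_space) auto
  also have "\<dots> = p w" using nonneg by (simp add: ivl_def)
  finally show ?thesis .
qed

text \<open>The measure and its image under the shift agree on every cylinder by
  \<open>Cons\<close>, hence are equal; \<open>snoc\<close> was spent on building the
  expansion.\<close>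

lemma invariant_weight_measure: "invariant_prob l weight_measure"
proof -
  have s: "sets weight_measure = sets (shift_space l)" by (simp add: weight_measure_def)
  interpret shift_prob l weight_measure
    by (intro shift_prob.intro shift_prob_axioms.intro prob_space_weight_measure s)
  have m: "shift \<in> weight_measure \<rightarrow>\<^sub>M weight_measure" by measurable
  have "distr weight_measure weight_measure shift = weight_measure"
  proof (rule shift_space_measure_eqI[of _ _ l])
    fix w assume w: "w \<in> lists {1..l}"
    have "shift -` word_cyl l w \<inter> space weight_measure = (\<Union>a\<in>{1..l}. word_cyl l (a # w))"
      by (auto simp: word_cyl_def initial_word_Suc_shift shift_full_shift) (auto simp: full_shift_def)
    then have "measure (distr weight_measure weight_measure shift) (word_cyl l w) =
      measure weight_measure (\<Union>a\<in>{1..l}. word_cyl l (a # w))"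
      by (subst measure_distr[OF m]) auto
    also have "\<dots> = (\<Sum>a\<in>{1..l}. measure weight_measure (word_cyl l (a # w)))"
    proof (rule finite_measure_finite_Union)
      show "disjoint_family_on (\<lambda>a. word_cyl l (a # w)) {1..l}"
        by (auto simp: disjoint_family_on_def word_cyl_def initial_word_Suc_shift)
    qed auto
    also have "\<dots> = (\<Sum>a\<in>{1..l}. p (a # w))" using w by (intro sum.cong measure_weight_measure) auto
    also have "\<dots> = measure weight_measure (word_cyl l w)"
      using Cons[OF w] measure_weight_measure[OF w] by simp
    finally show "measure (distr weight_measure weight_measure shift) (word_cyl l w) =
      measure weight_measure (word_cyl l w)" .
  qed (use prob_space_distr[OF m] prob_space_weight_measure s in auto)
  then have "measure weight_measure (shift -` B \<inter> space weight_measure) = measure weight_measure B"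
    if "B \<in> sets weight_measure" for B
    using measure_distr[OF m that] by simp
  then show ?thesis by unfold_locales
qed

end

section \<open>Nonnegative growth exponents\<close>

text \<open>The truncation at \<open>\<delta>\<close> keeps every integrand finite. For nonnegative
  H, all truncated integrals at time n are nonnegative exactly when the extended integral of the
  logarithm is, with the value minus infinity where H vanishes.\<close>

definition nonneg_exponent :: "(nat \<Rightarrow> nat) measure \<Rightarrow> (nat list \<Rightarrow> real) \<Rightarrow> bool" where
  "nonneg_exponent \<mu> H \<longleftrightarrow> (\<forall>n\<ge>1. \<forall>\<delta>>0. 0 \<le> (\<integral>x. ln (max (H (initial_word n x)) \<delta>) \<partial>\<mu>))"

locale submultiplicative =
  fixes l :: nat and H :: "nat list \<Rightarrow> real"
  assumes H_nonneg: "0 \<le> H w"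
    and H_Nil: "H [] \<le> 1"
    and H_append: "u \<in> lists {1..l} \<Longrightarrow> w \<in> lists {1..l} \<Longrightarrow> H (u @ w) \<le> H u * H w"
begin

text \<open>Truncation respects submultiplicativity if the level is raised along with the number of
  blocks: k blocks truncated at \<open>\<delta>\<close> bound a product truncated at
  \<open>\<delta> ^ k\<close>.\<close>

lemma truncated_power:
  assumes x: "x \<in> full_shift l" and \<delta>: "\<delta> > 0"
  shows "max (H (initial_word (k * n) x)) (\<delta> ^ k) \<le>
    (\<Prod>j<k. max (H (initial_word n ((shift ^^ (j * n)) x))) \<delta>)"
proof (induction k)
  case 0
  show ?case using H_Nil by simp
next
  case (Suc k)
  let ?P = "\<Prod>j<k. max (H (initial_word n ((shift ^^ (j * n)) x))) \<delta>"
  let ?m = "max (H (initial_word n ((shift ^^ (k * n)) x))) \<delta>"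
  have P0: "0 \<le> ?P" by (intro prod_nonneg) (auto simp: H_nonneg le_max_iff_disj)
  have "H (initial_word (k * n) x @ initial_word n ((shift ^^ (k * n)) x)) \<le>
      H (initial_word (k * n) x) * H (initial_word n ((shift ^^ (k * n)) x))"
    using initial_word_in_words[OF x, of "k * n"]
      initial_word_in_words[OF shift_funpow_full_shift[OF x, of "k * n"], of n]
    by (intro H_append) (auto simp: words_def)
  also have "\<dots> \<le> ?P * ?m" using Suc by (intro mult_mono) (auto simp: H_nonneg intro: order_trans[OF H_nonneg])
  finally have 1: "H (initial_word (Suc k * n) x) \<le> ?P * ?m"
    by (simp add: initial_word_add[symmetric] add.commute)
  have 2: "\<delta> ^ Suc k \<le> ?P * ?m"
    using Suc \<delta> P0 mult_mono[of "\<delta> ^ k" ?P \<delta> ?m] by (simp add: mult.commute)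
  show ?case using 1 2 by simp
qed

text \<open>The logarithms of the k blocks all have the same integral by invariance. Hence a
  negative truncated integral at a single time n forces a linear decrease along the multiples of n,
  the source of the contradictions below.\<close>

lemma integral_truncated_power:
  assumes "invariant_prob l \<mu>" and \<delta>: "\<delta> > 0"
  shows "(\<integral>x. ln (max (H (initial_word (k * n) x)) (\<delta> ^ k)) \<partial>\<mu>) \<le>
    real k * (\<integral>x. ln (max (H (initial_word n x)) \<delta>) \<partial>\<mu>)"
proof -
  interpret invariant_prob l \<mu> by fact
  let ?f = "\<lambda>x. ln (max (H (initial_word n x)) \<delta>)"
  have int: "integrable \<mu> (\<lambda>x. ?f ((shift ^^ m) x))" for m
  proof -
    \<comment> \<open>The shifted function still depends on finitely many letters: it reads the
      first m + n and drops m of them.\<close>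
    have "integrable \<mu> (\<lambda>x. ln (max (H (drop m (initial_word (m + n) x))) \<delta>))"
      by (rule integral_initial_word(1))
    then show ?thesis by (simp add: initial_word_add)
  qed
  have "(\<integral>x. ln (max (H (initial_word (k * n) x)) (\<delta> ^ k)) \<partial>\<mu>) \<le>
      (\<integral>x. (\<Sum>j<k. ?f ((shift ^^ (j * n)) x)) \<partial>\<mu>)"
  proof (rule integral_mono)
    fix x assume "x \<in> space \<mu>"
    then have x: "x \<in> full_shift l" by simp
    have "ln (max (H (initial_word (k * n) x)) (\<delta> ^ k)) \<le>
        ln (\<Prod>j<k. max (H (initial_word n ((shift ^^ (j * n)) x))) \<delta>)"
      using truncated_power[OF x \<delta>, of k n] \<delta> by (intro ln_mono) (auto intro: less_max_iff_disj[THEN iffD2])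
    also have "\<dots> = (\<Sum>j<k. ?f ((shift ^^ (j * n)) x))"
      using \<delta> by (intro ln_prod) (auto simp: max_def)
    finally show "ln (max (H (initial_word (k * n) x)) (\<delta> ^ k)) \<le> (\<Sum>j<k. ?f ((shift ^^ (j * n)) x))" .
  qed (use int integral_initial_word(1)[of "\<lambda>w. ln (max (H w) (\<delta> ^ k))"] in auto)
  also have "\<dots> = (\<Sum>j<k. \<integral>x. ?f ((shift ^^ (j * n)) x) \<partial>\<mu>)"
    by (rule Bochner_Integration.integral_sum) (rule int)
  also have "\<dots> = (\<Sum>j<k. \<integral>x. ?f x \<partial>\<mu>)"
    using int[of 0] by (intro sum.cong integral_shift_funpow) auto
  finally show ?thesis by simp
qed

text \<open>The factor K adds \<open>ln K\<close> once, whereas a negative integral of H at time n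
  is multiplied by k at time k n. So the property is insensitive to passing to an equivalent
  norm.\<close>

lemma nonneg_exponent_equiv:
  assumes "invariant_prob l \<mu>" and G: "nonneg_exponent \<mu> G"
    and GH: "\<And>w. w \<in> lists {1..l} \<Longrightarrow> G w \<le> K * H w" and K: "K > 0"
  shows "nonneg_exponent \<mu> H"
  unfolding nonneg_exponent_def
proof (intro allI impI)
  fix n :: nat and \<delta> :: real assume n: "n \<ge> 1" and \<delta>: "\<delta> > 0"
  interpret invariant_prob l \<mu> by fact
  let ?I = "\<integral>x. ln (max (H (initial_word n x)) \<delta>) \<partial>\<mu>"
  have *: "0 \<le> ln K + real k * ?I" if k: "k \<ge> 1" for k
  proof -
    have "0 \<le> (\<integral>x. ln (max (G (initial_word (k * n) x)) (K * \<delta> ^ k)) \<partial>\<mu>)"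
      using G n k K \<delta> unfolding nonneg_exponent_def by simp
    also have "\<dots> \<le> (\<integral>x. ln K + ln (max (H (initial_word (k * n) x)) (\<delta> ^ k)) \<partial>\<mu>)"
    proof (rule integral_mono)
      fix x assume "x \<in> space \<mu>"
      then have "G (initial_word (k * n) x) \<le> K * H (initial_word (k * n) x)"
        using initial_word_in_words[of x l "k * n"] by (intro GH) (auto simp: words_def)
      then have "max (G (initial_word (k * n) x)) (K * \<delta> ^ k) \<le> K * max (H (initial_word (k * n) x)) (\<delta> ^ k)"
        using K by (auto simp: max_def intro: order_trans mult_left_mono)
      moreover have p: "max (H (initial_word (k * n) x)) (\<delta> ^ k) > 0" using \<delta> by (simp add: less_max_iff_disj)
      ultimately have "ln (max (G (initial_word (k * n) x)) (K * \<delta> ^ k)) \<le>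
          ln (K * max (H (initial_word (k * n) x)) (\<delta> ^ k))"
        using K \<delta> by (intro ln_mono) (auto simp: less_max_iff_disj)
      also have "\<dots> = ln K + ln (max (H (initial_word (k * n) x)) (\<delta> ^ k))"
        using K p by (simp add: ln_mult)
      finally show "ln (max (G (initial_word (k * n) x)) (K * \<delta> ^ k)) \<le>
        ln K + ln (max (H (initial_word (k * n) x)) (\<delta> ^ k))" .
    qed (use integral_initial_word(1)[of "\<lambda>w. ln (max (G w) (K * \<delta> ^ k))"]
          integral_initial_word(1)[of "\<lambda>w. ln (max (H w) (\<delta> ^ k))"] in auto)
    also have "\<dots> = ln K + (\<integral>x. ln (max (H (initial_word (k * n) x)) (\<delta> ^ k)) \<partial>\<mu>)"
      using integral_initial_word(1)[of "\<lambda>w. ln (max (H w) (\<delta> ^ k))"] prob_space by simp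
    also have "\<dots> \<le> ln K + real k * ?I"
      using integral_truncated_power[OF assms(1) \<delta>] by simp
    finally show ?thesis .
  qed
  show "0 \<le> ?I"
  proof (rule ccontr)
    assume "\<not> 0 \<le> ?I"
    then have neg: "- ?I > 0" by simp
    obtain k :: nat where k: "\<bar>ln K\<bar> < real k * (- ?I)"
      using reals_Archimedean3[OF neg] by blast
    then have "k \<ge> 1" by (cases k) auto
    from *[OF this] k show False by linarith
  qed
qed

text \<open>Growth under the other component is subexponential, so it contributes at most
  \<open>ln C\<close> plus an arbitrarily small multiple of the time, which cannot offset a linear
  decrease under \<open>\<nu>\<close>.\<close>

lemma nonneg_exponent_face:
  assumes "invariant_prob l \<mu>" "invariant_prob l \<nu>" "invariant_prob l \<nu>'"
    and dec: "\<And>w. measure \<mu> (word_cyl l w) = b * measure \<nu> (word_cyl l w) + (1 - b) * measure \<nu>' (word_cyl l w)"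
    and b: "0 < b" "b \<le> 1"
    and subexp: "\<And>\<eta>. \<eta> > 0 \<Longrightarrow> \<exists>C. \<forall>w\<in>lists {1..l}. H w \<le> C * (1 + \<eta>) ^ length w"
    and ne: "nonneg_exponent \<mu> H"
  shows "nonneg_exponent \<nu> H"
  unfolding nonneg_exponent_def
proof (intro allI impI)
  interpret M: invariant_prob l \<mu> by fact
  interpret N: invariant_prob l \<nu> by fact
  interpret N': invariant_prob l \<nu>' by fact
  have dec': "(\<integral>x. F (initial_word n x) \<partial>\<mu>) =
      b * (\<integral>x. F (initial_word n x) \<partial>\<nu>) + (1 - b) * (\<integral>x. F (initial_word n x) \<partial>\<nu>')"
    for F :: "nat list \<Rightarrow> real" and n
    unfolding M.integral_initial_word N.integral_initial_word N'.integral_initial_word dec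
    by (simp add: sum_distrib_left sum.distrib sum_subtractf algebra_simps)
  \<comment> \<open>Levels up to 1 suffice, since the integral increases with
    \<open>\<delta>\<close>; for them \<open>\<delta> ^ k\<close> stays below the growth
    bound.\<close>
  have small: "0 \<le> (\<integral>x. ln (max (H (initial_word n x)) \<delta>) \<partial>\<nu>)"
    if n: "n \<ge> 1" and \<delta>: "\<delta> > 0" "\<delta> \<le> 1" for n :: nat and \<delta> :: real
  proof (rule ccontr)
    let ?I = "\<integral>x. ln (max (H (initial_word n x)) \<delta>) \<partial>\<nu>"
    assume "\<not> 0 \<le> ?I"
    then have neg: "- (b * ?I) > 0" using b by (simp add: mult_pos_neg)
    \<comment> \<open>With this rate the other component gains, over each block of n letters, at
      most half of what \<open>\<nu>\<close> loses.\<close>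
    define \<eta> where "\<eta> = - (b * ?I) / (2 * real n)"
    have \<eta>: "\<eta> > 0" using neg n unfolding \<eta>_def by (intro divide_pos_pos) auto
    then obtain C0 where C0: "\<And>w. w \<in> lists {1..l} \<Longrightarrow> H w \<le> C0 * (1 + \<eta>) ^ length w"
      using subexp by blast
    \<comment> \<open>Enlarged to at least 1 so that \<open>ln C\<close> is nonnegative, the weight
      1 - b can be replaced by 1, and the growth bound stays above the truncation level.\<close>
    define C where "C = max C0 1"
    have C1: "C \<ge> 1" by (simp add: C_def)
    have C: "H w \<le> C * (1 + \<eta>) ^ length w" if "w \<in> lists {1..l}" for w
      using \<eta> by (intro order_trans[OF C0[OF that]] mult_right_mono) (auto simp: C_def)
    obtain k :: nat where k: "2 * ln C < real k * (- (b * ?I))"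
      using reals_Archimedean3[OF neg] by blast
    have "k \<ge> 1" using k C1 by (cases k) auto
    let ?g = "\<lambda>x. ln (max (H (initial_word (k * n) x)) (\<delta> ^ k))"
    have le: "(\<integral>x. ?g x \<partial>\<nu>') \<le> ln C + real (k * n) * \<eta>"
    proof -
      have "(\<integral>x. ?g x \<partial>\<nu>') \<le> (\<integral>x. ln C + real (k * n) * \<eta> \<partial>\<nu>')"
      proof (rule integral_mono)
        fix x assume "x \<in> space \<nu>'"
        then have "initial_word (k * n) x \<in> lists {1..l}"
          using initial_word_in_words[of x l "k * n"] by (auto simp: words_def)
        from C[OF this] have 1: "H (initial_word (k * n) x) \<le> C * (1 + \<eta>) ^ (k * n)" by simp
        have "\<delta> ^ k \<le> 1" using \<delta> by (simp add: power_le_one)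
        also have "1 \<le> C * (1 + \<eta>) ^ (k * n)"
          using C1 \<eta> mult_mono[of 1 C 1 "(1 + \<eta>) ^ (k * n)"] by simp
        finally have "max (H (initial_word (k * n) x)) (\<delta> ^ k) \<le> C * (1 + \<eta>) ^ (k * n)" using 1 by simp
        then have "?g x \<le> ln (C * (1 + \<eta>) ^ (k * n))"
          using \<delta> by (intro ln_mono) (auto simp: less_max_iff_disj)
        also have "\<dots> = ln C + real (k * n) * ln (1 + \<eta>)"
          using C1 \<eta> by (simp add: ln_mult ln_realpow)
        also have "\<dots> \<le> ln C + real (k * n) * \<eta>"
          using ln_add_one_self_le_self[of \<eta>] \<eta> by (intro add_left_mono mult_left_mono) auto
        finally show "?g x \<le> ln C + real (k * n) * \<eta>" .
      qed (use N'.integral_initial_word(1)[of "\<lambda>w. ln (max (H w) (\<delta> ^ k))"] in auto)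
      then show ?thesis using N'.prob_space by simp
    qed
    have "0 \<le> (\<integral>x. ?g x \<partial>\<mu>)"
      using ne n \<open>k \<ge> 1\<close> \<delta> unfolding nonneg_exponent_def by simp
    also have "\<dots> = b * (\<integral>x. ?g x \<partial>\<nu>) + (1 - b) * (\<integral>x. ?g x \<partial>\<nu>')"
      by (rule dec'[of "\<lambda>w. ln (max (H w) (\<delta> ^ k))"])
    also have "\<dots> \<le> b * (real k * ?I) + (1 - b) * (ln C + real (k * n) * \<eta>)"
      using integral_truncated_power[OF assms(2) \<delta>(1), of k n] le b by (intro add_mono mult_left_mono) auto
    also have "\<dots> \<le> b * (real k * ?I) + 1 * (ln C + real (k * n) * \<eta>)"
      using b C1 \<eta> by (intro add_left_mono mult_right_mono) auto
    also have "real (k * n) * \<eta> = real k * (- (b * ?I)) / 2" using n by (simp add: \<eta>_def)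
    finally show False using k by (simp add: algebra_simps)
  qed
  fix n :: nat and \<delta> :: real assume n: "n \<ge> 1" and \<delta>: "\<delta> > 0"
  have "0 \<le> (\<integral>x. ln (max (H (initial_word n x)) (min \<delta> 1)) \<partial>\<nu>)" using small[OF n] \<delta> by simp
  also have "\<dots> \<le> (\<integral>x. ln (max (H (initial_word n x)) \<delta>) \<partial>\<nu>)"
    using \<delta> by (intro integral_mono N.integral_initial_word(1)[of "\<lambda>w. ln (max (H w) (min \<delta> 1))"]
      N.integral_initial_word(1)[of "\<lambda>w. ln (max (H w) \<delta>)"] ln_mono) (auto simp: less_max_iff_disj)
  finally show "0 \<le> (\<integral>x. ln (max (H (initial_word n x)) \<delta>) \<partial>\<nu>)" .
qed

end

section \<open>Conditioning on an invariant set\<close>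

context invariant_prob
begin

text \<open>Up to a null set, intersecting B with the preimage of D gives the preimage of
  \<open>B \<inter> D\<close>, so invariance of \<open>\<mu>\<close> carries over. Invariance of B
  is asked for almost everywhere because this is what the set of contracted points will
  provide.\<close>

lemma invariant_uniform_measure:
  assumes B: "B \<in> sets \<mu>" and pos: "measure \<mu> B > 0"
    and AE_inv: "AE x in \<mu>. shift x \<in> B \<longleftrightarrow> x \<in> B"
  shows "invariant_prob l (uniform_measure \<mu> B)"
proof -
  have e: "emeasure \<mu> B \<noteq> 0" "emeasure \<mu> B \<noteq> \<infinity>" using pos by (auto simp: emeasure_eq_measure)
  interpret U: prob_space "uniform_measure \<mu> B" by (rule prob_space_uniform_measure[OF e])
  show ?thesis
  proof unfold_locales
    show "sets (uniform_measure \<mu> B) = sets (shift_space l)" using sets_eq by simp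
    fix D assume "D \<in> sets (uniform_measure \<mu> B)"
    then have D: "D \<in> sets \<mu>" by simp
    have s: "shift -` D \<inter> space \<mu> \<in> sets \<mu>" if "D \<in> sets \<mu>" for D
      by (rule measurable_sets[OF _ that]) measurable
    have "measure \<mu> (B \<inter> (shift -` D \<inter> space \<mu>)) = measure \<mu> (shift -` (B \<inter> D) \<inter> space \<mu>)"
    proof (rule measure_eq_AE)
      show "AE x in \<mu>. (x \<in> B \<inter> (shift -` D \<inter> space \<mu>)) = (x \<in> shift -` (B \<inter> D) \<inter> space \<mu>)"
        using AE_inv AE_space by eventually_elim auto
      show "B \<inter> (shift -` D \<inter> space \<mu>) \<in> sets \<mu>" by (intro sets.Int B s D)
      show "shift -` (B \<inter> D) \<inter> space \<mu> \<in> sets \<mu>" by (intro s sets.Int B D)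
    qed
    also have "\<dots> = measure \<mu> (B \<inter> D)" using B D by (intro inv) auto
    finally show "measure (uniform_measure \<mu> B) (shift -` D \<inter> space (uniform_measure \<mu> B)) =
      measure (uniform_measure \<mu> B) D"
      using B D s[OF D] by (simp add: measure_uniform_measure[OF e])
  qed
qed

lemma uniform_measure_decomposition:
  assumes B: "B \<in> sets \<mu>" and pos: "measure \<mu> B > 0"
    and AE_inv: "AE x in \<mu>. shift x \<in> B \<longleftrightarrow> x \<in> B"
  obtains \<nu>' where "invariant_prob l \<nu>'"
    "\<And>w. measure \<mu> (word_cyl l w) = measure \<mu> B * measure (uniform_measure \<mu> B) (word_cyl l w) +
      (1 - measure \<mu> B) * measure \<nu>' (word_cyl l w)"
proof -
  have e: "emeasure \<mu> D \<noteq> 0" "emeasure \<mu> D \<noteq> \<infinity>" if "measure \<mu> D > 0" for D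
    using that by (auto simp: emeasure_eq_measure)
  define C where "C = space \<mu> - B"
  have C: "C \<in> sets \<mu>" "measure \<mu> C = 1 - measure \<mu> B" using sets.compl_sets[OF B] prob_compl[OF B] by (simp_all add: C_def)
  have split: "measure \<mu> W = measure \<mu> (B \<inter> W) + measure \<mu> (C \<inter> W)" if W: "W \<in> sets \<mu>" for W
  proof -
    have "W = (B \<inter> W) \<union> (C \<inter> W)" using sets.sets_into_space[OF W] by (auto simp: C_def)
    then show ?thesis using finite_measure_Union[of "B \<inter> W" "C \<inter> W"] B C W by (auto simp: C_def)
  qed
  have U: "measure \<mu> D * measure (uniform_measure \<mu> D) (word_cyl l w) = measure \<mu> (D \<inter> word_cyl l w)"
    if "measure \<mu> D > 0" for D w
    using that measure_uniform_measure[OF e[OF that], of "word_cyl l w"] by simp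
  have cyl: "word_cyl l w \<in> sets \<mu>" for w by simp
  show thesis
  proof (cases "measure \<mu> C = 0")
    case True
    have z: "measure \<mu> (C \<inter> W) = 0" for W
      using finite_measure_mono[OF Int_lower1 C(1), of W] True measure_nonneg[of \<mu> "C \<inter> W"] by linarith
    \<comment> \<open>The complement is null, so its component has coefficient 0 and
      \<open>\<mu>\<close> itself serves as a placeholder.\<close>
    have b: "1 - measure \<mu> B = 0" using True C(2) by simp
    show thesis
    proof (rule that[of \<mu>])
      show "invariant_prob l \<mu>" by (rule invariant_prob_axioms)
      show "measure \<mu> (word_cyl l w) = measure \<mu> B * measure (uniform_measure \<mu> B) (word_cyl l w) +
        (1 - measure \<mu> B) * measure \<mu> (word_cyl l w)" for w
        unfolding U[OF pos] b using split[OF cyl, of w] z[of "word_cyl l w"] by linarith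
    qed
  next
    case False
    then have posC: "measure \<mu> C > 0" using measure_nonneg[of \<mu> C] by linarith
    have AE_C: "AE x in \<mu>. shift x \<in> C \<longleftrightarrow> x \<in> C"
      using AE_inv AE_space by eventually_elim (auto simp: C_def shift_full_shift)
    show thesis
    proof (rule that[of "uniform_measure \<mu> C"])
      show "invariant_prob l (uniform_measure \<mu> C)" by (rule invariant_uniform_measure[OF C(1) posC AE_C])
      show "measure \<mu> (word_cyl l w) = measure \<mu> B * measure (uniform_measure \<mu> B) (word_cyl l w) +
        (1 - measure \<mu> B) * measure (uniform_measure \<mu> C) (word_cyl l w)" for w
        unfolding U[OF pos] C(2)[symmetric] U[OF posC] by (rule split[OF cyl])
    qed
  qed
qed

end

section \<open>Almost sure extremality\<close>

lemma rel_onorm_equiv_norm: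
  fixes f :: "'a::euclidean_space \<Rightarrow> 'a"
  assumes f: "linear f" and c: "c > 0" "\<And>v. c * norm v \<le> p v" and C: "\<And>v. p v \<le> C * norm v"
  shows "p (f v) \<le> (C * onorm f / c) * p v" and "onorm f \<le> C / c * rel_onorm p UNIV f"
proof -
  have bl: "bounded_linear f" using f by (simp add: linear_conv_bounded_linear)
  obtain b :: 'a where "b \<in> Basis" by (metis SOME_Basis)
  then have "c \<le> C" using order_trans[OF c(2)[of b] C[of b]] by (simp add: norm_Basis)
  with c have C0: "C > 0" by simp
  have nn: "0 \<le> p v" for v using c order_trans[OF _ c(2)[of v]] by simp
  show bd: "p (f v) \<le> (C * onorm f / c) * p v" for v
  proof -
    have "p (f v) \<le> C * norm (f v)" by (rule C)
    also have "\<dots> \<le> C * (onorm f * norm v)" using C0 onorm[OF bl, of v] by simp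
    also have "norm v \<le> p v / c" using c(2)[of v] c(1) by (simp add: field_simps)
    then have "C * (onorm f * norm v) \<le> C * (onorm f * (p v / c))"
      using C0 onorm_pos_le[OF bl] by (intro mult_left_mono) auto
    finally show ?thesis by (simp add: mult_ac)
  qed
  show "onorm f \<le> C / c * rel_onorm p UNIV f"
  proof (rule onorm_le)
    fix v
    have "norm (f v) \<le> p (f v) / c" using c(2)[of "f v"] c(1) by (simp add: field_simps)
    also have "p (f v) \<le> rel_onorm p UNIV f * p v" by (rule rel_onorm_bound[of p UNIV f, OF nn bd]) simp
    then have "p (f v) / c \<le> rel_onorm p UNIV f * p v / c" using c(1) by (simp add: divide_right_mono)
    also have "\<dots> \<le> rel_onorm p UNIV f * (C * norm v) / c"
      using c(1) C[of v] rel_onorm_nonneg[of p UNIV f, OF nn bd] by (intro divide_right_mono mult_left_mono) auto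
    finally show "norm (f v) \<le> C / c * rel_onorm p UNIV f * norm v" by (simp add: mult_ac)
  qed
qed

locale subexponential_words = linear_words "{1..l}" W
  for l :: nat and W :: "nat list \<Rightarrow> 'a::euclidean_space \<Rightarrow> 'a" +
  assumes subexp: "\<eta> > 0 \<Longrightarrow> \<exists>C. \<forall>w\<in>lists {1..l}. onorm (W w) \<le> C * (1 + \<eta>) ^ length w"
begin

lemma W_append_comp: "W (u @ w) = W w \<circ> W u"
  by (auto simp: W_append)

lemma onorm_W_nonneg: "0 \<le> onorm (W w)"
  using linear_W[of w] by (simp add: linear_conv_bounded_linear onorm_pos_le)

lemma submultiplicative_rel_onorm:
  assumes c: "c > 0" "\<And>v. c * norm v \<le> p v" and C: "\<And>v. p v \<le> C * norm v"
  shows "submultiplicative l (\<lambda>w. rel_onorm p UNIV (W w))"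
proof
  have nn: "0 \<le> p v" for v using c order_trans[OF _ c(2)[of v]] by simp
  note bd = rel_onorm_equiv_norm(1)[OF linear_W c C]
  show "0 \<le> rel_onorm p UNIV (W w)" for w by (rule rel_onorm_nonneg[of p UNIV "W w", OF nn bd]) simp
  show "rel_onorm p UNIV (W []) \<le> 1" by (rule rel_onorm_le[of UNIV p "W []" 1, OF _ nn]) (auto simp: W_Nil)
  show "rel_onorm p UNIV (W (u @ w)) \<le> rel_onorm p UNIV (W u) * rel_onorm p UNIV (W w)" for u w
    unfolding W_append_comp by (rule rel_onorm_compose[of p UNIV "W u" _ "W w", OF nn _ _ bd bd]) auto
qed

lemma submultiplicative_onorm: "submultiplicative l (\<lambda>w. onorm (W w))"
proof -
  have "onorm (W w) = rel_onorm norm UNIV (W w)" for w by (simp add: onorm_def rel_onorm_def)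
  then show ?thesis using submultiplicative_rel_onorm[of 1 norm 1] by simp
qed

lemma nonneg_exponent_rel_onorm:
  assumes "invariant_prob l \<mu>" "nonneg_exponent \<mu> (\<lambda>w. onorm (W w))"
    and c: "c > 0" "\<And>v. c * norm v \<le> p v" and C: "\<And>v. p v \<le> C * norm v"
  shows "nonneg_exponent \<mu> (\<lambda>w. rel_onorm p UNIV (W w))"
proof -
  obtain b :: 'a where "b \<in> Basis" by (metis SOME_Basis)
  then have "c \<le> C" using order_trans[OF c(2)[of b] C[of b]] by (simp add: norm_Basis)
  then have "C / c > 0" using c(1) by simp
  then show ?thesis
    using submultiplicative.nonneg_exponent_equiv[OF submultiplicative_rel_onorm[OF c C] assms(1,2)]
      rel_onorm_equiv_norm(2)[OF linear_W c C] by blast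
qed

text \<open>The operator norm of the map that \<open>W w\<close> induces on
  \<open>filt (Suc j)\<close> modulo \<open>filt j\<close>, that is, of a diagonal block of
  \<open>W w\<close>.\<close>

definition quot :: "nat \<Rightarrow> nat list \<Rightarrow> real" where
  "quot j w = rel_onorm (\<lambda>v. infdist v (filt j)) (filt (Suc j)) (W w)"

lemma filt_ne: "filt j \<noteq> {}"
  using subspace_0[OF subspace_filt] by blast

lemma quot_onorm_bound: "w \<in> lists {1..l} \<Longrightarrow> infdist (W w v) (filt j) \<le> onorm (W w) * infdist v (filt j)"
  by (rule infdist_W_le_onorm[OF invariant_filt])

lemma quot_nonneg: "w \<in> lists {1..l} \<Longrightarrow> 0 \<le> quot j w"
  unfolding quot_def by (rule rel_onorm_nonneg[where p = "\<lambda>v. infdist v (filt j)" and f = "W w" and U = "filt (Suc j)", OF infdist_nonneg quot_onorm_bound filt_ne])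

lemma quot_le_onorm: "w \<in> lists {1..l} \<Longrightarrow> quot j w \<le> onorm (W w)"
  unfolding quot_def
  by (rule rel_onorm_le[where p = "\<lambda>v. infdist v (filt j)" and f = "W w" and U = "filt (Suc j)", OF filt_ne infdist_nonneg quot_onorm_bound]) (auto simp: onorm_W_nonneg)

lemma quot_bound:
  "w \<in> lists {1..l} \<Longrightarrow> v \<in> filt (Suc j) \<Longrightarrow> infdist (W w v) (filt j) \<le> quot j w * infdist v (filt j)"
  unfolding quot_def by (rule rel_onorm_bound[where p = "\<lambda>v. infdist v (filt j)" and f = "W w" and U = "filt (Suc j)", OF infdist_nonneg quot_onorm_bound])

lemma quot_append:
  assumes "u \<in> lists {1..l}" "w \<in> lists {1..l}"
  shows "quot j (u @ w) \<le> quot j u * quot j w"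
  unfolding quot_def W_append_comp
proof (rule rel_onorm_compose[where p = "\<lambda>v. infdist v (filt j)", OF infdist_nonneg filt_ne])
  show "W u v \<in> filt (Suc j)" if "v \<in> filt (Suc j)" for v
    using that assms(1) invariant_filt[of "Suc j"] unfolding invariant_subspace_def by blast
  show "infdist (W u v) (filt j) \<le> onorm (W u) * infdist v (filt j)" for v
    by (rule quot_onorm_bound[OF assms(1)])
  show "infdist (W w v) (filt j) \<le> onorm (W w) * infdist v (filt j)" for v
    by (rule quot_onorm_bound[OF assms(2)])
qed

lemma quot_uniform:
  obtains C where "C \<ge> 1" "\<And>j w. j < DIM('a) \<Longrightarrow> w \<in> lists {1..l} \<Longrightarrow> quot j w \<le> C"
proof -
  obtain C where C: "0 \<le> C" "\<And>j w v. j < DIM('a) \<Longrightarrow> w \<in> lists {1..l} \<Longrightarrow> v \<in> filt (Suc j) \<Longrightarrow>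
      infdist (W w v) (filt j) \<le> C * infdist v (filt j)"
    using filt_bounded[where k = "DIM('a)"] by metis
  have "quot j w \<le> max C 1" if "j < DIM('a)" "w \<in> lists {1..l}" for j w
  proof -
    have "quot j w \<le> C" unfolding quot_def by (rule rel_onorm_le[where p = "\<lambda>v. infdist v (filt j)" and f = "W w" and U = "filt (Suc j)", OF filt_ne infdist_nonneg C(2)[OF that] C(1)])
    then show ?thesis by simp
  qed
  then show thesis using that[of "max C 1"] by auto
qed

text \<open>
  The weights of \<open>filt_norm\<close> can be chosen after the length \<open>n\<close>, so a small expected logarithm of the
  diagonal blocks at one time \<open>n\<close> already contradicts a nonnegative exponent.
\<close>

lemma nonneg_exponent_quot:
  assumes inv: "invariant_prob l \<mu>" and ne: "nonneg_exponent \<mu> (\<lambda>w. onorm (W w))"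
    and n: "n \<ge> 1" and \<delta>: "\<delta> > 0"
  shows "- ln 2 \<le> (\<integral>x. ln (max (\<Sum>j<DIM('a). quot j (initial_word n x)) \<delta>) \<partial>\<mu>)"
proof -
  interpret invariant_prob l \<mu> by fact
  define R where "R w = (\<Sum>j<DIM('a). quot j w)" for w
  define K where "K = (\<Sum>w\<in>words l n. \<bar>R w\<bar> + onorm (W w))"
  \<comment> \<open>K dominates the sum of the block norms plus the full norm for each of the
    finitely many words of length n, so this weight pushes the off-diagonal contribution below
    \<open>\<delta>\<close>; the 1 keeps t positive.\<close>
  define t where "t = max 1 (K / \<delta>)"
  have t: "t > 0" "K / t \<le> \<delta>"
  proof -
    show "t > 0" by (simp add: t_def)
    have "K \<le> \<delta> * t" using \<delta> by (auto simp: t_def max_def field_simps)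
    then show "K / t \<le> \<delta>" using \<open>t > 0\<close> by (simp add: divide_le_eq mult.commute)
  qed
  define h where "h w = rel_onorm (filt_norm t) UNIV (W w)" for w
  have ne': "nonneg_exponent \<mu> h"
    unfolding h_def
    by (rule nonneg_exponent_rel_onorm[OF assms(1,2), of 1 _ "\<Sum>j<DIM('a). t ^ j"])
      (use filt_norm_ge[OF t(1)] filt_norm_le[OF t(1)] in auto)
  have fn: "0 \<le> filt_norm t v" for v using filt_norm_ge[OF t(1), of v] norm_ge_zero order_trans by blast
  have hle: "h w \<le> R w + \<delta>" and R0: "0 \<le> R w" if w: "w \<in> words l n" for w
  proof -
    have wl: "w \<in> lists {1..l}" using w by (auto simp: words_def)
    show R0: "0 \<le> R w" unfolding R_def by (intro sum_nonneg quot_nonneg wl)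
    have q: "quot j w \<le> R w" if "j < DIM('a)" for j
      unfolding R_def using that quot_nonneg[OF wl] by (intro member_le_sum) auto
    have "\<bar>R w\<bar> + onorm (W w) \<le> K"
      unfolding K_def using w by (intro member_le_sum) (auto simp: onorm_W_nonneg)
    then have "(R w + onorm (W w)) / t \<le> K / t" using t(1) R0 by (intro divide_right_mono) auto
    then have le: "R w + (R w + onorm (W w)) / t \<le> R w + \<delta>" using t(2) by simp
    show "h w \<le> R w + \<delta>"
      unfolding h_def
    proof (rule rel_onorm_le[of UNIV "filt_norm t", OF _ fn])
      fix v
      have "filt_norm t (W w v) \<le> (R w + (R w + onorm (W w)) / t) * filt_norm t v"
      proof (rule filt_norm_W_le[OF filt_top[OF subexp] wl t(1) _ R0])
        fix j v assume "j < DIM('a)" "v \<in> filt (Suc j)"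
        then show "infdist (W w v) (filt j) \<le> R w * infdist v (filt j)"
          using quot_bound[OF wl, of v j] mult_right_mono[OF q infdist_nonneg, of j v "filt j"] by force
      qed
      also have "\<dots> \<le> (R w + \<delta>) * filt_norm t v" by (rule mult_right_mono[OF le fn])
      finally show "filt_norm t (W w v) \<le> (R w + \<delta>) * filt_norm t v" .
    qed (use R0 \<delta> in auto)
  qed
  have "0 \<le> (\<integral>x. ln (max (h (initial_word n x)) \<delta>) \<partial>\<mu>)"
    using ne' n \<delta> by (simp add: nonneg_exponent_def)
  also have "\<dots> \<le> (\<integral>x. ln 2 + ln (max (R (initial_word n x)) \<delta>) \<partial>\<mu>)"
  proof (rule integral_mono)
    fix x assume "x \<in> space \<mu>"
    then have w: "initial_word n x \<in> words l n" by (simp add: initial_word_in_words)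
    \<comment> \<open>The sum \<open>R w + \<delta>\<close> is at most twice the maximum; this is
      the origin of \<open>ln 2\<close>.\<close>
    have "max (h (initial_word n x)) \<delta> \<le> 2 * max (R (initial_word n x)) \<delta>"
      using hle[OF w] \<delta> by (auto simp: max_def)
    then have "ln (max (h (initial_word n x)) \<delta>) \<le> ln (2 * max (R (initial_word n x)) \<delta>)"
      using \<delta> by (intro ln_mono) (auto simp: less_max_iff_disj)
    also have "\<dots> = ln 2 + ln (max (R (initial_word n x)) \<delta>)"
      using \<delta> by (intro ln_mult_pos) (auto simp: less_max_iff_disj)
    finally show "ln (max (h (initial_word n x)) \<delta>) \<le> ln 2 + ln (max (R (initial_word n x)) \<delta>)" .
  qed (use integral_initial_word(1)[of "\<lambda>w. ln (max (h w) \<delta>)"]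
        integral_initial_word(1)[of "\<lambda>w. ln (max (R w) \<delta>)"] in auto)
  also have "\<dots> = ln 2 + (\<integral>x. ln (max (R (initial_word n x)) \<delta>) \<partial>\<mu>)"
    using integral_initial_word(1)[of "\<lambda>w. ln (max (R w) \<delta>)"] prob_space by simp
  finally show ?thesis by (simp add: R_def)
qed

text \<open>Since the block norms are bounded over all words, a block that is once small stays small
  up to a constant. So at each point either all blocks tend to 0 or some block is bounded away from
  0; the points of the first kind form the set E below.\<close>

theorem AE_bounded_below:
  assumes inv: "invariant_prob l \<mu>" and ne: "nonneg_exponent \<mu> (\<lambda>w. onorm (W w))"
  shows "AE x in \<mu>. \<exists>\<epsilon>>0. \<forall>n. \<epsilon> \<le> onorm (W (initial_word n x))"
proof -
  interpret invariant_prob l \<mu> by fact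
  let ?d = "DIM('a)"
  have wl: "initial_word n x \<in> lists {1..l}" if "x \<in> full_shift l" for n x
    using initial_word_in_words[OF that, of n] by (auto simp: words_def)
  obtain C where C: "C \<ge> 1" "\<And>j w. j < ?d \<Longrightarrow> w \<in> lists {1..l} \<Longrightarrow> quot j w \<le> C"
    using quot_uniform by blast
  define E where "E = {x \<in> space \<mu>. \<forall>j\<in>{..<?d}. \<forall>m::nat. \<exists>n. quot j (initial_word n x) < inverse (real (Suc m))}"
  have meas: "(\<lambda>x. quot j (initial_word n x)) \<in> borel_measurable \<mu>" for j n
    using integral_initial_word(1)[of "quot j" n] by simp
  have E: "E \<in> sets \<mu>" unfolding E_def using meas by measurable
  \<comment> \<open>Prepending one letter costs at most the factor C, which is absorbed by a smaller
    threshold at the shifted point. This inclusion is enough: E and its preimage have the same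
    measure, so they agree almost everywhere.\<close>
  have sub: "x \<in> E" if xs: "x \<in> space \<mu>" "shift x \<in> E" for x
    unfolding E_def
  proof (intro CollectI conjI ballI allI)
    fix j m assume j: "j \<in> {..<?d}"
    obtain M :: nat where M: "C * real (Suc m) < real (Suc M)" using reals_Archimedean2 by (metis less_trans of_nat_less_iff lessI)
    have M': "C * inverse (real (Suc M)) < inverse (real (Suc m))"
      using M by (simp add: field_simps)
    obtain n where n: "quot j (initial_word n (shift x)) < inverse (real (Suc M))"
      using xs j unfolding E_def by blast
    have x: "x \<in> full_shift l" "shift x \<in> full_shift l" using xs by (auto simp: shift_full_shift)
    have "quot j ([x 0] @ initial_word n (shift x)) \<le> quot j [x 0] * quot j (initial_word n (shift x))"
      using wl[OF x(2)] x(1) by (intro quot_append) (auto simp: full_shift_def)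
    also have "\<dots> \<le> C * quot j (initial_word n (shift x))"
      using j x(1) quot_nonneg[OF wl[OF x(2)]] by (intro mult_right_mono C(2)) (auto simp: full_shift_def)
    also have "\<dots> \<le> C * inverse (real (Suc M))" using n C(1) by (intro mult_left_mono) auto
    also note M'
    finally show "\<exists>n. quot j (initial_word n x) < inverse (real (Suc m))"
      by (intro exI[of _ "Suc n"]) (simp add: initial_word_Suc_shift)
  qed fact
  have "measure \<mu> E = 0"
  proof (rule ccontr)
    assume "measure \<mu> E \<noteq> 0"
    then have pos: "measure \<mu> E > 0" using measure_nonneg[of \<mu> E] by linarith
    have sE: "shift -` E \<inter> space \<mu> \<in> sets \<mu>" by (rule measurable_sets[OF _ E]) measurable
    have "measure \<mu> (E - (shift -` E \<inter> space \<mu>)) = 0"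
      using finite_measure_Diff[OF E sE] sub inv[OF E] by auto
    then have "AE x in \<mu>. x \<notin> E - (shift -` E \<inter> space \<mu>)"
      using E sE by (intro AE_not_in) (auto simp: null_sets_def emeasure_eq_measure)
    then have AEE: "AE x in \<mu>. shift x \<in> E \<longleftrightarrow> x \<in> E"
      using AE_space by eventually_elim (use sub in auto)
    define \<nu> where "\<nu> = uniform_measure \<mu> E"
    have inv\<nu>: "invariant_prob l \<nu>" unfolding \<nu>_def by (rule invariant_uniform_measure[OF E pos AEE])
    obtain \<nu>' where \<nu>': "invariant_prob l \<nu>'"
      "\<And>w. measure \<mu> (word_cyl l w) = measure \<mu> E * measure \<nu> (word_cyl l w) + (1 - measure \<mu> E) * measure \<nu>' (word_cyl l w)"
      using uniform_measure_decomposition[OF E pos AEE] unfolding \<nu>_def by metis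
    have ne\<nu>: "nonneg_exponent \<nu> (\<lambda>w. onorm (W w))"
      by (rule submultiplicative.nonneg_exponent_face[OF submultiplicative_onorm assms(1) inv\<nu> \<nu>' pos _ subexp ne])
        (simp_all add: prob_le_1)
    interpret N: invariant_prob l \<nu> by (rule inv\<nu>)
    let ?R = "\<lambda>n x. \<Sum>j<?d. quot j (initial_word n x)"
    \<comment> \<open>On E the truncated integrands tend to \<open>ln \<delta> = -2\<close>. This
      lies below -1, hence below the bound \<open>- ln 2\<close> of
      \<open>nonneg_exponent_quot\<close>.\<close>
    define \<delta> where "\<delta> = exp (-2::real)"
    have \<delta>: "\<delta> > 0" by (simp add: \<delta>_def)
    have R_le: "?R n x \<le> real ?d * C" if "x \<in> full_shift l" for n x
      using sum_bounded_above[of "{..<?d}" "\<lambda>j. quot j (initial_word n x)" C] C(2) wl[OF that] by simp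
    have lim: "(\<lambda>n. ?R n x) \<longlonglongrightarrow> 0" if "x \<in> E" for x
    proof -
      have x: "x \<in> full_shift l" using that by (simp add: E_def)
      have "(\<lambda>n. quot j (initial_word n x)) \<longlonglongrightarrow> 0" if j: "j < ?d" for j
      proof (rule LIMSEQ_I)
        fix r :: real assume r: "r > 0"
        obtain m :: nat where m: "inverse (real (Suc m)) < r / C"
          using reals_Archimedean[of "r / C"] r C(1) by auto
        obtain k where k: "quot j (initial_word k x) < inverse (real (Suc m))"
          using \<open>x \<in> E\<close> j unfolding E_def by blast
        \<comment> \<open>After time k the remaining word multiplies the block norm by at most C, so
          a value below r / C at time k stays below r.\<close>
        have "norm (quot j (initial_word n x) - 0) < r" if "n \<ge> k" for n
        proof -
          have e: "initial_word n x = initial_word k x @ initial_word (n - k) ((shift ^^ k) x)"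
            using initial_word_add[of k "n - k" x] that by simp
          have "quot j (initial_word n x) \<le> quot j (initial_word k x) * quot j (initial_word (n - k) ((shift ^^ k) x))"
            unfolding e by (intro quot_append wl shift_funpow_full_shift x)
          also have "\<dots> \<le> quot j (initial_word k x) * C"
            by (intro mult_left_mono C(2) j wl shift_funpow_full_shift x quot_nonneg)
          also have "\<dots> < r / C * C" using k m C(1) by (intro mult_strict_right_mono) auto
          finally show ?thesis using C(1) quot_nonneg[OF wl[OF x, of n], of j] by simp
        qed
        then show "\<exists>no. \<forall>n\<ge>no. norm (quot j (initial_word n x) - 0) < r" by blast
      qed
      then show ?thesis using tendsto_sum[of "{..<?d}" "\<lambda>j n. quot j (initial_word n x)" "\<lambda>_. 0"] by simp
    qed
    have "(\<lambda>n. \<integral>x. ln (max (?R n x) \<delta>) \<partial>\<nu>) \<longlonglongrightarrow> (\<integral>x. ln \<delta> \<partial>\<nu>)"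
    proof (rule integral_dominated_convergence[where w = "\<lambda>_. \<bar>ln \<delta>\<bar> + \<bar>ln (max (real ?d * C) \<delta>)\<bar>"])
      show "(\<lambda>x. ln (max (?R n x) \<delta>)) \<in> borel_measurable \<nu>" for n
        using N.integral_initial_word(1)[of "\<lambda>w. ln (max (\<Sum>j<?d. quot j w) \<delta>)" n] by simp
      have "AE x in \<nu>. x \<in> E" unfolding \<nu>_def by (rule AE_uniform_measureI[OF E]) simp
      then show "AE x in \<nu>. (\<lambda>n. ln (max (?R n x) \<delta>)) \<longlonglongrightarrow> ln \<delta>"
      proof eventually_elim
        fix x assume "x \<in> E"
        then have "(\<lambda>n. ln (max (?R n x) \<delta>)) \<longlonglongrightarrow> ln (max 0 \<delta>)"
          using \<delta> by (intro tendsto_ln tendsto_max lim tendsto_const) auto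
        then show "(\<lambda>n. ln (max (?R n x) \<delta>)) \<longlonglongrightarrow> ln \<delta>" using \<delta> by simp
      qed
      show "AE x in \<nu>. norm (ln (max (?R n x) \<delta>)) \<le> \<bar>ln \<delta>\<bar> + \<bar>ln (max (real ?d * C) \<delta>)\<bar>" for n
      proof (rule AE_I2)
        fix x assume "x \<in> space \<nu>"
        then have "ln \<delta> \<le> ln (max (?R n x) \<delta>)" "ln (max (?R n x) \<delta>) \<le> ln (max (real ?d * C) \<delta>)"
          using \<delta> R_le[of x n] by (auto intro!: ln_mono simp: less_max_iff_disj)
        then show "norm (ln (max (?R n x) \<delta>)) \<le> \<bar>ln \<delta>\<bar> + \<bar>ln (max (real ?d * C) \<delta>)\<bar>" by simp
      qed
    qed auto
    then have "(\<lambda>n. \<integral>x. ln (max (?R n x) \<delta>) \<partial>\<nu>) \<longlonglongrightarrow> -2"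
      using N.prob_space by (simp add: \<delta>_def)
    then have "eventually (\<lambda>n. (\<integral>x. ln (max (?R n x) \<delta>) \<partial>\<nu>) < -1 \<and> n \<ge> 1) sequentially"
      by (intro eventually_conj order_tendstoD(2) eventually_ge_at_top) auto
    then obtain n where "(\<integral>x. ln (max (?R n x) \<delta>) \<partial>\<nu>) < -1" "n \<ge> 1"
      using eventually_happens by force
    with nonneg_exponent_quot[OF inv\<nu> ne\<nu> this(2) \<delta>] have "ln (2::real) > 1" by simp
    then show False using ln_2_less_1 by simp
  qed
  then have "AE x in \<mu>. x \<notin> E"
    using E by (intro AE_not_in) (auto simp: null_sets_def emeasure_eq_measure)
  then show ?thesis
    using AE_space
  proof eventually_elim
    fix x assume x: "x \<notin> E" "x \<in> space \<mu>"
    \<comment> \<open>Outside E some block is bounded below, and the full norm dominates each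
      block.\<close>
    then obtain j m where "\<And>n. inverse (real (Suc m)) \<le> quot j (initial_word n x)"
      unfolding E_def by (auto simp: not_less)
    moreover have "quot j (initial_word n x) \<le> onorm (W (initial_word n x))" for n
      using x(2) by (intro quot_le_onorm wl) simp
    ultimately have "inverse (real (Suc m)) \<le> onorm (W (initial_word n x))" for n
      by (rule order_trans)
    then show "\<exists>\<epsilon>>0. \<forall>n. \<epsilon> \<le> onorm (W (initial_word n x))"
      by (intro exI[of _ "inverse (real (Suc m))"]) auto
  qed
qed

text \<open>Because no word expands N, a vector that nearly keeps its norm up to a late time nearly
  keeps it at all earlier times. Near-maximisers for growing times therefore accumulate at a vector
  that keeps its norm for ever.\<close>

theorem AE_extremal_vector:
  assumes inv: "invariant_prob l \<mu>" and ne: "nonneg_exponent \<mu> (\<lambda>w. onorm (W w))"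
    and c: "c > 0" "\<And>v. c * norm v \<le> N v" and C: "\<And>v. N v \<le> C * norm v"
    and cont: "continuous_on UNIV N" and scale: "\<And>a v. N (a *\<^sub>R v) = \<bar>a\<bar> * N v"
    and contr: "\<And>w v. w \<in> lists {1..l} \<Longrightarrow> N (W w v) \<le> N v"
  shows "AE x in \<mu>. \<exists>v. N v = 1 \<and> (\<forall>n. N (W (initial_word n x) v) = 1)"
proof -
  interpret invariant_prob l \<mu> by fact
  let ?h = "\<lambda>w. rel_onorm N UNIV (W w)"
  have nn: "0 \<le> N v" for v using c order_trans[OF _ c(2)[of v]] by simp
  have wl: "initial_word n x \<in> lists {1..l}" if "x \<in> full_shift l" for n x
    using initial_word_in_words[OF that, of n] by (auto simp: words_def)
  have h1: "?h w \<le> 1" if "w \<in> lists {1..l}" for w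
    by (rule rel_onorm_le[of UNIV N, OF _ nn]) (use contr[OF that] in auto)
  have ne': "nonneg_exponent \<mu> ?h" by (rule nonneg_exponent_rel_onorm[OF assms(1,2) c C])
  have "AE x in \<mu>. 1 \<le> ?h (initial_word (Suc n) x)" for n
  proof -
    \<comment> \<open>Any truncation level strictly between 0 and 1 serves: as the relative norm is
      at most 1, a vanishing truncated logarithm forces it to be 1.\<close>
    let ?f = "\<lambda>x. - ln (max (?h (initial_word (Suc n) x)) (1/2))"
    have int: "integrable \<mu> ?f" by (rule integral_initial_word(1))
    have f0: "0 \<le> ?f x" if "x \<in> space \<mu>" for x
    proof -
      have "max (?h (initial_word (Suc n) x)) (1/2) \<le> 1" using h1[OF wl, of x "Suc n"] that by simp
      then show ?thesis by (simp add: less_max_iff_disj ln_le_zero_iff)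
    qed
    have "(\<integral>x. ?f x \<partial>\<mu>) \<le> 0"
      using ne' unfolding nonneg_exponent_def by simp
    moreover have "0 \<le> (\<integral>x. ?f x \<partial>\<mu>)" by (rule Bochner_Integration.integral_nonneg) (rule f0)
    ultimately have "(\<integral>x. ?f x \<partial>\<mu>) = 0" by linarith
    then have "AE x in \<mu>. ?f x = 0"
      using integral_nonneg_eq_0_iff_AE[OF int AE_I2[OF f0]] by blast
    then show ?thesis
      by eventually_elim (auto simp: max_def split: if_splits)
  qed
  then have "AE x in \<mu>. \<forall>n. 1 \<le> ?h (initial_word (Suc n) x)" by (simp add: AE_all_countable)
  then show ?thesis
    using AE_space
  proof eventually_elim
    fix x assume h: "\<forall>n. 1 \<le> ?h (initial_word (Suc n) x)" and "x \<in> space \<mu>"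
    then have x: "x \<in> full_shift l" by simp
    define S where "S = {v. N v = 1}"
    have "closed S" unfolding S_def by (intro closed_Collect_eq cont continuous_on_const)
    moreover have "bounded S"
    proof (rule boundedI)
      fix v assume "v \<in> S"
      then show "norm v \<le> 1 / c" using c(2)[of v] c(1) by (simp add: S_def field_simps)
    qed
    ultimately have "compact S" by (simp add: compact_eq_bounded_closed)
    have "\<exists>v\<in>S. 1 - inverse (real (Suc n)) < N (W (initial_word (Suc n) x) v)" for n
    proof -
      have "1 - inverse (real (Suc n)) < 1" by simp
      also have "1 \<le> ?h (initial_word (Suc n) x)" using h by blast
      finally have "1 - inverse (real (Suc n)) < ?h (initial_word (Suc n) x)" .
      then obtain v where v: "1 - inverse (real (Suc n)) < N (W (initial_word (Suc n) x) v) / N v"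
        unfolding rel_onorm_def by (rule less_cSupE) auto
      \<comment> \<open>This excludes \<open>N v = 0\<close>, where the quotient is 0 by
        convention.\<close>
      have "0 \<le> 1 - inverse (real (Suc n))" by (simp add: field_simps)
      then have "N v \<noteq> 0" using v by (intro notI) simp
      then have pos: "N v > 0" using nn[of v] by simp
      have "N ((1 / N v) *\<^sub>R v) = 1" using pos by (simp add: scale)
      moreover have "N (W (initial_word (Suc n) x) ((1 / N v) *\<^sub>R v)) = N (W (initial_word (Suc n) x) v) / N v"
        using pos by (simp add: linear_scale[OF linear_W] scale)
      ultimately show ?thesis using v by (intro bexI[of _ "(1 / N v) *\<^sub>R v"]) (auto simp: S_def)
    qed
    then obtain vs where vs: "\<And>n. vs n \<in> S"
      "\<And>n. 1 - inverse (real (Suc n)) < N (W (initial_word (Suc n) x) (vs n))"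
      by metis
    obtain v r where v: "v \<in> S" "strict_mono r" "(vs \<circ> r) \<longlonglongrightarrow> v"
      using \<open>compact S\<close> vs(1) unfolding compact_eq_seq_compact_metric seq_compact_def by metis
    have "N (W (initial_word m x) v) = 1" for m
    proof (rule antisym)
      show "N (W (initial_word m x) v) \<le> 1" using contr[OF wl[OF x], of m v] v(1) by (simp add: S_def)
      have le: "1 - inverse (real (Suc n)) \<le> N (W (initial_word m x) (vs n))" if "n \<ge> m" for n
      proof -
        have e: "initial_word (Suc n) x = initial_word m x @ initial_word (Suc n - m) ((shift ^^ m) x)"
          using initial_word_add[of m "Suc n - m" x] that by simp
        have "N (W (initial_word (Suc n) x) (vs n)) \<le> N (W (initial_word m x) (vs n))"
          unfolding e W_append by (intro contr wl shift_funpow_full_shift x)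
        with vs(2)[of n] show ?thesis by simp
      qed
      have "(\<lambda>n. N (W (initial_word m x) ((vs \<circ> r) n))) \<longlonglongrightarrow> N (W (initial_word m x) v)"
      proof (rule continuous_on_tendsto_compose[OF cont])
        show "(\<lambda>n. W (initial_word m x) ((vs \<circ> r) n)) \<longlonglongrightarrow> W (initial_word m x) v"
          by (rule bounded_linear.tendsto[OF _ v(3)]) (simp only: linear_conv_bounded_linear[symmetric] linear_W)
      qed auto
      moreover have "(\<lambda>n. 1 - inverse (real (Suc (r n)))) \<longlonglongrightarrow> 1 - 0"
        using LIMSEQ_subseq_LIMSEQ[OF LIMSEQ_inverse_real_of_nat v(2)]
        by (intro tendsto_diff tendsto_const) (simp add: comp_def)
      moreover have "eventually (\<lambda>n. 1 - inverse (real (Suc (r n))) \<le> N (W (initial_word m x) ((vs \<circ> r) n))) sequentially"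
        using eventually_ge_at_top[of m]
      proof eventually_elim
        case (elim n)
        then have "m \<le> r n" using seq_suble[OF v(2), of n] by simp
        then show ?case using le by simp
      qed
      ultimately have "1 - 0 \<le> N (W (initial_word m x) v)"
        by (rule tendsto_le[OF trivial_limit_sequentially])
      then show "1 \<le> N (W (initial_word m x) v)" by simp
    qed
    then show "\<exists>v. N v = 1 \<and> (\<forall>n. N (W (initial_word n x) v) = 1)" using v(1) by (auto simp: S_def)
  qed
qed

end

section \<open>Ergodic and empirical measures\<close>

text \<open>Turns a probability measure into a point of a product of unit intervals indexed by
  words, where convergence at every word plays the part of weak convergence.\<close>

definition cyl_weight :: "nat \<Rightarrow> (nat \<Rightarrow> nat) measure \<Rightarrow> nat list \<Rightarrow> real" where
  "cyl_weight l \<mu> w = measure \<mu> (word_cyl l w)"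

lemma cyl_weight_outside: "w \<notin> lists {1..l} \<Longrightarrow> cyl_weight l \<mu> w = 0"
  by (simp add: cyl_weight_def word_cyl_empty)

lemma (in invariant_prob) word_weights_cyl_weight: "word_weights l (cyl_weight l \<mu>)"
proof
  show "0 \<le> cyl_weight l \<mu> w" for w by (simp add: cyl_weight_def)
  show "cyl_weight l \<mu> [] = 1" using prob_space by (simp add: cyl_weight_def)
  fix w assume w: "w \<in> lists {1..l}"
  show "cyl_weight l \<mu> w = (\<Sum>a\<in>{1..l}. cyl_weight l \<mu> (w @ [a]))"
    unfolding cyl_weight_def by (rule word_cyl_snoc[OF w])
  show "cyl_weight l \<mu> w = (\<Sum>a\<in>{1..l}. cyl_weight l \<mu> (a # w))"
    unfolding cyl_weight_def by (rule word_cyl_Cons[OF w])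
qed

lemma (in word_weights) weight_le_1:
  assumes "w \<in> lists {1..l}"
  shows "p w \<le> 1"
  using assms
proof (induction w rule: rev_induct)
  case Nil
  show ?case using word_weights.Nil[OF word_weights_axioms] by simp
next
  case (snoc a w)
  then have w: "w \<in> lists {1..l}" "a \<in> {1..l}" by auto
  have "p (w @ [a]) \<le> (\<Sum>a\<in>{1..l}. p (w @ [a]))"
    using w(2) by (intro member_le_sum) (auto simp: nonneg)
  then show ?case using snoc.IH w word_weights.snoc[OF word_weights_axioms w(1)] by auto
qed

text \<open>The weights of the invariant measures with nonnegative exponent. Vanishing on
  inadmissible words pins down coordinates that \<open>word_weights\<close> leaves free, so that
  points correspond to measures and all coordinates lie in the unit interval.\<close>

definition exponent_weights :: "nat \<Rightarrow> (nat list \<Rightarrow> real) \<Rightarrow> (nat list \<Rightarrow> real) set" where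
  "exponent_weights l H = {p. word_weights l p \<and> (\<forall>w. w \<notin> lists {1..l} \<longrightarrow> p w = 0) \<and>
     (\<forall>n\<ge>1. \<forall>\<delta>>0. 0 \<le> (\<Sum>w\<in>words l n. p w * ln (max (H w) \<delta>)))}"

lemma cyl_weight_in_exponent_weights:
  assumes "invariant_prob l \<mu>"
  shows "cyl_weight l \<mu> \<in> exponent_weights l H \<longleftrightarrow> nonneg_exponent \<mu> H"
proof -
  interpret invariant_prob l \<mu> by fact
  show ?thesis
    using word_weights_cyl_weight cyl_weight_outside[of _ l \<mu>]
    unfolding exponent_weights_def nonneg_exponent_def integral_initial_word(2)[of "\<lambda>w. ln (max (H w) _)"]
    by (simp add: cyl_weight_def)
qed

lemma exponent_weights_imp_measure:
  assumes "p \<in> exponent_weights l H"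
  obtains \<mu> where "invariant_prob l \<mu>" "cyl_weight l \<mu> = p" "nonneg_exponent \<mu> H"
proof -
  interpret word_weights l p using assms by (simp add: exponent_weights_def)
  have "cyl_weight l weight_measure = p"
  proof
    fix w
    show "cyl_weight l weight_measure w = p w"
      using assms measure_weight_measure[of w] cyl_weight_outside[of w l weight_measure]
      by (cases "w \<in> lists {1..l}") (auto simp: exponent_weights_def cyl_weight_def simp del: in_lists_conv_set One_nat_def)
  qed
  with that[of weight_measure] assms invariant_weight_measure cyl_weight_in_exponent_weights[OF invariant_weight_measure, of H]
  show thesis by metis
qed

section \<open>Compactness of the set of weights\<close>

lemma continuous_on_coordinate: "continuous_on S (\<lambda>p. p w :: real)"
  by (rule continuous_on_subset[OF continuous_on_product_coordinates]) simp

lemma compact_unit_cube: "compact {p :: 'i \<Rightarrow> real. \<forall>w. p w \<in> {0..1}}"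
proof -
  have "compactin (product_topology (\<lambda>_::'i. euclidean :: real topology) UNIV) (Pi\<^sub>E UNIV (\<lambda>_. {0..1}))"
    by (simp add: compactin_PiE)
  then have "compact (Pi\<^sub>E (UNIV :: 'i set) (\<lambda>_. {0..1::real}))"
    by (simp add: euclidean_product_topology)
  moreover have "Pi\<^sub>E (UNIV :: 'i set) (\<lambda>_. {0..1::real}) = {p. \<forall>w. p w \<in> {0..1}}" by (auto simp: PiE_iff)
  ultimately show ?thesis by simp
qed

lemma closed_Collect_imp_const: "closed {p. P p} \<Longrightarrow> closed {p. Q \<longrightarrow> P p}"
  by (cases Q) auto

text \<open>Each single condition involves finitely many coordinates, so it is closed in the product
  topology, and the set is a closed part of a product of unit intervals.\<close>

lemma compact_exponent_weights: "compact (exponent_weights l H)"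
proof -
  have "exponent_weights l H = {p. (\<forall>w. 0 \<le> p w) \<and> p [] = 1 \<and>
      (\<forall>w. w \<in> lists {1..l} \<longrightarrow> p w = (\<Sum>a\<in>{1..l}. p (w @ [a]))) \<and>
      (\<forall>w. w \<in> lists {1..l} \<longrightarrow> p w = (\<Sum>a\<in>{1..l}. p (a # w))) \<and>
      (\<forall>w. w \<notin> lists {1..l} \<longrightarrow> p w = 0) \<and>
      (\<forall>n. n \<ge> 1 \<longrightarrow> (\<forall>\<delta>. \<delta> > 0 \<longrightarrow> 0 \<le> (\<Sum>w\<in>words l n. p w * ln (max (H w) \<delta>))))}"
    unfolding exponent_weights_def word_weights_def by blast
  also have "closed \<dots>"
    by (intro closed_Collect_conj closed_Collect_all closed_Collect_imp_const closed_Collect_le closed_Collect_eq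
        continuous_intros continuous_on_coordinate)
  finally have "closed (exponent_weights l H)" .
  moreover have "exponent_weights l H \<subseteq> {p. \<forall>w. p w \<in> {0..1}}"
  proof (intro subsetI CollectI allI)
    fix p w assume p: "p \<in> exponent_weights l H"
    then interpret word_weights l p by (simp add: exponent_weights_def)
    show "p w \<in> {0..1}"
      using weight_le_1[of w] nonneg[of w] p
      by (cases "w \<in> lists {1..l}") (auto simp: exponent_weights_def simp del: in_lists_conv_set One_nat_def)
  qed
  ultimately show ?thesis
    using compact_Int_closed[OF compact_unit_cube] by (metis inf.absorb_iff2)
qed

lemma seq_compact_unit_cube:
  fixes q :: "nat \<Rightarrow> 'i::countable \<Rightarrow> real"
  assumes "\<And>n w. q n w \<in> {0..1}"
  obtains r p where "strict_mono r" "\<And>w. (\<lambda>n. q (r n) w) \<longlonglongrightarrow> p w"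
proof -
  have "seq_compact {p :: 'i \<Rightarrow> real. \<forall>w. p w \<in> {0..1}}"
    using compact_unit_cube[where 'i = 'i] unfolding compact_eq_seq_compact_metric .
  moreover have "\<forall>n. q n \<in> {p. \<forall>w. p w \<in> {0..1}}" using assms by blast
  ultimately obtain p r where r: "strict_mono (r :: nat \<Rightarrow> nat)" "(q \<circ> r) \<longlonglongrightarrow> p"
    unfolding seq_compact_def by metis
  have "(\<lambda>n. q (r n) w) \<longlonglongrightarrow> p w" for w
    using continuous_on_tendsto_compose[OF continuous_on_product_coordinates[of w] r(2)] by simp
  then show thesis using that r(1) by blast
qed

section \<open>Extreme points by lexicographic maximisation\<close>

definition argmax_on :: "'a set \<Rightarrow> ('a \<Rightarrow> real) \<Rightarrow> 'a set" where
  "argmax_on K f = {p \<in> K. \<forall>q\<in>K. f q \<le> f p}"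

lemma argmax_on_compact:
  assumes "compact K" "K \<noteq> {}" "continuous_on UNIV f"
  shows "compact (argmax_on K f)" "argmax_on K f \<noteq> {}"
proof -
  have cf: "continuous_on K f" using assms(3) continuous_on_subset by blast
  obtain m where m: "m \<in> K" "\<And>q. q \<in> K \<Longrightarrow> f q \<le> f m"
    using continuous_attains_sup[OF assms(1,2) cf] by metis
  then show "argmax_on K f \<noteq> {}" by (auto simp: argmax_on_def)
  have "argmax_on K f = K \<inter> {p. f p = f m}" using m by (auto simp: argmax_on_def intro: antisym)
  moreover have "closed {p. f p = f m}" by (intro closed_Collect_eq assms(3) continuous_on_const)
  ultimately show "compact (argmax_on K f)" using assms(1) by (simp add: compact_Int_closed)
qed

text \<open>
  Maximising the given functional and then all coordinates one after the other leaves a single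
  point, which is therefore extreme.
\<close>

primrec lex_max :: "(nat list \<Rightarrow> real) set \<Rightarrow> ((nat list \<Rightarrow> real) \<Rightarrow> real) \<Rightarrow> nat \<Rightarrow> (nat list \<Rightarrow> real) set" where
  "lex_max K f 0 = argmax_on K f"
| "lex_max K f (Suc n) = argmax_on (lex_max K f n) (\<lambda>p. p (from_nat n))"

lemma lex_max_compact:
  assumes "compact K" "K \<noteq> {}" "continuous_on UNIV f"
  shows "compact (lex_max K f n) \<and> lex_max K f n \<noteq> {}"
proof (induction n)
  case 0
  show ?case using argmax_on_compact[OF assms] by simp
next
  case (Suc n)
  then show ?case
    using argmax_on_compact[of "lex_max K f n" "\<lambda>p. p (from_nat n)"] continuous_on_coordinate by simp
qed

lemma lex_max_antimono: "m \<le> n \<Longrightarrow> lex_max K f n \<subseteq> lex_max K f m"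
  by (rule lift_Suc_antimono_le[of "lex_max K f"]) (auto simp: argmax_on_def)

lemma lex_max_nonempty:
  assumes "compact K" "K \<noteq> {}" "continuous_on UNIV f"
  obtains p where "\<And>n. p \<in> lex_max K f n"
proof -
  have "lex_max K f 0 \<inter> (\<Inter>n\<in>UNIV. lex_max K f n) \<noteq> {}"
  proof (rule compact_imp_fip_image)
    show "compact (lex_max K f 0)" "closed (lex_max K f n)" for n
      using lex_max_compact[OF assms] compact_imp_closed by blast+
    fix J :: "nat set" assume J: "finite J"
    define m where "m = Max (insert 0 J)"
    have "n \<le> m" if "n \<in> J" for n using J that by (simp add: m_def)
    then have "lex_max K f m \<subseteq> lex_max K f 0 \<inter> (\<Inter>n\<in>J. lex_max K f n)"
      using lex_max_antimono[of _ m K f] by blast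
    then show "lex_max K f 0 \<inter> (\<Inter>n\<in>J. lex_max K f n) \<noteq> {}" using lex_max_compact[OF assms, of m] by blast
  qed
  then show thesis using that by blast
qed

text \<open>Every word is \<open>from_nat\<close> of its own code, so each coordinate is maximised
  at some step and thereby determined.\<close>

lemma lex_max_unique:
  assumes "\<And>n. p \<in> lex_max K f n" "\<And>n. q \<in> lex_max K f n"
  shows "p = q"
proof
  fix w :: "nat list"
  have "p \<in> lex_max K f (Suc (to_nat w))" "q \<in> lex_max K f (Suc (to_nat w))" using assms by blast+
  then show "p w = q w" by (auto simp: argmax_on_def intro: antisym)
qed

lemma argmax_on_face:
  fixes t :: real
  assumes "p \<in> argmax_on K f" "p1 \<in> K" "p2 \<in> K" "f p = t * f p1 + (1 - t) * f p2" "0 < t" "t < 1"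
  shows "p1 \<in> argmax_on K f" "p2 \<in> argmax_on K f"
proof -
  have le: "f p1 \<le> f p" "f p2 \<le> f p" using assms(1-3) by (auto simp: argmax_on_def)
  have "t * (f p - f p1) + (1 - t) * (f p - f p2) = 0" using assms(4) by (simp add: algebra_simps)
  moreover have "0 \<le> t * (f p - f p1)" "0 \<le> (1 - t) * (f p - f p2)" using le assms(5,6) by simp_all
  ultimately have "t * (f p - f p1) = 0" "(1 - t) * (f p - f p2) = 0" by linarith+
  then have "f p1 = f p" "f p2 = f p" using assms(5,6) by auto
  then show "p1 \<in> argmax_on K f" "p2 \<in> argmax_on K f" using assms(1-3) by (auto simp: argmax_on_def)
qed

lemma lex_max_face:
  fixes t :: real
  assumes p: "p \<in> lex_max K (\<lambda>p. s * p u) n" and K: "p1 \<in> K" "p2 \<in> K"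
    and dec: "\<And>w. p w = t * p1 w + (1 - t) * p2 w" and t: "0 < t" "t < 1"
  shows "p1 \<in> lex_max K (\<lambda>p. s * p u) n \<and> p2 \<in> lex_max K (\<lambda>p. s * p u) n"
  using p
proof (induction n)
  case 0
  then show ?case
    using argmax_on_face[of p K "\<lambda>p. s * p u" p1 p2 t] K t dec[of u] by (simp add: algebra_simps)
next
  case (Suc n)
  then have "p \<in> lex_max K (\<lambda>p. s * p u) n" by (simp add: argmax_on_def)
  with Suc.IH have IH: "p1 \<in> lex_max K (\<lambda>p. s * p u) n" "p2 \<in> lex_max K (\<lambda>p. s * p u) n" by auto
  with Suc.prems show ?case
    using argmax_on_face[of p _ "\<lambda>p. p (from_nat n)" p1 p2 t] dec[of "from_nat n"] t by simp
qed

context submultiplicative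
begin

text \<open>An invariant set of measure strictly between 0 and 1 splits \<open>\<mu>\<close> into
  its two conditional measures. Both keep a nonnegative exponent and, the sets of maximisers being
  faces, both pass every step of the maximisation. So the one on B equals \<open>\<mu>\<close>,
  although it gives B full measure.\<close>

lemma lex_max_ergodic:
  assumes subexp: "\<And>\<eta>. \<eta> > 0 \<Longrightarrow> \<exists>C. \<forall>w\<in>lists {1..l}. H w \<le> C * (1 + \<eta>) ^ length w"
    and inv\<mu>: "invariant_prob l \<mu>" and ne: "nonneg_exponent \<mu> H"
    and lm: "\<And>n. cyl_weight l \<mu> \<in> lex_max (exponent_weights l H) (\<lambda>p. s * p u) n"
  shows "ergodic \<mu>"
  unfolding ergodic_def
proof (intro ballI impI)
  interpret invariant_prob l \<mu> by fact
  fix B assume B: "B \<in> sets \<mu>" "shift -` B \<inter> space \<mu> = B"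
  show "measure \<mu> B = 0 \<or> measure \<mu> B = 1"
  proof (rule ccontr)
    assume "\<not> ?thesis"
    then have b: "0 < measure \<mu> B" "measure \<mu> B < 1"
      using measure_nonneg[of \<mu> B] prob_le_1[of B] by linarith+
    have AEB: "AE x in \<mu>. shift x \<in> B \<longleftrightarrow> x \<in> B" using B(2) by (intro AE_I2) blast
    define \<nu> where "\<nu> = uniform_measure \<mu> B"
    have inv\<nu>: "invariant_prob l \<nu>" unfolding \<nu>_def by (rule invariant_uniform_measure[OF B(1) b(1) AEB])
    obtain \<nu>' where inv\<nu>': "invariant_prob l \<nu>'" and
      dec: "\<And>w. measure \<mu> (word_cyl l w) = measure \<mu> B * measure \<nu> (word_cyl l w) + (1 - measure \<mu> B) * measure \<nu>' (word_cyl l w)"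
      using uniform_measure_decomposition[OF B(1) b(1) AEB] unfolding \<nu>_def by metis
    have "nonneg_exponent \<nu> H"
      using nonneg_exponent_face[OF inv\<mu> inv\<nu> inv\<nu>' dec b(1) _ subexp ne] b by simp
    moreover have "nonneg_exponent \<nu>' H"
      using nonneg_exponent_face[OF inv\<mu> inv\<nu>' inv\<nu>, of "1 - measure \<mu> B", OF _ _ _ subexp ne] b dec by (simp add: add.commute)
    ultimately have K: "cyl_weight l \<nu> \<in> exponent_weights l H" "cyl_weight l \<nu>' \<in> exponent_weights l H"
      using cyl_weight_in_exponent_weights inv\<nu> inv\<nu>' by blast+
    have "cyl_weight l \<nu> \<in> lex_max (exponent_weights l H) (\<lambda>p. s * p u) n" for n
      using lex_max_face[OF lm[of n] K, of "measure \<mu> B"] dec b by (simp add: cyl_weight_def)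
    with lm have "cyl_weight l \<nu> = cyl_weight l \<mu>" using lex_max_unique by blast
    then have eq: "measure \<nu> (word_cyl l w) = measure \<mu> (word_cyl l w)" for w
      by (metis cyl_weight_def)
    interpret N: invariant_prob l \<nu> by (rule inv\<nu>)
    have "\<nu> = \<mu>"
      by (rule shift_space_measure_eqI[OF N.prob_space_axioms prob_space_axioms N.sets_eq sets_eq eq])
    moreover have "measure \<nu> B = 1"
      unfolding \<nu>_def using b(1) B(1) by (subst measure_uniform_measure) (auto simp: emeasure_eq_measure)
    ultimately show False using b(2) by simp
  qed
qed

text \<open>The factors s = 1 and s = -1 select the largest and the smallest value of the cylinder
  among all measures with nonnegative exponent. Each is attained at an ergodic one, so both equal
  \<open>\<gamma>\<close>.\<close>

theorem ergodic_cyl_weight: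
  assumes subexp: "\<And>\<eta>. \<eta> > 0 \<Longrightarrow> \<exists>C. \<forall>w\<in>lists {1..l}. H w \<le> C * (1 + \<eta>) ^ length w"
    and erg: "\<And>\<mu>. invariant_prob l \<mu> \<Longrightarrow> nonneg_exponent \<mu> H \<Longrightarrow> ergodic \<mu> \<Longrightarrow> measure \<mu> (word_cyl l u) = \<gamma>"
    and inv\<mu>: "invariant_prob l \<mu>" and ne: "nonneg_exponent \<mu> H"
  shows "measure \<mu> (word_cyl l u) = \<gamma>"
proof -
  let ?K = "exponent_weights l H"
  have \<mu>K: "cyl_weight l \<mu> \<in> ?K" using cyl_weight_in_exponent_weights[OF inv\<mu>] ne by blast
  have *: "s * measure \<mu> (word_cyl l u) \<le> s * \<gamma>" for s :: real
  proof -
    have cont: "continuous_on UNIV (\<lambda>p. s * p u)" by (intro continuous_intros continuous_on_coordinate)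
    obtain p where p: "\<And>n. p \<in> lex_max ?K (\<lambda>p. s * p u) n"
      using lex_max_nonempty[OF compact_exponent_weights _ cont] \<mu>K by blast
    have p0: "p \<in> argmax_on ?K (\<lambda>p. s * p u)" using p[of 0] by simp
    then have "p \<in> ?K" by (simp add: argmax_on_def)
    then obtain \<nu> where \<nu>: "invariant_prob l \<nu>" "cyl_weight l \<nu> = p" "nonneg_exponent \<nu> H"
      using exponent_weights_imp_measure by blast
    have "ergodic \<nu>" by (rule lex_max_ergodic[OF subexp \<nu>(1,3), of s u]) (auto simp: \<nu>(2) p)
    then have "p u = \<gamma>" using erg[OF \<nu>(1,3)] \<nu>(2) by (metis cyl_weight_def)
    then show ?thesis using p0 \<mu>K by (auto simp: argmax_on_def cyl_weight_def)
  qed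
  show ?thesis using *[of 1] *[of "-1"] by simp
qed

end

section \<open>Empirical frequencies of words along an orbit\<close>

definition empirical :: "(nat \<Rightarrow> nat) \<Rightarrow> nat \<Rightarrow> nat list \<Rightarrow> real" where
  "empirical x N w = (\<Sum>k<N. if initial_word (length w) ((shift ^^ k) x) = w then 1 else 0) / real N"

lemma empirical_bounds: "empirical x N w \<in> {0..1}"
proof -
  have "(\<Sum>k<N. if initial_word (length w) ((shift ^^ k) x) = w then 1 else 0) \<le> (\<Sum>k<N. 1::real)"
    by (intro sum_mono) auto
  then show ?thesis
    unfolding empirical_def by (cases "N = 0") (auto intro!: divide_nonneg_nonneg sum_nonneg simp: divide_le_eq)
qed

lemma sum_indicator_word:
  fixes G :: "nat list \<Rightarrow> real"
  assumes "y \<in> full_shift l"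
  shows "(\<Sum>w\<in>words l n. (if initial_word (length w) y = w then 1 else 0) * G w) = G (initial_word n y)"
proof -
  have "(\<Sum>w\<in>words l n. (if initial_word (length w) y = w then 1 else 0) * G w) =
      (\<Sum>w\<in>words l n. if w = initial_word n y then G w else 0)"
    by (intro sum.cong) (auto simp: words_def)
  also have "\<dots> = G (initial_word n y)"
    using initial_word_in_words[OF assms, of n] by (simp add: sum.delta)
  finally show ?thesis .
qed

lemma empirical_sum:
  fixes G :: "nat list \<Rightarrow> real"
  assumes x: "x \<in> full_shift l"
  shows "(\<Sum>w\<in>words l n. empirical x N w * G w) = (\<Sum>k<N. G (initial_word n ((shift ^^ k) x))) / real N"
proof -
  have "(\<Sum>w\<in>words l n. empirical x N w * G w) =
      (\<Sum>w\<in>words l n. \<Sum>k<N. (if initial_word (length w) ((shift ^^ k) x) = w then 1 else 0) * G w / real N)"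
    by (intro sum.cong) (auto simp: empirical_def sum_distrib_right sum_divide_distrib simp flip: times_divide_eq_left)
  also have "\<dots> = (\<Sum>k<N. (\<Sum>w\<in>words l n. (if initial_word (length w) ((shift ^^ k) x) = w then 1 else 0) * G w) / real N)"
    by (subst sum.swap) (simp only: sum_divide_distrib)
  also have "\<dots> = (\<Sum>k<N. G (initial_word n ((shift ^^ k) x))) / real N"
    by (simp only: sum_indicator_word[OF shift_funpow_full_shift[OF x]] sum_divide_distrib)
  finally show ?thesis .
qed

text \<open>Occurrences are counted by their starting place below N and may read letters beyond it,
  so appending a letter leaves no boundary term.\<close>

lemma empirical_snoc:
  assumes x: "x \<in> full_shift l"
  shows "empirical x N w = (\<Sum>a\<in>{1..l}. empirical x N (w @ [a]))"
proof -
  have *: "(\<Sum>a\<in>{1..l}. if initial_word (length (w @ [a])) y = w @ [a] then 1 else 0) =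
      (if initial_word (length w) y = w then 1 else (0::real))" if y: "y \<in> full_shift l" for y
  proof -
    have "(\<Sum>a\<in>{1..l}. if initial_word (length (w @ [a])) y = w @ [a] then 1 else 0) =
        (\<Sum>a\<in>{1..l}. if y (length w) = a then (if initial_word (length w) y = w then 1 else 0) else (0::real))"
      by (intro sum.cong) (auto simp: initial_word_Suc)
    also have "\<dots> = (if initial_word (length w) y = w then 1 else 0)"
      using y by (subst sum.delta') (auto simp: full_shift_def)
    finally show ?thesis .
  qed
  have "(\<Sum>a\<in>{1..l}. empirical x N (w @ [a])) =
      (\<Sum>k<N. \<Sum>a\<in>{1..l}. if initial_word (length (w @ [a])) ((shift ^^ k) x) = w @ [a] then 1 else 0) / real N"
    unfolding empirical_def sum_divide_distrib[symmetric] by (subst sum.swap) (rule refl)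
  also have "\<dots> = empirical x N w"
    unfolding *[OF shift_funpow_full_shift[OF x]] empirical_def ..
  finally show ?thesis by simp
qed

text \<open>Prepending a letter moves the count by one place, and the difference of the two sums
  telescopes to its first and last terms; invariance holds up to 1/N.\<close>

lemma empirical_Cons:
  assumes x: "x \<in> full_shift l"
  shows "\<bar>empirical x N w - (\<Sum>a\<in>{1..l}. empirical x N (a # w))\<bar> \<le> 1 / real N"
proof -
  let ?i = "\<lambda>k. if initial_word (length w) ((shift ^^ k) x) = w then 1 else (0::real)"
  have *: "(\<Sum>a\<in>{1..l}. if initial_word (length (a # w)) y = a # w then 1 else 0) =
      (if initial_word (length w) (shift y) = w then 1 else (0::real))" if y: "y \<in> full_shift l" for y
  proof -
    have "(\<Sum>a\<in>{1..l}. if initial_word (length (a # w)) y = a # w then 1 else 0) =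
        (\<Sum>a\<in>{1..l}. if y 0 = a then (if initial_word (length w) (shift y) = w then 1 else 0) else (0::real))"
      by (intro sum.cong) (auto simp: initial_word_Suc_shift)
    also have "\<dots> = (if initial_word (length w) (shift y) = w then 1 else 0)"
      using y by (subst sum.delta') (auto simp: full_shift_def)
    finally show ?thesis .
  qed
  have "(\<Sum>a\<in>{1..l}. empirical x N (a # w)) =
      (\<Sum>k<N. \<Sum>a\<in>{1..l}. if initial_word (length (a # w)) ((shift ^^ k) x) = a # w then 1 else 0) / real N"
    unfolding empirical_def sum_divide_distrib[symmetric] by (subst sum.swap) (rule refl)
  also have "\<dots> = (\<Sum>k<N. ?i (Suc k)) / real N"
    unfolding *[OF shift_funpow_full_shift[OF x]] by simp
  finally have "empirical x N w - (\<Sum>a\<in>{1..l}. empirical x N (a # w)) = ((\<Sum>k<N. ?i k) - (\<Sum>k<N. ?i (Suc k))) / real N"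
    by (simp add: empirical_def diff_divide_distrib)
  also have "(\<Sum>k<N. ?i k) - (\<Sum>k<N. ?i (Suc k)) = ?i 0 - ?i N"
    using sum_lessThan_telescope'[of ?i N] by (simp only: sum_subtractf)
  finally show ?thesis by (auto simp: abs_le_iff divide_right_mono)
qed

text \<open>After cancellation only 2 m terms remain, each of them small compared with N.\<close>

lemma telescoped_average_tendsto:
  fixes b :: "nat \<Rightarrow> real"
  assumes b: "(\<lambda>n. b n / real n) \<longlonglongrightarrow> 0"
  shows "(\<lambda>N. (\<Sum>n<N. b (n + m) - b n) / real N) \<longlonglongrightarrow> 0"
proof -
  have eq: "(\<Sum>n<N. b (n + m) - b n) = (\<Sum>j<m. b (j + N)) - (\<Sum>j<m. b j)" for N
  proof (induction N)
    case (Suc N)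
    have "(\<Sum>j<m. b (j + Suc N)) = (\<Sum>j<Suc m. b (j + N)) - b N"
      by (subst sum.lessThan_Suc_shift) simp
    then show ?case using Suc by (simp add: add.commute)
  qed simp
  have "(\<lambda>N. b (j + N) / real N) \<longlonglongrightarrow> 0" for j
  proof -
    have "(\<lambda>N. b (N + j) / real (N + j)) \<longlonglongrightarrow> 0" using LIMSEQ_ignore_initial_segment[OF b] .
    moreover have "(\<lambda>N. 1 + real j * (1 / real N)) \<longlonglongrightarrow> 1 + real j * 0"
      by (intro tendsto_intros lim_1_over_n)
    ultimately have "(\<lambda>N. b (N + j) / real (N + j) * (1 + real j * (1 / real N))) \<longlonglongrightarrow> 0 * (1 + real j * 0)"
      by (rule tendsto_mult)
    then have "(\<lambda>N. b (N + j) / real (N + j) * (1 + real j * (1 / real N))) \<longlonglongrightarrow> 0" by simp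
    then show ?thesis
    proof (rule Lim_transform_eventually)
      show "eventually (\<lambda>N. b (N + j) / real (N + j) * (1 + real j * (1 / real N)) = b (j + N) / real N) sequentially"
        using eventually_gt_at_top[of 0]
      proof eventually_elim
        case (elim N)
        then have "1 + real j * (1 / real N) = real (N + j) / real N" by (simp add: field_simps)
        then show ?case using elim by (simp add: add.commute)
      qed
    qed
  qed
  then have "(\<lambda>N. (\<Sum>j<m. b (j + N) / real N)) \<longlonglongrightarrow> (\<Sum>j<m. 0)" by (intro tendsto_sum)
  moreover have "(\<lambda>N. (\<Sum>j<m. b j) * (1 / real N)) \<longlonglongrightarrow> (\<Sum>j<m. b j) * 0"
    by (intro tendsto_intros lim_1_over_n)
  ultimately have "(\<lambda>N. (\<Sum>j<m. b (j + N) / real N) - (\<Sum>j<m. b j) * (1 / real N)) \<longlonglongrightarrow> (\<Sum>j<m. 0) - (\<Sum>j<m. b j) * 0"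
    by (rule tendsto_diff)
  then show ?thesis by (simp add: eq diff_divide_distrib sum_divide_distrib)
qed

text \<open>Submultiplicativity bounds the increment of \<open>ln H\<close> over m letters from
  place n by the truncated logarithm of the block read there. Averaged over n, the increments tend
  to 0 and the blocks give the sum over words, which is therefore nonnegative in the limit.\<close>

lemma (in submultiplicative) empirical_limit_in_exponent_weights:
  assumes x: "x \<in> full_shift l" and pos: "\<And>n. H (initial_word n x) > 0"
    and growth: "(\<lambda>n. ln (H (initial_word n x)) / real n) \<longlonglongrightarrow> 0"
    and r: "strict_mono r" and lim: "\<And>w. (\<lambda>n. empirical x (r n) w) \<longlonglongrightarrow> p w"
  shows "p \<in> exponent_weights l H"
proof -
  have r_top: "filterlim r at_top sequentially" by (rule filterlim_subseq[OF r])
  have inv0: "(\<lambda>n. 1 / real (r n)) \<longlonglongrightarrow> 0" by (rule filterlim_compose[OF lim_1_over_n r_top])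
  have "word_weights l p"
  proof
    show "0 \<le> p w" for w
      using LIMSEQ_le_const[OF lim[of w]] empirical_bounds[of x] by simp
    show "p [] = 1"
    proof (rule LIMSEQ_unique[OF lim])
      have "eventually (\<lambda>n. 1 = empirical x (r n) []) sequentially"
        using eventually_compose_filterlim[OF eventually_gt_at_top[of 0] r_top]
        by eventually_elim (simp add: empirical_def)
      then show "(\<lambda>n. empirical x (r n) []) \<longlonglongrightarrow> 1" by (rule Lim_transform_eventually[OF tendsto_const])
    qed
    fix w assume "w \<in> lists {1..l}"
    have "(\<lambda>n. \<Sum>a\<in>{1..l}. empirical x (r n) (w @ [a])) \<longlonglongrightarrow> (\<Sum>a\<in>{1..l}. p (w @ [a]))"
      by (intro tendsto_sum lim)
    then show "p w = (\<Sum>a\<in>{1..l}. p (w @ [a]))"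
      using LIMSEQ_unique[OF lim[of w]] empirical_snoc[OF x, of _ w] by simp
    have "(\<lambda>n. empirical x (r n) w - (\<Sum>a\<in>{1..l}. empirical x (r n) (a # w))) \<longlonglongrightarrow> p w - (\<Sum>a\<in>{1..l}. p (a # w))"
      by (intro tendsto_diff tendsto_sum lim)
    moreover have "(\<lambda>n. empirical x (r n) w - (\<Sum>a\<in>{1..l}. empirical x (r n) (a # w))) \<longlonglongrightarrow> 0"
      by (rule Lim_null_comparison[OF _ inv0]) (use empirical_Cons[OF x] in auto)
    ultimately show "p w = (\<Sum>a\<in>{1..l}. p (a # w))" using LIMSEQ_unique by fastforce
  qed
  moreover have "p w = 0" if "w \<notin> lists {1..l}" for w
  proof -
    have "initial_word (length w) ((shift ^^ k) x) \<noteq> w" for k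
      using initial_word_in_words[OF shift_funpow_full_shift[OF x, of k], of "length w"] that by (auto simp: words_def)
    then have "empirical x N w = 0" for N by (simp add: empirical_def)
    then show ?thesis using LIMSEQ_unique[OF lim[of w]] by simp
  qed
  moreover have "0 \<le> (\<Sum>w\<in>words l m. p w * ln (max (H w) \<delta>))" if \<delta>: "\<delta> > 0" for m \<delta>
  proof -
    define b where "b n = ln (H (initial_word n x))" for n
    have step: "b (n + m) - b n \<le> ln (max (H (initial_word m ((shift ^^ n) x))) \<delta>)" for n
    proof -
      have "H (initial_word (n + m) x) \<le> H (initial_word n x) * H (initial_word m ((shift ^^ n) x))"
        unfolding initial_word_add
        using initial_word_in_words[OF x, of n] initial_word_in_words[OF shift_funpow_full_shift[OF x, of n], of m]
        by (intro H_append) (auto simp: words_def)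
      also have "\<dots> \<le> H (initial_word n x) * max (H (initial_word m ((shift ^^ n) x))) \<delta>"
        by (intro mult_left_mono) (auto simp: H_nonneg)
      finally have "b (n + m) \<le> ln (H (initial_word n x) * max (H (initial_word m ((shift ^^ n) x))) \<delta>)"
        unfolding b_def using pos by (intro ln_mono) auto
      also have "\<dots> = b n + ln (max (H (initial_word m ((shift ^^ n) x))) \<delta>)"
        unfolding b_def using pos \<delta> by (intro ln_mult_pos) (auto simp: less_max_iff_disj)
      finally show ?thesis by simp
    qed
    have "(\<lambda>n. (\<Sum>k<r n. b (k + m) - b k) / real (r n)) \<longlonglongrightarrow> 0"
      using growth unfolding b_def[symmetric]
      by (intro filterlim_compose[OF telescoped_average_tendsto r_top])
    moreover have "(\<lambda>n. \<Sum>w\<in>words l m. empirical x (r n) w * ln (max (H w) \<delta>)) \<longlonglongrightarrow>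
        (\<Sum>w\<in>words l m. p w * ln (max (H w) \<delta>))"
      by (intro tendsto_sum tendsto_mult lim tendsto_const)
    moreover have "(\<Sum>k<r n. b (k + m) - b k) / real (r n) \<le> (\<Sum>w\<in>words l m. empirical x (r n) w * ln (max (H w) \<delta>))" for n
      unfolding empirical_sum[OF x] by (intro divide_right_mono sum_mono step) auto
    ultimately show ?thesis using LIMSEQ_le by blast
  qed
  ultimately show ?thesis by (simp add: exponent_weights_def)
qed

text \<open>Every subsequence has a further one that converges at all words, and its limit is the
  weight function of a measure with nonnegative exponent, whose value at u is
  \<open>\<gamma>\<close>.\<close>

theorem (in submultiplicative) empirical_tendsto:
  assumes x: "x \<in> full_shift l" and pos: "\<And>n. H (initial_word n x) > 0"
    and growth: "(\<lambda>n. ln (H (initial_word n x)) / real n) \<longlonglongrightarrow> 0"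
    and all: "\<And>\<mu>. invariant_prob l \<mu> \<Longrightarrow> nonneg_exponent \<mu> H \<Longrightarrow> measure \<mu> (word_cyl l u) = \<gamma>"
  shows "(\<lambda>N. empirical x N u) \<longlonglongrightarrow> \<gamma>"
proof (rule ccontr)
  assume "\<not> ?thesis"
  then obtain e where e: "e > 0" "\<And>n0. \<exists>n\<ge>n0. e \<le> dist (empirical x n u) \<gamma>"
    unfolding lim_sequentially by (meson not_le)
  obtain r :: "nat \<Rightarrow> nat" where r: "strict_mono r" "\<And>n. e \<le> dist (empirical x (r n) u) \<gamma>"
  proof -
    have inf: "infinite {n. e \<le> dist (empirical x n u) \<gamma>}"
      unfolding infinite_nat_iff_unbounded_le using e(2) by blast
    show thesis
      using that[of "enumerate {n. e \<le> dist (empirical x n u) \<gamma>}"] strict_mono_enumerate[OF inf] enumerate_in_set[OF inf] by blast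
  qed
  obtain s p where s: "strict_mono (s :: nat \<Rightarrow> nat)" "\<And>w. (\<lambda>n. empirical x (r (s n)) w) \<longlonglongrightarrow> p w"
    using seq_compact_unit_cube[of "\<lambda>n. empirical x (r n)"] empirical_bounds by metis
  have "p \<in> exponent_weights l H"
    by (rule empirical_limit_in_exponent_weights[OF x pos growth, of "r \<circ> s"])
      (use strict_mono_o[OF r(1) s(1)] s(2) in \<open>auto simp: comp_def\<close>)
  then obtain \<mu> where \<mu>: "invariant_prob l \<mu>" "cyl_weight l \<mu> = p" "nonneg_exponent \<mu> H"
    using exponent_weights_imp_measure by blast
  then have "p u = \<gamma>" using all[OF \<mu>(1,3)] by (metis cyl_weight_def)
  then have "(\<lambda>n. dist (empirical x (r (s n)) u) \<gamma>) \<longlonglongrightarrow> 0"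
    using tendsto_dist[OF s(2)[of u] tendsto_const[of \<gamma>]] by simp
  then have "e \<le> 0" using r(2) by (intro LIMSEQ_le_const) auto
  with e(1) show False by simp
qed

section \<open>The joint spectral radius\<close>

text \<open>Fekete's lemma, the limit being the infimum of the roots; roots instead of logarithms
  admit \<open>a n = 0\<close>. The bound \<open>K * s ^ n\<close> is kept because it becomes the
  subexponential growth of the scaled products.\<close>

lemma submultiplicative_root_converges:
  fixes a :: "nat \<Rightarrow> real"
  assumes nn: "\<And>n. 0 \<le> a n" and a0: "a 0 \<le> 1" and sub: "\<And>m n. a (m + n) \<le> a m * a n"
  obtains r where "0 \<le> r" "(\<lambda>n. root n (a n)) \<longlonglongrightarrow> r" "\<And>s. s > r \<Longrightarrow> \<exists>K>0. \<forall>n. a n \<le> K * s ^ n"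
proof -
  define R where "R = (\<lambda>n. root n (a n)) ` {1..}"
  have R0: "0 \<le> y" if "y \<in> R" for y using that nn by (auto simp: R_def)
  have bdd: "bdd_below R" using R0 by (rule bdd_belowI)
  have Rne: "R \<noteq> {}" by (auto simp: R_def)
  define r where "r = Inf R"
  have r0: "0 \<le> r" unfolding r_def by (rule cInf_greatest[OF Rne R0])
  have r_le: "r \<le> root n (a n)" if "n \<ge> 1" for n
    unfolding r_def using that by (intro cInf_lower[OF _ bdd]) (auto simp: R_def)
  have pw: "a (q * m) \<le> a m ^ q" for q m
  proof (induction q)
    case (Suc q)
    have "a (Suc q * m) \<le> a m * a (q * m)" using sub[of m "q * m"] by simp
    also have "\<dots> \<le> a m * a m ^ q" using Suc nn by (intro mult_left_mono) auto
    finally show ?case by simp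
  qed (use a0 in simp)
  have growth: "\<exists>K>0. \<forall>n. a n \<le> K * s ^ n" if s: "s > r" for s
  proof -
    obtain y where "y \<in> R" "y < s" using cInf_lessD[OF Rne] s unfolding r_def by blast
    then obtain m where m: "m \<ge> 1" "root m (a m) < s" by (auto simp: R_def)
    have s0: "s > 0" using s r0 by simp
    have am: "a m \<le> s ^ m"
      using m nn power_mono[of "root m (a m)" s m] by (simp add: real_root_pow_pos2)
    \<comment> \<open>Dividing n by m leaves a remainder below m; the sum covers all remainders, and
      the 1 makes K positive even if the sum vanishes.\<close>
    define K where "K = 1 + (\<Sum>t<m. a t / s ^ t)"
    have K: "K > 0" using nn s0 unfolding K_def by (intro add_pos_nonneg sum_nonneg) auto
    have "a n \<le> K * s ^ n" for n
    proof -
      define q t where "q = n div m" and "t = n mod m"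
      have n: "n = q * m + t" and t: "t < m" using m by (auto simp: q_def t_def)
      have "a t / s ^ t \<le> (\<Sum>t<m. a t / s ^ t)" using t nn s0 by (intro member_le_sum) auto
      then have "a t / s ^ t \<le> K" by (simp add: K_def)
      then have at: "a t \<le> K * s ^ t" using s0 by (simp add: divide_le_eq)
      have "a n \<le> a (q * m) * a t" unfolding n by (rule sub)
      also have "\<dots> \<le> (s ^ m) ^ q * (K * s ^ t)"
        using order_trans[OF pw power_mono[OF am nn]] at nn K s0 by (intro mult_mono) auto
      also have "\<dots> = K * s ^ n" by (simp add: n power_add power_mult[symmetric] mult.commute)
      finally show ?thesis .
    qed
    with K show ?thesis by blast
  qed
  have "(\<lambda>n. root n (a n)) \<longlonglongrightarrow> r"
  proof (rule order_tendstoI)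
    fix y assume "y < r"
    show "eventually (\<lambda>n. y < root n (a n)) sequentially"
      using eventually_ge_at_top[of 1] by eventually_elim (use r_le \<open>y < r\<close> in force)
  next
    fix y assume y: "y > r"
    define s where "s = (r + y) / 2"
    have s: "s > r" "s < y" "s > 0" using y r0 by (auto simp: s_def)
    obtain K where K: "K > 0" "\<And>n. a n \<le> K * s ^ n" using growth[OF s(1)] by blast
    have "(\<lambda>n. root n K * s) \<longlonglongrightarrow> 1 * s" by (intro tendsto_intros LIMSEQ_root_const K)
    then have "eventually (\<lambda>n. root n K * s < y) sequentially" using s(2) by (intro order_tendstoD(2)) auto
    then show "eventually (\<lambda>n. root n (a n) < y) sequentially"
      using eventually_ge_at_top[of 1]
    proof eventually_elim
      case (elim n)
      have "root n (a n) \<le> root n (K * s ^ n)" using elim K(2) by (intro real_root_le_mono) auto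
      also have "\<dots> = root n K * s" using elim s by (simp add: real_root_mult real_root_power_cancel)
      finally show ?case using elim by simp
    qed
  qed
  with r0 growth show thesis using that by blast
qed

section \<open>Norms of matrix products\<close>

lemma linear_matrix_vector: "linear (\<lambda>v. (M :: complex^'d^'d) *v v)"
proof (rule linearI)
  show "M *v (x + y) = M *v x + M *v y" for x y by (rule matrix_vector_right_distrib)
  show "M *v (c *\<^sub>R x) = c *\<^sub>R (M *v x)" for c x
    by (simp add: vec_eq_iff matrix_vector_mult_def scaleR_sum_right)
qed

lemma bounded_linear_matrix_vector: "bounded_linear (\<lambda>v. (M :: complex^'d^'d) *v v)"
  using linear_matrix_vector by (simp add: linear_conv_bounded_linear)

lemma op_norm_nonneg: "0 \<le> op_norm M"
  unfolding op_norm_def by (rule onorm_pos_le[OF bounded_linear_matrix_vector])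

lemma op_norm_bound: "norm (M *v v) \<le> op_norm M * norm v"
  unfolding op_norm_def by (rule onorm[OF bounded_linear_matrix_vector])

lemma op_norm_mult: "op_norm (M ** N) \<le> op_norm M * op_norm N"
  unfolding op_norm_def
  using onorm_compose[OF bounded_linear_matrix_vector bounded_linear_matrix_vector, of M N]
  by (simp add: comp_def matrix_vector_mul_assoc)

lemma op_norm_mat_1: "op_norm (mat 1 :: complex^'d^'d) \<le> 1"
proof -
  have "(\<lambda>v. mat 1 *v v) = (\<lambda>v :: complex^'d. v)" by (simp add: fun_eq_iff)
  then show ?thesis unfolding op_norm_def by (metis onorm_id_le)
qed

lemma word_prod_append: "word_prod A (u @ w) = word_prod A u ** word_prod A w"
  by (induction u) (simp_all add: word_prod_def matrix_mul_assoc)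

lemma cocycle_eq: "cocycle A x n = word_prod A (rev (initial_word n x))"
  by (induction n) (simp_all add: word_prod_def initial_word_Suc)

definition max_norm :: "(nat \<Rightarrow> complex^'d^'d) \<Rightarrow> nat \<Rightarrow> nat \<Rightarrow> real" where
  "max_norm A l n = Max ((\<lambda>w. op_norm (word_prod A w)) ` words l n)"

lemma words_nonempty: "1 \<le> l \<Longrightarrow> words l n \<noteq> {}"
  by (auto simp: words_def intro!: exI[of _ "replicate n 1"])

lemma op_norm_le_max_norm: "w \<in> words l n \<Longrightarrow> op_norm (word_prod A w) \<le> max_norm A l n"
  unfolding max_norm_def by (intro Max_ge) auto

lemma jsr_props:
  fixes A :: "nat \<Rightarrow> complex^'d^'d"
  assumes l: "1 \<le> l"
  shows jsr_nonneg: "0 \<le> jsr A l"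
    and jsr_limit: "(\<lambda>n. root n (max_norm A l n)) \<longlonglongrightarrow> jsr A l"
    and jsr_growth: "s > jsr A l \<Longrightarrow> \<exists>K>0. \<forall>n. max_norm A l n \<le> K * s ^ n"
proof -
  have nn: "0 \<le> max_norm A l n" for n
    using words_nonempty[OF l, of n] op_norm_le_max_norm op_norm_nonneg order_trans by blast
  have sub: "max_norm A l (m + n) \<le> max_norm A l m * max_norm A l n" for m n
    unfolding max_norm_def[of A l "m + n"]
  proof (rule Max.boundedI)
    fix y assume "y \<in> (\<lambda>w. op_norm (word_prod A w)) ` words l (m + n)"
    then obtain w where w: "w \<in> words l (m + n)" "y = op_norm (word_prod A w)" by blast
    have uv: "take m w \<in> words l m" "drop m w \<in> words l n"
      using w(1) by (auto simp: words_def dest: in_set_takeD in_set_dropD)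
    have "y \<le> op_norm (word_prod A (take m w)) * op_norm (word_prod A (drop m w))"
      using op_norm_mult[of "word_prod A (take m w)" "word_prod A (drop m w)"]
      by (simp add: w(2) flip: word_prod_append)
    also have "\<dots> \<le> max_norm A l m * max_norm A l n"
      by (intro mult_mono op_norm_le_max_norm uv nn op_norm_nonneg)
    finally show "y \<le> max_norm A l m * max_norm A l n" .
  qed (use words_nonempty[OF l] in auto)
  have a0: "max_norm A l 0 \<le> 1" using op_norm_mat_1 by (simp add: max_norm_def word_prod_def)
  obtain r where r: "0 \<le> r" "(\<lambda>n. root n (max_norm A l n)) \<longlonglongrightarrow> r"
    "\<And>s. s > r \<Longrightarrow> \<exists>K>0. \<forall>n. max_norm A l n \<le> K * s ^ n"
    using submultiplicative_root_converges[of "max_norm A l", OF nn a0 sub] by blast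
  \<comment> \<open>\<open>root 0\<close> is constantly 0, so n = 0 needs no exception when root and
    maximum are exchanged.\<close>
  have mono: "mono (root n)" for n
    by (cases "n = 0") (auto simp: mono_def)
  have "Max {root n (op_norm (word_prod A w)) | w. length w = n \<and> set w \<subseteq> {1..l}} = root n (max_norm A l n)" for n
  proof -
    have "{root n (op_norm (word_prod A w)) | w. length w = n \<and> set w \<subseteq> {1..l}} =
        root n ` (\<lambda>w. op_norm (word_prod A w)) ` words l n"
      by (auto simp: words_def)
    then show ?thesis
      unfolding max_norm_def using words_nonempty[OF l, of n]
      by (simp add: mono_Max_commute[OF mono])
  qed
  then have "jsr A l = r" unfolding jsr_def using limI[OF r(2)] by simp
  with r show "0 \<le> jsr A l" "(\<lambda>n. root n (max_norm A l n)) \<longlonglongrightarrow> jsr A l"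
    "s > jsr A l \<Longrightarrow> \<exists>K>0. \<forall>n. max_norm A l n \<le> K * s ^ n" by auto
qed

section \<open>Extended integrals of logarithms\<close>

lemma ext_integral_mono:
  assumes "\<And>x. x \<in> space M \<Longrightarrow> f x \<le> g x"
  shows "ext_integral M f \<le> ext_integral M g"
  unfolding ext_integral_def
proof (rule ereal_minus_mono)
  show "enn2ereal (\<integral>\<^sup>+ x. e2ennreal (f x) \<partial>M) \<le> enn2ereal (\<integral>\<^sup>+ x. e2ennreal (g x) \<partial>M)"
    using assms by (simp add: less_eq_ennreal.rep_eq[symmetric] nn_integral_mono e2ennreal_mono)
  show "enn2ereal (\<integral>\<^sup>+ x. e2ennreal (- g x) \<partial>M) \<le> enn2ereal (\<integral>\<^sup>+ x. e2ennreal (- f x) \<partial>M)"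
    using assms by (simp add: less_eq_ennreal.rep_eq[symmetric] nn_integral_mono e2ennreal_mono)
qed

lemma ext_integral_cong_AE:
  assumes "AE x in M. f x = g x"
  shows "ext_integral M f = ext_integral M g"
proof -
  have "(\<integral>\<^sup>+ x. e2ennreal (f x) \<partial>M) = (\<integral>\<^sup>+ x. e2ennreal (g x) \<partial>M)"
    using assms by (intro nn_integral_cong_AE) auto
  moreover have "(\<integral>\<^sup>+ x. e2ennreal (- f x) \<partial>M) = (\<integral>\<^sup>+ x. e2ennreal (- g x) \<partial>M)"
    using assms by (intro nn_integral_cong_AE) auto
  ultimately show ?thesis by (simp add: ext_integral_def)
qed

lemma ext_integral_real:
  assumes "integrable M g"
  shows "ext_integral M (\<lambda>x. ereal (g x)) = ereal (\<integral>x. g x \<partial>M)"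
proof -
  obtain r q where rq: "0 \<le> r" "0 \<le> q" "(\<integral>\<^sup>+ x. ennreal (g x) \<partial>M) = ennreal r"
    "(\<integral>\<^sup>+ x. ennreal (- g x) \<partial>M) = ennreal q" "(\<integral>x. g x \<partial>M) = r - q"
    using integrableE[OF assms] by metis
  then show ?thesis unfolding ext_integral_def by (simp add: e2ennreal_ereal)
qed

context shift_prob
begin

lemma ext_log_le_truncated:
  "0 \<le> y \<Longrightarrow> 0 < \<delta> \<Longrightarrow> ext_log y \<le> ereal (ln (max y \<delta>))"
  by (auto simp: ext_log_def intro!: ln_mono)

lemma ext_integral_le:
  assumes G: "\<And>w. 0 \<le> G w" and M: "M > 0" "\<And>w. w \<in> words l n \<Longrightarrow> G w \<le> M"
  shows "ext_integral \<mu> (\<lambda>x. ext_log (G (initial_word n x))) \<le> ereal (ln M)"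
proof -
  have "ext_integral \<mu> (\<lambda>x. ext_log (G (initial_word n x))) \<le> ext_integral \<mu> (\<lambda>x. ereal (ln M))"
  proof (rule ext_integral_mono)
    fix x assume "x \<in> space \<mu>"
    then have "max (G (initial_word n x)) M = M" using M(2)[OF initial_word_in_words, of x] by simp
    then show "ext_log (G (initial_word n x)) \<le> ereal (ln M)"
      using ext_log_le_truncated[OF G M(1), of "initial_word n x"] by simp
  qed
  also have "\<dots> = ereal (ln M)" using ext_integral_real[of \<mu> "\<lambda>_. ln M"] prob_space by simp
  finally show ?thesis .
qed

text \<open>At time n the function G takes finitely many values. If it vanished on a set of positive
  measure, the truncated integrals would tend to minus infinity as \<open>\<delta>\<close>
  decreases; otherwise a level below all positive values changes nothing almost everywhere.\<close>

lemma ext_integral_ge_iff: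
  assumes G: "\<And>w. 0 \<le> G w"
  shows "ereal c \<le> ext_integral \<mu> (\<lambda>x. ext_log (G (initial_word n x))) \<longleftrightarrow>
    (\<forall>\<delta>>0. c \<le> (\<integral>x. ln (max (G (initial_word n x)) \<delta>) \<partial>\<mu>))"
proof (intro iffI allI impI)
  fix \<delta> :: real assume c: "ereal c \<le> ext_integral \<mu> (\<lambda>x. ext_log (G (initial_word n x)))" and \<delta>: "\<delta> > 0"
  have "ext_integral \<mu> (\<lambda>x. ext_log (G (initial_word n x))) \<le>
      ext_integral \<mu> (\<lambda>x. ereal (ln (max (G (initial_word n x)) \<delta>)))"
    by (rule ext_integral_mono) (rule ext_log_le_truncated[OF G \<delta>])
  also have "\<dots> = ereal (\<integral>x. ln (max (G (initial_word n x)) \<delta>) \<partial>\<mu>)"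
    by (rule ext_integral_real) (rule integral_initial_word(1)[of "\<lambda>w. ln (max (G w) \<delta>)"])
  finally have "ereal c \<le> ereal (\<integral>x. ln (max (G (initial_word n x)) \<delta>) \<partial>\<mu>)" using c by (rule order_trans[rotated])
  then show "c \<le> (\<integral>x. ln (max (G (initial_word n x)) \<delta>) \<partial>\<mu>)" by simp
next
  assume tr: "\<forall>\<delta>>0. c \<le> (\<integral>x. ln (max (G (initial_word n x)) \<delta>) \<partial>\<mu>)"
  define F where "F w = (if G w = 0 then 1 else (0::real))" for w
  have F0: "0 \<le> F w" for w by (simp add: F_def)
  define m where "m = (\<integral>x. F (initial_word n x) \<partial>\<mu>)"
  have m0: "0 \<le> m" unfolding m_def by (rule Bochner_Integration.integral_nonneg) (rule F0)
  have "m = 0"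
  proof (rule ccontr)
    assume "m \<noteq> 0"
    with m0 have m: "m > 0" by simp
    define B where "B = (\<Sum>w\<in>words l n. \<bar>ln (max (G w) 1)\<bar>)"
    \<comment> \<open>At level \<open>exp (- real t)\<close> the zeros of G, a set of measure m,
      contribute - t m, while B bounds the rest.\<close>
    obtain t :: nat where t: "B - c < real t * m" using reals_Archimedean3[OF m] by blast
    have "c \<le> (\<integral>x. ln (max (G (initial_word n x)) (exp (- real t))) \<partial>\<mu>)" using tr by simp
    also have "\<dots> \<le> (\<integral>x. B - real t * F (initial_word n x) \<partial>\<mu>)"
    proof (rule integral_mono)
      fix x assume "x \<in> space \<mu>"
      then have w: "initial_word n x \<in> words l n" by (simp add: initial_word_in_words)
      let ?w = "initial_word n x"
      have "ln (max (G ?w) (exp (- real t))) \<le> ln (max (G ?w) 1)"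
        by (intro ln_mono max.mono) (auto simp: less_max_iff_disj)
      also have "\<dots> \<le> \<bar>ln (max (G ?w) 1)\<bar>" by simp
      also have "\<dots> \<le> B" unfolding B_def using w by (intro member_le_sum) auto
      finally have 1: "ln (max (G ?w) (exp (- real t))) \<le> B" .
      have B0: "0 \<le> B" unfolding B_def by (intro sum_nonneg) auto
      show "ln (max (G ?w) (exp (- real t))) \<le> B - real t * F ?w"
        using 1 B0 by (cases "G ?w = 0") (auto simp: F_def)
    qed (use integral_initial_word(1)[of "\<lambda>w. ln (max (G w) (exp (- real t)))"] integral_initial_word(1)[of F] in auto)
    also have "\<dots> = B - real t * m"
      using integral_initial_word(1)[of F n] prob_space by (simp add: m_def)
    finally show False using t by simp
  qed
  then have AEF: "AE x in \<mu>. F (initial_word n x) = 0"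
    using integral_nonneg_eq_0_iff_AE[OF integral_initial_word(1)[of F n]] F0 unfolding m_def by simp
  \<comment> \<open>The 1 keeps P nonempty in case G has no positive value.\<close>
  define P where "P = insert 1 (G ` {w \<in> words l n. G w > 0})"
  define \<delta> where "\<delta> = Min P"
  have P: "finite P" "P \<noteq> {}" by (auto simp: P_def)
  have \<delta>: "\<delta> > 0" unfolding \<delta>_def using P by (subst Min_gr_iff) (auto simp: P_def)
  have "AE x in \<mu>. ext_log (G (initial_word n x)) = ereal (ln (max (G (initial_word n x)) \<delta>))"
    using AEF AE_space
  proof eventually_elim
    fix x assume "F (initial_word n x) = 0" "x \<in> space \<mu>"
    then have w: "G (initial_word n x) \<noteq> 0" "initial_word n x \<in> words l n"
      by (auto simp: F_def initial_word_in_words split: if_splits)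
    with G[of "initial_word n x"] have "G (initial_word n x) \<in> P" by (auto simp: P_def)
    then have "\<delta> \<le> G (initial_word n x)" unfolding \<delta>_def using P(1) by (intro Min_le)
    then show "ext_log (G (initial_word n x)) = ereal (ln (max (G (initial_word n x)) \<delta>))"
      using w by (simp add: ext_log_def max_def)
  qed
  then have "ext_integral \<mu> (\<lambda>x. ext_log (G (initial_word n x))) =
      ext_integral \<mu> (\<lambda>x. ereal (ln (max (G (initial_word n x)) \<delta>)))"
    by (rule ext_integral_cong_AE)
  also have "\<dots> = ereal (\<integral>x. ln (max (G (initial_word n x)) \<delta>) \<partial>\<mu>)"
    by (rule ext_integral_real) (rule integral_initial_word(1)[of "\<lambda>w. ln (max (G w) \<delta>)"])
  finally show "ereal c \<le> ext_integral \<mu> (\<lambda>x. ext_log (G (initial_word n x)))" using tr \<delta> by simp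
qed

end

section \<open>Equivalence of the extremality conditions\<close>

text \<open>The word is reversed because the cocycle multiplies each new matrix on the left, whereas
  \<open>word_prod\<close> puts the head of the list on the left.\<close>

definition scaled_word :: "(nat \<Rightarrow> complex^'d^'d) \<Rightarrow> real \<Rightarrow> nat list \<Rightarrow> complex^'d \<Rightarrow> complex^'d" where
  "scaled_word A r w v = (1 / r ^ length w) *\<^sub>R (word_prod A (rev w) *v v)"

lemma onorm_scaled_word: "r > 0 \<Longrightarrow> onorm (scaled_word A r w) = op_norm (word_prod A (rev w)) / r ^ length w"
  unfolding scaled_word_def op_norm_def by (subst onorm_scaleR[OF bounded_linear_matrix_vector]) simp

lemma onorm_scaled_word_cocycle:
  "r > 0 \<Longrightarrow> onorm (scaled_word A r (initial_word n x)) = op_norm (cocycle A x n) / r ^ n"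
  by (simp add: onorm_scaled_word cocycle_eq)

lemma subexponential_scaled_word:
  assumes l: "1 \<le> l" and pos: "jsr A l > 0"
  shows "subexponential_words l (scaled_word A (jsr A l))"
proof (intro subexponential_words.intro linear_words.intro subexponential_words_axioms.intro)
  let ?\<rho> = "jsr A l"
  fix u w :: "nat list" and v
  show "linear (scaled_word A ?\<rho> w)"
    unfolding scaled_word_def by (intro linear_compose_scale_right linear_matrix_vector)
  show "scaled_word A ?\<rho> [] v = v" by (simp add: scaled_word_def word_prod_def)
  show "scaled_word A ?\<rho> (u @ w) v = scaled_word A ?\<rho> w (scaled_word A ?\<rho> u v)"
    by (simp add: scaled_word_def word_prod_append matrix_vector_mul_assoc[symmetric]
        linear_scale[OF linear_matrix_vector] power_add)
next
  let ?\<rho> = "jsr A l"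
  fix \<eta> :: real assume "\<eta> > 0"
  then have "?\<rho> * (1 + \<eta>) > ?\<rho>" using pos by simp
  then obtain K where K: "K > 0" "\<And>n. max_norm A l n \<le> K * (?\<rho> * (1 + \<eta>)) ^ n" using jsr_growth[OF l] by blast
  have "onorm (scaled_word A ?\<rho> w) \<le> K * (1 + \<eta>) ^ length w" if "w \<in> lists {1..l}" for w
  proof -
    have "rev w \<in> words l (length w)" using that by (auto simp: words_def)
    then have "op_norm (word_prod A (rev w)) \<le> K * (?\<rho> * (1 + \<eta>)) ^ length w"
      using op_norm_le_max_norm K(2) order_trans by blast
    then show ?thesis using pos by (simp add: onorm_scaled_word divide_le_eq power_mult_distrib mult_ac)
  qed
  then show "\<exists>C. \<forall>w\<in>lists {1..l}. onorm (scaled_word A ?\<rho> w) \<le> C * (1 + \<eta>) ^ length w" by blast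
qed

text \<open>The bound \<open>K * s ^ n\<close> costs \<open>ln K / n\<close> at time n, which
  vanishes in the limit. Comparing with s above the radius, not with the radius itself, also covers
  radius 0, where s may be arbitrarily small.\<close>

lemma INF_exponent_le:
  assumes l: "1 \<le> l" and inv: "shift_prob l \<mu>" and s: "s > jsr A l"
  shows "(INF n\<in>{1..}. ereal (1 / real n) * ext_integral \<mu> (\<lambda>x. ext_log (op_norm (cocycle A x n)))) \<le> ereal (ln s)"
proof -
  interpret shift_prob l \<mu> by fact
  have s0: "s > 0" using s jsr_nonneg[OF l, of A] by simp
  obtain K where K: "K > 0" "\<And>n. max_norm A l n \<le> K * s ^ n" using jsr_growth[OF l s] by blast
  let ?E = "\<lambda>n. ereal (1 / real n) * ext_integral \<mu> (\<lambda>x. ext_log (op_norm (cocycle A x n)))"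
  have le: "?E n \<le> ereal (ln K * (1 / real n) + ln s)" if n: "n \<ge> 1" for n
  proof -
    have "op_norm (word_prod A (rev w)) \<le> K * s ^ n" if "w \<in> words l n" for w
    proof -
      have "rev w \<in> words l n" using that by (auto simp: words_def)
      then show ?thesis using op_norm_le_max_norm K(2) order_trans by blast
    qed
    then have "ext_integral \<mu> (\<lambda>x. ext_log (op_norm (cocycle A x n))) \<le> ereal (ln (K * s ^ n))"
      unfolding cocycle_eq using ext_integral_le[of "\<lambda>w. op_norm (word_prod A (rev w))" "K * s ^ n" n] K(1) s0
      by (simp add: op_norm_nonneg)
    then have "?E n \<le> ereal (1 / real n) * ereal (ln (K * s ^ n))"
      by (intro ereal_mult_left_mono) auto
    also have "\<dots> = ereal (ln K * (1 / real n) + ln s)"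
      using n K(1) s0 by (simp add: ln_mult ln_realpow field_simps)
    finally show ?thesis .
  qed
  have "(\<lambda>n. ereal (ln K * (1 / real n) + ln s)) \<longlonglongrightarrow> ereal (ln K * 0 + ln s)"
    by (intro tendsto_ereal tendsto_intros lim_1_over_n)
  moreover have "eventually (\<lambda>n. (INF n\<in>{1..}. ?E n) \<le> ereal (ln K * (1 / real n) + ln s)) sequentially"
    using eventually_ge_at_top[of 1]
  proof eventually_elim
    case (elim n)
    then have "(INF n\<in>{1..}. ?E n) \<le> ?E n" by (intro INF_lower) simp
    also note le[OF elim]
    finally show ?case .
  qed
  ultimately have "(INF n\<in>{1..}. ?E n) \<le> ereal (ln K * 0 + ln s)"
    by (intro tendsto_lowerbound[where F = sequentially]) auto
  then show ?thesis by simp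
qed

lemma max_measures_zero:
  assumes l: "1 \<le> l" and z: "jsr A l = 0"
  shows "\<mu> \<in> max_measures A l \<longleftrightarrow> invariant_prob l \<mu>"
proof -
  have "(INF n\<in>{1..}. ereal (1 / real n) * ext_integral \<mu> (\<lambda>x. ext_log (op_norm (cocycle A x n)))) = - \<infinity>"
    if "invariant_prob l \<mu>"
  proof (rule ereal_bot)
    interpret invariant_prob l \<mu> by fact
    fix B :: real
    show "(INF n\<in>{1..}. ereal (1 / real n) * ext_integral \<mu> (\<lambda>x. ext_log (op_norm (cocycle A x n)))) \<le> ereal B"
      using INF_exponent_le[OF l shift_prob_axioms, of A "exp B"] z by simp
  qed
  then show ?thesis unfolding max_measures_def invariant_measures_iff by (auto simp: z ext_log_def)
qed

text \<open>Letting s decrease to the radius shows that the infimum never exceeds the logarithm of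
  the radius, so a measure is maximising when every term is at least that logarithm. Scaling the
  matrices turns this into nonnegativity.\<close>

lemma max_measures_pos:
  assumes l: "1 \<le> l" and pos: "jsr A l > 0"
  shows "\<mu> \<in> max_measures A l \<longleftrightarrow>
    invariant_prob l \<mu> \<and> nonneg_exponent \<mu> (\<lambda>w. onorm (scaled_word A (jsr A l) w))"
proof -
  let ?\<rho> = "jsr A l"
  let ?E = "\<lambda>n. ext_integral \<mu> (\<lambda>x. ext_log (op_norm (cocycle A x n)))"
  have "(INF n\<in>{1..}. ereal (1 / real n) * ?E n) = ext_log ?\<rho> \<longleftrightarrow>
      nonneg_exponent \<mu> (\<lambda>w. onorm (scaled_word A ?\<rho> w))" if "invariant_prob l \<mu>"
  proof -
    interpret invariant_prob l \<mu> by fact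
    have up: "(INF n\<in>{1..}. ereal (1 / real n) * ?E n) \<le> ereal (ln ?\<rho>)"
    proof (rule tendsto_lowerbound)
      show "((\<lambda>s. ereal (ln s)) \<longlongrightarrow> ereal (ln ?\<rho>)) (at_right ?\<rho>)"
        using pos by (intro tendsto_ereal tendsto_ln tendsto_ident_at) auto
      show "eventually (\<lambda>s. (INF n\<in>{1..}. ereal (1 / real n) * ?E n) \<le> ereal (ln s)) (at_right ?\<rho>)"
        using eventually_at_right_less by (rule eventually_mono) (rule INF_exponent_le[OF l shift_prob_axioms])
    qed simp
    have scale: "ereal (ln ?\<rho>) \<le> ereal (1 / real n) * ?E n \<longleftrightarrow> ereal (real n * ln ?\<rho>) \<le> ?E n" if n: "n \<ge> 1" for n
      using n by (cases "?E n") (auto simp: field_simps)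
    have trunc: "ereal (real n * ln ?\<rho>) \<le> ?E n \<longleftrightarrow>
      (\<forall>\<delta>>0. 0 \<le> (\<integral>x. ln (max (onorm (scaled_word A ?\<rho> (initial_word n x))) \<delta>) \<partial>\<mu>))" for n
    proof -
      define G where "G w = op_norm (word_prod A (rev w))" for w
      \<comment> \<open>Scaling moves the truncation level along: level \<open>\<delta>\<close> for
        the scaled word is level \<open>\<delta> * ?\<rho> ^ n\<close> for the matrix
        product.\<close>
      have conv: "(\<integral>x. ln (max (onorm (scaled_word A ?\<rho> (initial_word n x))) \<delta>) \<partial>\<mu>) =
          (\<integral>x. ln (max (G (initial_word n x)) (\<delta> * ?\<rho> ^ n)) \<partial>\<mu>) - real n * ln ?\<rho>" if \<delta>: "\<delta> > 0" for \<delta>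
      proof -
        have "ln (max (onorm (scaled_word A ?\<rho> (initial_word n x))) \<delta>) =
            ln (max (G (initial_word n x)) (\<delta> * ?\<rho> ^ n)) - real n * ln ?\<rho>" for x
        proof -
          have p: "?\<rho> ^ n > 0" using pos by simp
          have "max (onorm (scaled_word A ?\<rho> (initial_word n x))) \<delta> = max (G (initial_word n x)) (\<delta> * ?\<rho> ^ n) / ?\<rho> ^ n"
            using p pos by (simp add: onorm_scaled_word[OF pos] G_def max_divide_distrib_right)
          moreover have "max (G (initial_word n x)) (\<delta> * ?\<rho> ^ n) > 0" using p \<delta> by (simp add: less_max_iff_disj)
          ultimately show ?thesis using p pos by (simp add: ln_div ln_realpow)
        qed
        then show ?thesis
          using integral_initial_word(1)[of "\<lambda>w. ln (max (G w) (\<delta> * ?\<rho> ^ n))" n] prob_space by simp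
      qed
      have "ereal (real n * ln ?\<rho>) \<le> ?E n \<longleftrightarrow>
          (\<forall>\<delta>>0. real n * ln ?\<rho> \<le> (\<integral>x. ln (max (G (initial_word n x)) \<delta>) \<partial>\<mu>))"
        unfolding cocycle_eq G_def[symmetric]
        by (rule ext_integral_ge_iff) (simp add: G_def op_norm_nonneg)
      also have "\<dots> \<longleftrightarrow> (\<forall>\<delta>>0. real n * ln ?\<rho> \<le> (\<integral>x. ln (max (G (initial_word n x)) (\<delta> * ?\<rho> ^ n)) \<partial>\<mu>))"
      proof (intro iffI allI impI)
        fix \<delta> :: real
        assume h: "\<forall>\<delta>>0. real n * ln ?\<rho> \<le> (\<integral>x. ln (max (G (initial_word n x)) (\<delta> * ?\<rho> ^ n)) \<partial>\<mu>)" and \<delta>: "\<delta> > 0"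
        have "\<delta> / ?\<rho> ^ n > 0" "\<delta> / ?\<rho> ^ n * ?\<rho> ^ n = \<delta>" using \<delta> pos by simp_all
        then show "real n * ln ?\<rho> \<le> (\<integral>x. ln (max (G (initial_word n x)) \<delta>) \<partial>\<mu>)" using h by metis
      qed (use pos in simp)
      also have "\<dots> \<longleftrightarrow> (\<forall>\<delta>>0. 0 \<le> (\<integral>x. ln (max (onorm (scaled_word A ?\<rho> (initial_word n x))) \<delta>) \<partial>\<mu>))"
        using conv by auto
      finally show ?thesis .
    qed
    have "(INF n\<in>{1..}. ereal (1 / real n) * ?E n) = ext_log ?\<rho> \<longleftrightarrow>
        ereal (ln ?\<rho>) \<le> (INF n\<in>{1..}. ereal (1 / real n) * ?E n)"
      using up pos by (auto simp: ext_log_def)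
    also have "\<dots> \<longleftrightarrow> (\<forall>n\<ge>1. ereal (ln ?\<rho>) \<le> ereal (1 / real n) * ?E n)"
      by (simp add: le_INF_iff Ball_def)
    also have "\<dots> \<longleftrightarrow> nonneg_exponent \<mu> (\<lambda>w. onorm (scaled_word A ?\<rho> w))"
      unfolding nonneg_exponent_def using scale trunc by auto
    finally show ?thesis .
  qed
  then show ?thesis unfolding max_measures_def invariant_measures_iff by blast
qed

lemma has_frequency_iff:
  assumes "x \<in> full_shift l"
  shows "has_frequency l i \<gamma> x \<longleftrightarrow> (\<lambda>N. empirical x N [i]) \<longlonglongrightarrow> \<gamma>"
proof -
  have "indicator (cyl l i) ((shift ^^ k) x) = (if initial_word (length [i]) ((shift ^^ k) x) = [i] then 1 else (0::real))" for k
    using shift_funpow_full_shift[OF assms, of k] by (auto simp: cyl_def initial_word_def split: split_indicator)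
  then show ?thesis unfolding has_frequency_def empirical_def by (simp add: divide_inverse mult.commute)
qed

lemma (in invariant_prob) AE_frequency_imp_measure:
  assumes "AE x in \<mu>. has_frequency l i \<gamma> x"
  shows "measure \<mu> (cyl l i) = \<gamma>"
proof -
  let ?f = "\<lambda>n x. 1 / real n * (\<Sum>k<n. indicator (cyl l i) ((shift ^^ k) x) :: real)"
  have C: "cyl l i \<in> sets \<mu>" by simp
  have meas: "(\<lambda>x. indicator (cyl l i) ((shift ^^ k) x) :: real) \<in> borel_measurable \<mu>" for k
  proof (rule measurable_compose[of "shift ^^ k" \<mu> \<mu>])
    show "shift ^^ k \<in> \<mu> \<rightarrow>\<^sub>M \<mu>" by measurable
  qed (use C in measurable)
  have "(\<lambda>n. \<integral>x. ?f n x \<partial>\<mu>) \<longlonglongrightarrow> (\<integral>x. \<gamma> \<partial>\<mu>)"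
  proof (rule integral_dominated_convergence[where w = "\<lambda>_. 1"])
    show "?f n \<in> borel_measurable \<mu>" for n using meas by measurable
    show "AE x in \<mu>. (\<lambda>n. ?f n x) \<longlonglongrightarrow> \<gamma>" using assms by (simp add: has_frequency_def)
    show "AE x in \<mu>. norm (?f n x) \<le> 1" for n
    proof (rule AE_I2)
      fix x
      have s: "0 \<le> (\<Sum>k<n. indicator (cyl l i) ((shift ^^ k) x) :: real)" by (intro sum_nonneg) auto
      have "(\<Sum>k<n. indicator (cyl l i) ((shift ^^ k) x)) \<le> (\<Sum>k<n. 1::real)"
        by (intro sum_mono) (auto simp: indicator_def)
      then show "norm (?f n x) \<le> 1" using s by (cases "n = 0") (auto simp: divide_le_eq)
    qed
  qed auto
  moreover have "(\<integral>x. ?f n x \<partial>\<mu>) = measure \<mu> (cyl l i)" if "n \<ge> 1" for n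
  proof -
    have int: "integrable \<mu> (\<lambda>x. indicator (cyl l i) ((shift ^^ k) x) :: real)" for k
      by (rule integrable_const_bound[of _ 1]) (use meas in \<open>auto simp: indicator_def\<close>)
    have "(\<integral>x. ?f n x \<partial>\<mu>) = 1 / real n * (\<Sum>k<n. \<integral>x. indicator (cyl l i) ((shift ^^ k) x) \<partial>\<mu>)"
      using int by simp
    also have "\<dots> = 1 / real n * (\<Sum>k<n. \<integral>x. indicator (cyl l i) x \<partial>\<mu>)"
      using C by (intro arg_cong2[where f = "(*)"] refl sum.cong integral_shift_funpow) auto
    also have "\<dots> = measure \<mu> (cyl l i)" using that sets.sets_into_space[OF C] by (simp add: Int_absorb2)
    finally show ?thesis .
  qed
  then have "eventually (\<lambda>n. (\<integral>x. ?f n x \<partial>\<mu>) = measure \<mu> (cyl l i)) sequentially"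
    unfolding eventually_sequentially by blast
  ultimately have "(\<lambda>n::nat. measure \<mu> (cyl l i)) \<longlonglongrightarrow> (\<integral>x. \<gamma> \<partial>\<mu>)"
    by (rule Lim_transform_eventually)
  then show ?thesis using LIMSEQ_unique[OF tendsto_const] prob_space by simp
qed

text \<open>The lower bound loses only the n-th root of \<open>\<epsilon>\<close>, which tends to 1;
  from above the maximum over all words of length n serves.\<close>

lemma strongly_imp_weakly_extremal:
  assumes l: "1 \<le> l" and "strongly_extremal A l x"
  shows "weakly_extremal A l x"
proof -
  obtain \<epsilon> where x: "x \<in> full_shift l" and \<epsilon>: "\<epsilon> > 0" "\<And>n. n \<ge> 1 \<Longrightarrow> \<epsilon> * jsr A l ^ n \<le> op_norm (cocycle A x n)"
    using assms(2) by (auto simp: strongly_extremal_def)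
  have "(\<lambda>n. root n (op_norm (cocycle A x n))) \<longlonglongrightarrow> jsr A l"
  proof (rule tendsto_sandwich)
    show "eventually (\<lambda>n. root n \<epsilon> * jsr A l \<le> root n (op_norm (cocycle A x n))) sequentially"
      using eventually_ge_at_top[of 1]
    proof eventually_elim
      case (elim n)
      have "root n \<epsilon> * jsr A l = root n (\<epsilon> * jsr A l ^ n)"
        using elim jsr_nonneg[OF l, of A] by (simp add: real_root_mult real_root_power_cancel)
      also have "\<dots> \<le> root n (op_norm (cocycle A x n))" using elim \<epsilon>(2) by (intro real_root_le_mono) auto
      finally show ?case .
    qed
    show "eventually (\<lambda>n. root n (op_norm (cocycle A x n)) \<le> root n (max_norm A l n)) sequentially"
      using eventually_ge_at_top[of 1]
    proof eventually_elim
      case (elim n)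
      have "rev (initial_word n x) \<in> words l n" using initial_word_in_words[OF x, of n] by (auto simp: words_def)
      then show ?case
        unfolding cocycle_eq using elim by (intro real_root_le_mono op_norm_le_max_norm) auto
    qed
    have "(\<lambda>n. root n \<epsilon> * jsr A l) \<longlonglongrightarrow> 1 * jsr A l" by (intro tendsto_intros LIMSEQ_root_const \<epsilon>)
    then show "(\<lambda>n. root n \<epsilon> * jsr A l) \<longlonglongrightarrow> jsr A l" by simp
  qed (rule jsr_limit[OF l])
  with x show ?thesis by (simp add: weakly_extremal_def)
qed

section \<open>Equivalence of norms and Kozyakin extremal points\<close>

lemma norm_equivalence:
  fixes N :: "'a::euclidean_space \<Rightarrow> real"
  assumes nn: "\<And>v. 0 \<le> N v" and zero: "\<And>v. N v = 0 \<longleftrightarrow> v = 0"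
    and scale: "\<And>a v. N (a *\<^sub>R v) = \<bar>a\<bar> * N v" and tri: "\<And>u v. N (u + v) \<le> N u + N v"
  obtains c C where "c > 0" "C > 0" "\<And>v. c * norm v \<le> N v" "\<And>v. N v \<le> C * norm v" "continuous_on UNIV N"
proof -
  define C where "C = 1 + (\<Sum>b\<in>Basis. N b)"
  have C0: "C > 0" using nn unfolding C_def by (intro add_pos_nonneg sum_nonneg) auto
  have N_sum: "N (\<Sum>b\<in>B. g b) \<le> (\<Sum>b\<in>B. N (g b))" if "finite B" for B and g :: "'a \<Rightarrow> 'a"
    using that
  proof induction
    case (insert b B)
    then show ?case using tri[of "g b" "\<Sum>b\<in>B. g b"] by simp
  qed (use zero[of 0] in simp)
  have C: "N v \<le> C * norm v" for v
  proof -
    have "N v = N (\<Sum>b\<in>Basis. (v \<bullet> b) *\<^sub>R b)" by (simp add: euclidean_representation)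
    also have "\<dots> \<le> (\<Sum>b\<in>Basis. \<bar>v \<bullet> b\<bar> * N b)" using N_sum[of Basis "\<lambda>b. (v \<bullet> b) *\<^sub>R b"] by (simp add: scale)
    also have "\<dots> \<le> (\<Sum>b\<in>Basis. norm v * N b)" by (intro sum_mono mult_right_mono Basis_le_norm nn)
    also have "\<dots> = norm v * (\<Sum>b\<in>Basis. N b)" by (simp add: sum_distrib_left)
    also have "\<dots> \<le> C * norm v" by (simp add: C_def distrib_right mult.commute[of "norm v"])
    finally show ?thesis .
  qed
  have diff: "\<bar>N u - N v\<bar> \<le> C * norm (u - v)" for u v
    using tri[of v "u - v"] tri[of u "v - u"] C[of "u - v"] C[of "v - u"] by (simp add: norm_minus_commute)
  have cont: "continuous_on UNIV N"
  proof (rule continuous_onI)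
    fix u :: 'a and e :: real assume "e > 0"
    then show "\<exists>d>0. \<forall>v\<in>UNIV. dist v u < d \<longrightarrow> dist (N v) (N u) \<le> e"
      using C0 diff by (intro exI[of _ "e / C"])
        (force simp: dist_norm field_simps intro: order_trans[OF diff])
  qed
  have "compact (sphere (0::'a) 1)" "sphere (0::'a) 1 \<noteq> {}" by auto
  then obtain s where s: "s \<in> sphere 0 1" "\<And>v. v \<in> sphere 0 1 \<Longrightarrow> N s \<le> N v"
    using continuous_attains_inf[of "sphere 0 1" N] continuous_on_subset[OF cont] by blast
  have Ns: "N s > 0" using s(1) zero[of s] nn[of s] by (cases "s = 0") (auto simp: less_le)
  have "N s * norm v \<le> N v" for v
  proof (cases "v = 0")
    case False
    then have "N s \<le> N ((1 / norm v) *\<^sub>R v)" by (intro s(2)) simp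
    then show ?thesis using False by (simp add: scale field_simps)
  qed (simp add: nn)
  with that[of "N s" C] Ns C0 C cont show thesis by blast
qed

lemma is_norm_equivalence:
  fixes N :: "complex^'d \<Rightarrow> real"
  assumes "is_norm N"
  obtains c C where "c > 0" "C > 0" "\<And>v. c * norm v \<le> N v" "\<And>v. N v \<le> C * norm v"
    "continuous_on UNIV N" "\<And>a v. N (a *\<^sub>R v) = \<bar>a\<bar> * N v"
proof -
  have n: "\<And>v. 0 \<le> N v" "\<And>v. N v = 0 \<longleftrightarrow> v = 0" "\<And>c v. N (c *s v) = cmod c * N v" "\<And>u v. N (u + v) \<le> N u + N v"
    using assms by (auto simp: is_norm_def)
  have scale: "N (a *\<^sub>R v) = \<bar>a\<bar> * N v" for a v
  proof -
    have "a *\<^sub>R v = complex_of_real a *s v" by (simp add: vec_eq_iff) (simp add: scaleR_conv_of_real)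
    then show ?thesis using n(3) by simp
  qed
  show thesis using norm_equivalence[OF n(1,2) scale n(4)] that scale by metis
qed

lemma kozyakin_imp_strongly_extremal:
  assumes "kozyakin_extremal A l x"
  shows "strongly_extremal A l x"
proof -
  obtain N v where x: "x \<in> full_shift l" and N: "is_norm N" "N v = 1"
    and eq: "\<And>n. n \<ge> 1 \<Longrightarrow> N (cocycle A x n *v v) = jsr A l ^ n"
    using assms by (auto simp: kozyakin_extremal_def barabanov_norm_def)
  obtain c C where C: "C > 0" "\<And>v. N v \<le> C * norm v" using is_norm_equivalence[OF N(1)] by metis
  have "N v = 0 \<longleftrightarrow> v = 0" using N(1) unfolding is_norm_def by blast
  then have v: "norm v > 0" using N(2) by simp
  \<comment> \<open>The Barabanov norm is at most C times the Euclidean one, so its exact growth on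
    the single vector v bounds the operator norm from below with this constant.\<close>
  have "1 / (C * norm v) * jsr A l ^ n \<le> op_norm (cocycle A x n)" if "n \<ge> 1" for n
  proof -
    have "jsr A l ^ n \<le> C * norm (cocycle A x n *v v)" using eq[OF that] C(2) by metis
    also have "\<dots> \<le> C * (op_norm (cocycle A x n) * norm v)"
      using C(1) op_norm_bound by (intro mult_left_mono) auto
    finally show ?thesis using C(1) v by (simp add: field_simps)
  qed
  then show ?thesis
    unfolding strongly_extremal_def using x C(1) v by (auto intro!: exI[of _ "1 / (C * norm v)"])
qed

lemma AE_strongly_extremal:
  assumes l: "1 \<le> l" and \<mu>: "\<mu> \<in> max_measures A l"
  shows "AE x in \<mu>. strongly_extremal A l x"
proof (cases "jsr A l = 0")
  case True
  interpret invariant_prob l \<mu> using \<mu> max_measures_zero[OF l True] by blast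
  \<comment> \<open>With radius 0 the required lower bound is 0 at every time n \<ge> 1, so
    \<open>\<epsilon>\<close> = 1 works.\<close>
  show ?thesis
    by (rule AE_I2) (auto simp: strongly_extremal_def True op_norm_nonneg power_0_left intro!: exI[of _ 1])
next
  case False
  then have pos: "jsr A l > 0" using jsr_nonneg[OF l, of A] by simp
  have iv: "invariant_prob l \<mu>" and ne: "nonneg_exponent \<mu> (\<lambda>w. onorm (scaled_word A (jsr A l) w))"
    using \<mu> max_measures_pos[OF l pos] by blast+
  interpret invariant_prob l \<mu> by fact
  interpret S: subexponential_words l "scaled_word A (jsr A l)" by (rule subexponential_scaled_word[OF l pos])
  show ?thesis using S.AE_bounded_below[OF iv ne] AE_space
  proof eventually_elim
    fix x assume "\<exists>\<epsilon>>0. \<forall>n. \<epsilon> \<le> onorm (scaled_word A (jsr A l) (initial_word n x))" "x \<in> space \<mu>"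
    then obtain \<epsilon> where "\<epsilon> > 0" "\<forall>n. \<epsilon> \<le> op_norm (cocycle A x n) / jsr A l ^ n" "x \<in> full_shift l"
      unfolding onorm_scaled_word_cocycle[OF pos] space_eq by blast
    then show "strongly_extremal A l x"
      unfolding strongly_extremal_def using pos by (auto simp: le_divide_eq intro!: exI[of _ \<epsilon>])
  qed
qed

text \<open>The Barabanov identity makes each matrix divided by the radius a contraction of N, as
  \<open>AE_extremal_vector\<close> requires. With radius 0 it makes the matrices vanish, and any
  vector of norm one serves at every point.\<close>

lemma AE_kozyakin_extremal:
  fixes A :: "nat \<Rightarrow> complex^'d^'d"
  assumes l: "1 \<le> l" and \<mu>: "\<mu> \<in> max_measures A l" and N: "barabanov_norm A l N"
  shows "AE x in \<mu>. kozyakin_extremal A l x"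
proof -
  have n: "is_norm N" and b: "\<And>v. jsr A l * N v = Max ((\<lambda>i. N (A i *v v)) ` {1..l})"
    using N by (auto simp: barabanov_norm_def)
  have le: "N (A i *v v) \<le> jsr A l * N v" if "i \<in> {1..l}" for i v
    unfolding b using that by (intro Max_ge) auto
  obtain c C where C: "c > 0" "C > 0" "\<And>v. c * norm v \<le> N v" "\<And>v. N v \<le> C * norm v" "continuous_on UNIV N"
    and scale: "\<And>a v. N (a *\<^sub>R v) = \<bar>a\<bar> * N v"
    using is_norm_equivalence[OF n] by metis
  show ?thesis
  proof (cases "jsr A l = 0")
    case True
    interpret invariant_prob l \<mu> using \<mu> max_measures_zero[OF l True] by blast
    obtain v0 :: "complex^'d" where v0: "v0 \<in> Basis" by (metis SOME_Basis)
    define v where "v = (1 / N v0) *\<^sub>R v0"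
    have "N v0 > 0" using v0 C(1,3) nonzero_Basis[OF v0] by (meson less_le_trans mult_pos_pos zero_less_norm_iff)
    then have v: "N v = 1" by (simp add: v_def scale)
    have Az: "A i *v u = 0" if "i \<in> {1..l}" for i u
      using le[OF that, of u] n by (auto simp: True is_norm_def intro: antisym)
    have N0: "N 0 = 0" using n by (simp add: is_norm_def)
    show ?thesis
    proof (rule AE_I2)
      fix x assume "x \<in> space \<mu>"
      then have x: "x \<in> full_shift l" by simp
      have "N (cocycle A x n *v v) = jsr A l ^ n" if n: "n \<ge> 1" for n
      proof -
        obtain m where m: "n = Suc m" using n by (cases n) auto
        show ?thesis using x Az[of "x m"] N0
          by (simp add: m True matrix_vector_mul_assoc[symmetric] full_shift_def)
      qed
      then show "kozyakin_extremal A l x" unfolding kozyakin_extremal_def using x N v by blast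
    qed
  next
    case False
    then have pos: "jsr A l > 0" using jsr_nonneg[OF l, of A] by simp
    have iv: "invariant_prob l \<mu>" and ne: "nonneg_exponent \<mu> (\<lambda>w. onorm (scaled_word A (jsr A l) w))"
      using \<mu> max_measures_pos[OF l pos] by blast+
    interpret invariant_prob l \<mu> by fact
    interpret S: subexponential_words l "scaled_word A (jsr A l)" by (rule subexponential_scaled_word[OF l pos])
    have contr: "N (scaled_word A (jsr A l) w v) \<le> N v" if "w \<in> lists {1..l}" for w v
      using that
    proof (induction w arbitrary: v)
      case Nil
      show ?case by (simp add: S.W_Nil)
    next
      case (Cons a w)
      then have a: "a \<in> {1..l}" by simp
      have "N (scaled_word A (jsr A l) (a # w) v) = N (scaled_word A (jsr A l) w (scaled_word A (jsr A l) [a] v))"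
        using S.W_append[of "[a]" w v] by simp
      also have "\<dots> \<le> N (scaled_word A (jsr A l) [a] v)" using Cons by auto
      also have "\<dots> = N (A a *v v) / jsr A l" using pos by (simp add: scaled_word_def word_prod_def scale)
      also have "\<dots> \<le> N v" using le[OF a, of v] pos by (simp add: divide_le_eq mult.commute)
      finally show ?case .
    qed
    have "AE x in \<mu>. \<exists>v. N v = 1 \<and> (\<forall>n. N (scaled_word A (jsr A l) (initial_word n x) v) = 1)"
      by (rule S.AE_extremal_vector[OF iv ne C(1,3,4,5) scale contr])
    then show ?thesis using AE_space
    proof eventually_elim
      fix x assume "\<exists>v. N v = 1 \<and> (\<forall>n. N (scaled_word A (jsr A l) (initial_word n x) v) = 1)" "x \<in> space \<mu>"
      then obtain v where v: "N v = 1" "\<And>n. N (scaled_word A (jsr A l) (initial_word n x) v) = 1" and x: "x \<in> full_shift l"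
        by auto
      have "N (cocycle A x n *v v) = jsr A l ^ n" for n
        using v(2)[of n] pos by (simp add: scaled_word_def scale cocycle_eq field_simps)
      then show "kozyakin_extremal A l x" unfolding kozyakin_extremal_def using x N v(1) by blast
    qed
  qed
qed

text \<open>
  If the joint spectral radius vanishes, every invariant measure is maximising, which is the case of
  the constant function \<open>1\<close>.
\<close>

lemma max_measures_submultiplicative:
  assumes l: "1 \<le> l"
  obtains H where "submultiplicative l H"
    "\<And>\<eta>. \<eta> > 0 \<Longrightarrow> \<exists>C. \<forall>w\<in>lists {1..l}. H w \<le> C * (1 + \<eta>) ^ length w"
    "\<And>\<mu>. \<mu> \<in> max_measures A l \<longleftrightarrow> invariant_prob l \<mu> \<and> nonneg_exponent \<mu> H"
    "\<And>x n. weakly_extremal A l x \<Longrightarrow> H (initial_word n x) > 0"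
    "\<And>x. weakly_extremal A l x \<Longrightarrow> (\<lambda>n. ln (H (initial_word n x)) / real n) \<longlonglongrightarrow> 0"
proof (cases "jsr A l = 0")
  case True
  have sub: "submultiplicative l (\<lambda>_. 1)" by unfold_locales auto
  have "nonneg_exponent \<mu> (\<lambda>_. 1)" for \<mu>
    unfolding nonneg_exponent_def by (auto intro!: Bochner_Integration.integral_nonneg simp: le_max_iff_disj)
  moreover have "\<exists>C. \<forall>w\<in>lists {1..l}. 1 \<le> C * (1 + \<eta>) ^ length w" if "\<eta> > 0" for \<eta> :: real
    using that by (intro exI[of _ 1]) auto
  ultimately show thesis using that[of "\<lambda>_. 1", OF sub] max_measures_zero[OF l True] by auto
next
  case False
  then have pos: "jsr A l > 0" using jsr_nonneg[OF l, of A] by simp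
  interpret S: subexponential_words l "scaled_word A (jsr A l)" by (rule subexponential_scaled_word[OF l pos])
  \<comment> \<open>A vanishing product makes all later ones vanish, so the roots would tend to 0
    and not to the positive radius.\<close>
  have cpos: "op_norm (cocycle A x n) > 0" if w: "weakly_extremal A l x" for x n
  proof (rule ccontr)
    assume "\<not> ?thesis"
    then have z: "op_norm (cocycle A x n) = 0" using op_norm_nonneg[of "cocycle A x n"] by simp
    have z': "op_norm (cocycle A x (n + k)) = 0" for k
    proof (induction k)
      case (Suc k)
      then show ?case
        using op_norm_mult[of "A (x (n + k))" "cocycle A x (n + k)"]
          op_norm_nonneg[of "A (x (n + k)) ** cocycle A x (n + k)"] by simp
    qed (simp add: z)
    have "eventually (\<lambda>m. root m (op_norm (cocycle A x m)) = 0) sequentially"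
      using eventually_ge_at_top[of n]
    proof eventually_elim
      case (elim m)
      then show ?case using z'[of "m - n"] by simp
    qed
    then have "(\<lambda>m. root m (op_norm (cocycle A x m))) \<longlonglongrightarrow> 0" by (rule tendsto_eventually)
    with w pos show False unfolding weakly_extremal_def using LIMSEQ_unique by force
  qed
  show thesis
  proof (rule that[OF S.submultiplicative_onorm S.subexp])
    show "\<mu> \<in> max_measures A l \<longleftrightarrow> invariant_prob l \<mu> \<and> nonneg_exponent \<mu> (\<lambda>w. onorm (scaled_word A (jsr A l) w))" for \<mu>
      by (rule max_measures_pos[OF l pos])
    fix x assume w: "weakly_extremal A l x"
    show "onorm (scaled_word A (jsr A l) (initial_word n x)) > 0" for n
      using cpos[OF w, of n] pos by (simp add: onorm_scaled_word_cocycle)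
    \<comment> \<open>The logarithm of an n-th root is the logarithm divided by n, so weak
      extremality is the growth condition asked of the scaled products.\<close>
    have "(\<lambda>n. ln (root n (op_norm (cocycle A x n))) - ln (jsr A l)) \<longlonglongrightarrow> ln (jsr A l) - ln (jsr A l)"
      using w pos unfolding weakly_extremal_def by (intro tendsto_diff tendsto_ln tendsto_const) auto
    then have "(\<lambda>n. ln (root n (op_norm (cocycle A x n))) - ln (jsr A l)) \<longlonglongrightarrow> 0" by simp
    then show "(\<lambda>n. ln (onorm (scaled_word A (jsr A l) (initial_word n x))) / real n) \<longlonglongrightarrow> 0"
    proof (rule Lim_transform_eventually)
      show "eventually (\<lambda>n. ln (root n (op_norm (cocycle A x n))) - ln (jsr A l) =
        ln (onorm (scaled_word A (jsr A l) (initial_word n x))) / real n) sequentially"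
        using eventually_gt_at_top[of 0]
      proof eventually_elim
        case (elim n)
        then show ?case
          using cpos[OF w, of n] pos
          by (simp add: onorm_scaled_word_cocycle ln_root ln_div ln_realpow diff_divide_distrib)
      qed
    qed
  qed
qed

theorem proposition6p1:
  fixes A :: "nat \<Rightarrow> complex^'d^'d" and l i :: nat and \<gamma> :: real
  assumes "0 \<le> \<gamma>" and "\<gamma> \<le> 1" and "1 \<le> i" and "i \<le> l"
  shows
    "let P1 = (\<forall>x. weakly_extremal A l x \<longrightarrow> has_frequency l i \<gamma> x);
         P2 = (\<forall>x. strongly_extremal A l x \<longrightarrow> has_frequency l i \<gamma> x);
         P3 = (\<forall>\<mu>\<in>max_measures A l. ergodic \<mu> \<longrightarrow> measure \<mu> (cyl l i) = \<gamma>);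
         P4 = (\<forall>\<mu>\<in>max_measures A l. measure \<mu> (cyl l i) = \<gamma>);
         P5 = (\<forall>x. kozyakin_extremal A l x \<longrightarrow> has_frequency l i \<gamma> x)
     in (P1 \<longleftrightarrow> P2) \<and> (P2 \<longleftrightarrow> P3) \<and> (P3 \<longleftrightarrow> P4) \<and>
        ((\<exists>N. barabanov_norm A l N) \<longrightarrow>
          (P1 \<longleftrightarrow> P5) \<and> (P2 \<longleftrightarrow> P5) \<and> (P3 \<longleftrightarrow> P5) \<and> (P4 \<longleftrightarrow> P5))"
proof -
  define P1 where "P1 = (\<forall>x. weakly_extremal A l x \<longrightarrow> has_frequency l i \<gamma> x)"
  define P2 where "P2 = (\<forall>x. strongly_extremal A l x \<longrightarrow> has_frequency l i \<gamma> x)"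
  define P3 where "P3 = (\<forall>\<mu>\<in>max_measures A l. ergodic \<mu> \<longrightarrow> measure \<mu> (cyl l i) = \<gamma>)"
  define P4 where "P4 = (\<forall>\<mu>\<in>max_measures A l. measure \<mu> (cyl l i) = \<gamma>)"
  define P5 where "P5 = (\<forall>x. kozyakin_extremal A l x \<longrightarrow> has_frequency l i \<gamma> x)"
  have l: "1 \<le> l" using assms(3,4) by simp
  obtain H where sub: "submultiplicative l H"
    and subexp: "\<And>\<eta>. \<eta> > 0 \<Longrightarrow> \<exists>C. \<forall>w\<in>lists {1..l}. H w \<le> C * (1 + \<eta>) ^ length w"
    and mm: "\<And>\<mu>. \<mu> \<in> max_measures A l \<longleftrightarrow> invariant_prob l \<mu> \<and> nonneg_exponent \<mu> H"
    and pos: "\<And>x n. weakly_extremal A l x \<Longrightarrow> H (initial_word n x) > 0"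
    and growth: "\<And>x. weakly_extremal A l x \<Longrightarrow> (\<lambda>n. ln (H (initial_word n x)) / real n) \<longlonglongrightarrow> 0"
    by (rule max_measures_submultiplicative[OF l, of A]) (rule that)
  interpret submultiplicative l H by (rule sub)
  \<comment> \<open>The implications close up as P1, P2, P4, P1, with P3 equivalent to P4. A
    Barabanov norm inserts P5 between P2 and P4: Kozyakin extremal points are strongly extremal, and
    they have full measure for every maximising measure.\<close>
  have "P1 \<Longrightarrow> P2" unfolding P1_def P2_def using strongly_imp_weakly_extremal[OF l] by blast
  moreover have "P2 \<Longrightarrow> P4"
    unfolding P4_def
  proof
    fix \<mu> assume P2 and \<mu>: "\<mu> \<in> max_measures A l"
    interpret invariant_prob l \<mu> using \<mu> mm by blast
    have "AE x in \<mu>. has_frequency l i \<gamma> x"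
      using AE_strongly_extremal[OF l \<mu>] by eventually_elim (use \<open>P2\<close> P2_def in blast)
    then show "measure \<mu> (cyl l i) = \<gamma>" by (rule AE_frequency_imp_measure)
  qed
  moreover have "P4 \<Longrightarrow> P1"
    unfolding P1_def
  proof (intro allI impI)
    fix x assume P4 and x: "weakly_extremal A l x"
    have xs: "x \<in> full_shift l" using x by (simp add: weakly_extremal_def)
    have "(\<lambda>N. empirical x N [i]) \<longlonglongrightarrow> \<gamma>"
      by (rule empirical_tendsto[OF xs pos[OF x] growth[OF x]])
        (use \<open>P4\<close> mm in \<open>auto simp: P4_def word_cyl_singleton\<close>)
    then show "has_frequency l i \<gamma> x" by (simp add: has_frequency_iff[OF xs])
  qed
  moreover have "P4 \<Longrightarrow> P3" unfolding P3_def P4_def by blast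
  moreover have "P3 \<Longrightarrow> P4"
    unfolding P4_def
  proof
    fix \<mu> assume P3 and \<mu>: "\<mu> \<in> max_measures A l"
    have "measure \<mu> (word_cyl l [i]) = \<gamma>"
      by (rule ergodic_cyl_weight[OF subexp]) (use \<open>P3\<close> \<mu> mm in \<open>auto simp: P3_def word_cyl_singleton\<close>)
    then show "measure \<mu> (cyl l i) = \<gamma>" by (simp add: word_cyl_singleton)
  qed
  moreover have "P2 \<Longrightarrow> P5" unfolding P2_def P5_def using kozyakin_imp_strongly_extremal by blast
  moreover have "P5 \<Longrightarrow> P4" if ex: "\<exists>N. barabanov_norm A l N"
    unfolding P4_def
  proof
    obtain N where N: "barabanov_norm A l N" using ex by blast
    fix \<mu> assume P5 and \<mu>: "\<mu> \<in> max_measures A l"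
    interpret invariant_prob l \<mu> using \<mu> mm by blast
    have "AE x in \<mu>. has_frequency l i \<gamma> x"
      using AE_kozyakin_extremal[OF l \<mu> N] by eventually_elim (use \<open>P5\<close> P5_def in blast)
    then show "measure \<mu> (cyl l i) = \<gamma>" by (rule AE_frequency_imp_measure)
  qed
  ultimately show ?thesis
    unfolding Let_def P1_def[symmetric] P2_def[symmetric] P3_def[symmetric] P4_def[symmetric] P5_def[symmetric]
    by blast
qed

end
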